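(* Assume the following conditions. (C1) $\|\boldsymbol{\mu}\|^2/n=O(1)$. (C2) There exists a constant $\kappa_0>0$ such that $\lambda_{\min}(n^{-1}\mathbf{X}_{M_0+1}^{\top}\mathbf{X}_{M_0+1})\ge\kappa_0$ (for all $n$). (C3) There exist constants $0<c_1<c_2<\infty$ such that $\Pr(c_1\le\hat\sigma^2/\sigma^2\le c_2)\to1$. (C4) If $k_{M_0+1}$ is fixed, then $n^{-1}\mathbf{X}_{M_0+1}^{\top}\mathbf{X}_{M_0+1}\to\mathbf{Q}$ and $n^{-1/2}\mathbf{X}_{M_0+1}^{\top}\mathbf{e}\to_d N(\mathbf{0},\sigma^2\mathbf{Q})$, where $\mathbf{Q}$ is a positive definite matrix. Say that asymptotic loss optimality holds if $L_n(\hat{\mathbf{w}})/\inf_{\mathbf{w}\in\mathcal{H}_n}L_n(\mathbf{w})\to_p1$, and that it does not hold if this ratio does not converge in probability to $1$. Then: (i) Consider $\phi_n\to\infty$. If $k_{M_0+1}$ is fixed and $\phi_n^2/n\to0$, then the asymptotic loss optimality does not hold. If $k_{M_0+1}\to\infty$, $\phi_n^2(k_{M_0+1}-k_1)/(n\eta_n)\to0$, and $M_0/(k_{M_0+1}\eta_n)\to0$, then the asymptotic loss optimality holds. (ii) Consider $\phi_n=2$. If $(k_{M_0+1}-k_1)/(n\eta_n)\to0$ and $M_0/(n\eta_n^2)\to0$, then as long as $\sum_{m>M_0+1}\hat w_m^2\left(\frac{\mathbf{e}^{\top}\mathbf{P}_m\mathbf{e}}{\mathbf{e}^{\top}\mathbf{P}_{M_0+1}\mathbf{e}}-1\right)$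 does not converge to $0$ in probability, the asymptotic loss optimality does not hold. If $k_{M_0+1}\to\infty$, $(k_{M_0+1}-k_1)/(n\eta_n)\to0$, $M_0/(k_{M_0+1}\eta_n)\to0$, and $k_{M_n}/k_{M_0+1}\to1$, then the asymptotic loss optimality holds.
   Context: Model. For each sample size $n$, $y_i=\mu_i+e_i$, $\mu_i=\sum_{j=1}^{\infty}\beta_jx_{ij}$, $i=1,\dots,n$, with deterministic covariates $x_{ij}$, unknown coefficients $\beta_j$, and i.i.d. errors $e_i$ with $E(e_i)=0$, $E(e_i^2)=\sigma^2>0$, and $E|e_i|^{4+\zeta}<\infty$ for some $\zeta>0$. Write $\mathbf{y}=(y_1,\dots,y_n)^{\top}$, $\boldsymbol{\mu}=(\mu_1,\dots,\mu_n)^{\top}$, $\mathbf{e}=(e_1,\dots,e_n)^{\top}$, so $\mathbf{y}=\boldsymbol{\mu}+\mathbf{e}$. Candidate models. There are $M_n$ nested candidate models; the $m$th uses the first $k_m$ covariates, where $0<k_1<\cdots<k_{M_n}<n$ are integers. $\mathbf{X}_m$ is the $n\times k_m$ design matrix of the $m$th model, assumed of full column rank, and $\mathbf{P}_m=\mathbf{X}_m(\mathbf{X}_m^{\top}\mathbf{X}_m)^{-1}\mathbf{X}_m^{\top}$. True model. Let $\mathcal{A}_m=\{1,\dots,k_m\}$ and let $\mathcal{A}_m^c$ be its complement. There is an index $M_0$ with $M_0\ge1$ and $M_n>M_0+1$ such that $(\beta_j,\ j\in\mathcal{A}_{M_0+1}\cap\mathcal{A}_{M_0}^c)\ne\mathbf{0}$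 and $\beta_j=0$ for all $j>k_{M_0+1}$. Thus models $1,\dots,M_0$ are under-fitted, model $M_0+1$ is the true model, and models $m>M_0+1$ are over-fitted. Put $\eta_n=\sum_{j\in\mathcal{A}_{M_0+1}\cap\mathcal{A}_{M_0}^c}\beta_j^2$. Dependence on $n$. $M_n$, $M_0$, the $k_m$, and the $\beta_j$ may depend on $n$. When "$k_{M_0+1}$ is fixed", $M_0$, $k_1,\dots,k_{M_0+1}$ and $\beta_1,\dots,\beta_{k_{M_0+1}}$ do not depend on $n$ (in particular $\eta_n^{-1}=O(1)$). All limits are as $n\to\infty$; $\to_p$ and $\to_d$ denote convergence in probability and in distribution. Averaging. $\mathcal{H}_n=\{\mathbf{w}\in[0,1]^{M_n}:\sum_{m=1}^{M_n}w_m=1\}$, $\mathbf{P}(\mathbf{w})=\sum_{m=1}^{M_n}w_m\mathbf{P}_m$, $\hat{\boldsymbol{\mu}}(\mathbf{w})=\mathbf{P}(\mathbf{w})\mathbf{y}$. The weight criterion is $\mathcal{G}_n(\mathbf{w})=\|\{\mathbf{I}_n-\mathbf{P}(\mathbf{w})\}\mathbf{y}\|^2+\phi_n\hat\sigma^2\mathbf{w}^{\top}\mathbf{K}$ with $\hat\sigma^2=(n-k_{M_n})^{-1}\mathbf{y}^{\top}(\mathbf{I}_n-\mathbf{P}_{M_n})\mathbf{y}$, $\mathbf{K}=(k_1,\dots,k_{M_n})^{\top}$, and penalty factor $\phi_n$ (possibly depending on $n$). The selected weight is $\hat{\mathbf{w}}=(\hat w_1,\dots,\hat w_{M_n})^{\top}=\arg\min_{\mathbf{w}\in\mathcal{H}_n}\mathcal{G}_n(\mathbf{w})$.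 The loss is $L_n(\mathbf{w})=\|\boldsymbol{\mu}-\hat{\boldsymbol{\mu}}(\mathbf{w})\|^2$. $\lambda_{\min}$ denotes the minimum eigenvalue, $\|\cdot\|$ the Euclidean norm. *)

theory Defs
  imports
    "HOL-Probability.Probability"
    "HOL-Library.Landau_Symbols"
    "Jordan_Normal_Form.Gauss_Jordan_Elimination"
    "Jordan_Normal_Form.DL_Rank"
    "Jordan_Normal_Form.Spectral_Radius"
begin

hide_type (open) Finite_Cartesian_Product.vec
hide_const (open) Finite_Cartesian_Product.vec Finite_Cartesian_Product.mat
  Determinants.det Cartesian_Space.rank
no_notation Inner_Product.real_inner_class.inner (infix \<open>\<bullet>\<close> 70)
no_notation Finite_Cartesian_Product.vec_nth (infixl \<open>$\<close> 90)

text \<open>Vectors and matrices are those of \<^theory>\<open>Jordan_Normal_Form.Matrix\<close>, whose dimensions are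
  values and whose indices start at 0.\<close>

definition sq_norm2 :: "real vec \<Rightarrow> real" where
  "sq_norm2 v = v \<bullet> v"

definition mat_inv :: "real mat \<Rightarrow> real mat" where
  "mat_inv A = the (mat_inverse A)"

definition full_col_rank :: "real mat \<Rightarrow> bool" where
  "full_col_rank X \<longleftrightarrow> vec_space.rank (dim_row X) X = dim_col X"

definition hat_matrix :: "real mat \<Rightarrow> real mat" where
  "hat_matrix X = X * mat_inv (X\<^sup>T * X) * X\<^sup>T"

text \<open>Only used for symmetric matrices of positive dimension, whose real spectrum is finite and
  nonempty.\<close>

definition lambda_min :: "real mat \<Rightarrow> real" where
  "lambda_min A = Min (spectrum A)"

definition pos_def_mat :: "nat \<Rightarrow> real mat \<Rightarrow> bool" where
  "pos_def_mat d A \<longleftrightarrow> A \<in> carrier_mat d d \<and> A\<^sup>T = A \<and>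
     (\<forall>v \<in> carrier_vec d. v \<noteq> 0\<^sub>v d \<longrightarrow> v \<bullet> (A *\<^sub>v v) > 0)"

definition conv_in_prob :: "'a measure \<Rightarrow> (nat \<Rightarrow> 'a \<Rightarrow> real) \<Rightarrow> real \<Rightarrow> bool" where
  "conv_in_prob \<Omega> X c \<longleftrightarrow>
     (\<forall>\<epsilon>>0. (\<lambda>n. measure \<Omega> {\<omega> \<in> space \<Omega>. \<bar>X n \<omega> - c\<bar> > \<epsilon>}) \<longlonglongrightarrow> 0)"

text \<open>Laws on the Euclidean space of dimension \<open>d\<close> are measures on the product space
  \<open>\<Pi>\<^sub>M i\<in>{..<d}. borel\<close>. Its points are functions on \<open>nat\<close> that are \<open>undefined\<close> from \<open>d\<close> onwards, so
  a random vector is restricted to \<open>{..<d}\<close> before a test function is applied to it. Continuity of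
  the test function refers to the product topology on \<open>nat \<Rightarrow> real\<close>, which induces the Euclidean
  topology on these points.\<close>

definition conv_in_distr ::
  "'a measure \<Rightarrow> nat \<Rightarrow> (nat \<Rightarrow> 'a \<Rightarrow> real vec) \<Rightarrow> (nat \<Rightarrow> real) measure \<Rightarrow> bool" where
  "conv_in_distr \<Omega> d Z N \<longleftrightarrow>
     (\<forall>f :: (nat \<Rightarrow> real) \<Rightarrow> real. continuous_on UNIV f \<and> bounded (range f) \<longrightarrow>
        (\<lambda>n. \<integral>\<omega>. f (\<lambda>i\<in>{..<d}. Z n \<omega> $ i) \<partial>\<Omega>) \<longlonglongrightarrow> (\<integral>u. f u \<partial>N))"

text \<open>The nondegenerate normal law with mean 0 and positive definite covariance matrix \<open>\<Sigma>\<close>.\<close>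

definition mvn :: "nat \<Rightarrow> real mat \<Rightarrow> (nat \<Rightarrow> real) measure" where
  "mvn d \<Sigma> = density (\<Pi>\<^sub>M i\<in>{..<d}. lborel)
     (\<lambda>u. ennreal (exp (- (vec d u \<bullet> (mat_inv \<Sigma> *\<^sub>v vec d u)) / 2) / sqrt ((2 * pi) ^ d * det \<Sigma>)))"

text \<open>The arguments \<open>x i j\<close>, \<open>b j\<close>, \<open>e i\<close>, \<open>K m\<close> and \<open>w m\<close> are numbered from 1, as in mathematical
  notation; hence the shifts by \<^const>\<open>Suc\<close> whenever they become vectors or matrices. Below, \<open>n\<close> is
  the sample size, \<open>b\<close> the coefficient sequence, \<open>K m\<close> the number of covariates in candidate model
  \<open>m\<close>, and \<open>M\<close> the number of candidate models. Values outside the range of the numbering are never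
  used.\<close>

definition design :: "(nat \<Rightarrow> nat \<Rightarrow> real) \<Rightarrow> nat \<Rightarrow> nat \<Rightarrow> real mat" where
  "design x n q = mat n q (\<lambda>(i, j). x (Suc i) (Suc j))"

definition mean_vec :: "(nat \<Rightarrow> nat \<Rightarrow> real) \<Rightarrow> nat \<Rightarrow> (nat \<Rightarrow> real) \<Rightarrow> real vec" where
  "mean_vec x n b = vec n (\<lambda>i. \<Sum>j. b (Suc j) * x (Suc i) (Suc j))"

definition error_vec :: "(nat \<Rightarrow> 'a \<Rightarrow> real) \<Rightarrow> nat \<Rightarrow> 'a \<Rightarrow> real vec" where
  "error_vec e n \<omega> = vec n (\<lambda>i. e (Suc i) \<omega>)"

definition cov_index :: "(nat \<Rightarrow> nat) \<Rightarrow> nat \<Rightarrow> nat set" where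
  "cov_index K m = {1..K m}"

definition proj :: "(nat \<Rightarrow> nat \<Rightarrow> real) \<Rightarrow> nat \<Rightarrow> (nat \<Rightarrow> nat) \<Rightarrow> nat \<Rightarrow> real mat" where
  "proj x n K m = hat_matrix (design x n (K m))"

definition weights :: "nat \<Rightarrow> (nat \<Rightarrow> real) set" where
  "weights M = {w. (\<forall>m\<in>{1..M}. w m \<in> {0..1}) \<and> (\<Sum>m=1..M. w m) = 1}"

definition avg_proj ::
  "(nat \<Rightarrow> nat \<Rightarrow> real) \<Rightarrow> nat \<Rightarrow> (nat \<Rightarrow> nat) \<Rightarrow> nat \<Rightarrow> (nat \<Rightarrow> real) \<Rightarrow> real mat" where
  "avg_proj x n K M w = mat n n (\<lambda>(i, j). \<Sum>m=1..M. w m * proj x n K m $$ (i, j))"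

definition sigma_hat_sq ::
  "(nat \<Rightarrow> nat \<Rightarrow> real) \<Rightarrow> nat \<Rightarrow> (nat \<Rightarrow> nat) \<Rightarrow> nat \<Rightarrow> real vec \<Rightarrow> real" where
  "sigma_hat_sq x n K M y = (y \<bullet> ((1\<^sub>m n - proj x n K M) *\<^sub>v y)) / (real n - real (K M))"

definition weight_criterion ::
  "(nat \<Rightarrow> nat \<Rightarrow> real) \<Rightarrow> nat \<Rightarrow> (nat \<Rightarrow> nat) \<Rightarrow> nat \<Rightarrow> real \<Rightarrow> real vec \<Rightarrow> (nat \<Rightarrow> real) \<Rightarrow> real" where
  "weight_criterion x n K M \<phi> y w =
     sq_norm2 ((1\<^sub>m n - avg_proj x n K M w) *\<^sub>v y)
       + \<phi> * sigma_hat_sq x n K M y * (\<Sum>m=1..M. w m * real (K m))"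

definition avg_loss ::
  "(nat \<Rightarrow> nat \<Rightarrow> real) \<Rightarrow> nat \<Rightarrow> (nat \<Rightarrow> nat) \<Rightarrow> nat \<Rightarrow> real vec \<Rightarrow> real vec \<Rightarrow> (nat \<Rightarrow> real) \<Rightarrow> real" where
  "avg_loss x n K M \<mu> y w = sq_norm2 (\<mu> - avg_proj x n K M w *\<^sub>v y)"

definition response ::
  "(nat \<Rightarrow> nat \<Rightarrow> real) \<Rightarrow> (nat \<Rightarrow> nat \<Rightarrow> real) \<Rightarrow> (nat \<Rightarrow> 'a \<Rightarrow> real) \<Rightarrow> nat \<Rightarrow> 'a \<Rightarrow> real vec" where
  "response x \<beta> e n \<omega> = mean_vec x n (\<beta> n) + error_vec e n \<omega>"

definition iid_errors :: "'a measure \<Rightarrow> (nat \<Rightarrow> 'a \<Rightarrow> real) \<Rightarrow> real \<Rightarrow> bool" where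
  "iid_errors \<Omega> e \<sigma> \<longleftrightarrow>
     prob_space.indep_vars \<Omega> (\<lambda>_. borel) e {1..} \<and>
     (\<forall>i\<ge>1. distr \<Omega> borel (e i) = distr \<Omega> borel (e 1)) \<and>
     (\<forall>i\<ge>1. integrable \<Omega> (e i) \<and> (\<integral>\<omega>. e i \<omega> \<partial>\<Omega>) = 0) \<and>
     (\<forall>i\<ge>1. integrable \<Omega> (\<lambda>\<omega>. (e i \<omega>)\<^sup>2) \<and> (\<integral>\<omega>. (e i \<omega>)\<^sup>2 \<partial>\<Omega>) = \<sigma>\<^sup>2) \<and>
     \<sigma>\<^sup>2 > 0 \<and>
     (\<exists>\<zeta>>0. \<forall>i\<ge>1. integrable \<Omega> (\<lambda>\<omega>. \<bar>e i \<omega>\<bar> powr (4 + \<zeta>)))"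

definition nested_candidates ::
  "(nat \<Rightarrow> nat \<Rightarrow> real) \<Rightarrow> nat \<Rightarrow> (nat \<Rightarrow> nat) \<Rightarrow> nat \<Rightarrow> bool" where
  "nested_candidates x n K M \<longleftrightarrow>
     0 < K 1 \<and> strict_mono_on {1..M} K \<and> K M < n \<and>
     (\<forall>m\<in>{1..M}. full_col_rank (design x n (K m)))"

definition true_model :: "(nat \<Rightarrow> real) \<Rightarrow> (nat \<Rightarrow> nat) \<Rightarrow> nat \<Rightarrow> nat \<Rightarrow> bool" where
  "true_model b K M M0 \<longleftrightarrow>
     1 \<le> M0 \<and> M0 + 1 < M \<and>
     (\<exists>j \<in> cov_index K (M0 + 1) \<inter> - cov_index K M0. b j \<noteq> 0) \<and>
     (\<forall>j > K (M0 + 1). b j = 0)"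

definition signal :: "(nat \<Rightarrow> real) \<Rightarrow> (nat \<Rightarrow> nat) \<Rightarrow> nat \<Rightarrow> real" where
  "signal b K M0 = (\<Sum>j \<in> cov_index K (M0 + 1) \<inter> - cov_index K M0. (b j)\<^sup>2)"

text \<open>The candidate and true model assumptions cannot hold for the first few sample sizes (they force
  \<open>n \<ge> 4\<close>), so a sample size \<open>n0\<close> is given from which on everything is required.\<close>

definition true_model_fixed ::
  "nat \<Rightarrow> (nat \<Rightarrow> nat \<Rightarrow> real) \<Rightarrow> (nat \<Rightarrow> nat \<Rightarrow> nat) \<Rightarrow> (nat \<Rightarrow> nat) \<Rightarrow> bool" where
  "true_model_fixed n0 \<beta> k M0 \<longleftrightarrow>
     (\<forall>n\<ge>n0. M0 n = M0 n0 \<and>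
        (\<forall>m\<in>{1..M0 n0 + 1}. k n m = k n0 m) \<and>
        (\<forall>j\<in>{1..k n0 (M0 n0 + 1)}. \<beta> n j = \<beta> n0 j))"

definition gram :: "(nat \<Rightarrow> nat \<Rightarrow> real) \<Rightarrow> nat \<Rightarrow> nat \<Rightarrow> real mat" where
  "gram x n q = (1 / real n) \<cdot>\<^sub>m ((design x n q)\<^sup>T * design x n q)"

definition design_clt ::
  "'a measure \<Rightarrow> (nat \<Rightarrow> nat \<Rightarrow> real) \<Rightarrow> (nat \<Rightarrow> 'a \<Rightarrow> real) \<Rightarrow> real \<Rightarrow> nat \<Rightarrow> bool" where
  "design_clt \<Omega> x e \<sigma> q \<longleftrightarrow>
     (\<exists>Q. pos_def_mat q Q \<and>
        (\<forall>i<q. \<forall>j<q. (\<lambda>n. gram x n q $$ (i, j)) \<longlonglongrightarrow> Q $$ (i, j)) \<and>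
        conv_in_distr \<Omega> q
          (\<lambda>n \<omega>. (1 / sqrt (real n)) \<cdot>\<^sub>v ((design x n q)\<^sup>T *\<^sub>v error_vec e n \<omega>))
          (mvn q (\<sigma>\<^sup>2 \<cdot>\<^sub>m Q)))"

text \<open>Quantifying over every measurable choice \<open>w\<close> of a minimiser covers the case in which the minimiser
  is not unique.\<close>

definition selected_weights ::
  "'a measure \<Rightarrow> (nat \<Rightarrow> nat \<Rightarrow> real) \<Rightarrow> nat \<Rightarrow> (nat \<Rightarrow> nat) \<Rightarrow> nat \<Rightarrow> real \<Rightarrow> ('a \<Rightarrow> real vec) \<Rightarrow>
    ('a \<Rightarrow> nat \<Rightarrow> real) \<Rightarrow> bool" where
  "selected_weights \<Omega> x n K M \<phi> y w \<longleftrightarrow>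
     (\<forall>m\<in>{1..M}. (\<lambda>\<omega>. w \<omega> m) \<in> borel_measurable \<Omega>) \<and>
     (\<forall>\<omega>\<in>space \<Omega>. is_arg_min (weight_criterion x n K M \<phi> (y \<omega>)) (\<lambda>v. v \<in> weights M) (w \<omega>))"

definition asymp_loss_optimal ::
  "'a measure \<Rightarrow> (nat \<Rightarrow> nat \<Rightarrow> real) \<Rightarrow> (nat \<Rightarrow> nat \<Rightarrow> real) \<Rightarrow> (nat \<Rightarrow> 'a \<Rightarrow> real) \<Rightarrow>
    (nat \<Rightarrow> nat \<Rightarrow> nat) \<Rightarrow> (nat \<Rightarrow> nat) \<Rightarrow> (nat \<Rightarrow> 'a \<Rightarrow> nat \<Rightarrow> real) \<Rightarrow> bool" where
  "asymp_loss_optimal \<Omega> x \<beta> e k M w \<longleftrightarrow>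
     conv_in_prob \<Omega>
       (\<lambda>n \<omega>. let L = avg_loss x n (k n) (M n) (mean_vec x n (\<beta> n)) (response x \<beta> e n \<omega>)
               in L (w n \<omega>) / (INF v\<in>weights (M n). L v)) 1"

definition overfit_excess ::
  "(nat \<Rightarrow> nat \<Rightarrow> real) \<Rightarrow> nat \<Rightarrow> (nat \<Rightarrow> nat) \<Rightarrow> nat \<Rightarrow> nat \<Rightarrow> real vec \<Rightarrow> (nat \<Rightarrow> real) \<Rightarrow> real" where
  "overfit_excess x n K M M0 u w =
     (\<Sum>m\<in>{M0 + 1<..M}. (w m)\<^sup>2 *
        ((u \<bullet> (proj x n K m *\<^sub>v u)) / (u \<bullet> (proj x n K (M0 + 1) *\<^sub>v u)) - 1))"

end

theory Submission
  imports Defs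
begin

text \<open>Let \<open>T = M0 + 1\<close> be the index of the true model, \<open>D\<^sub>1 = P\<^sub>1\<close> and \<open>D\<^sub>j = P\<^sub>j - P\<^sub>j\<^sub>-\<^sub>1\<close> the
  increments of the nested projections, which are mutually orthogonal projections, and
  \<open>\<gamma>\<^sub>j = w\<^sub>j + \<dots> + w\<^sub>M\<close> the tail sums of a weight vector. Then \<open>\<gamma>\<^sub>1 = 1\<close>, the \<open>\<gamma>\<^sub>j\<close> decrease, every
  decreasing sequence in \<open>[0, 1]\<close> starting at 1 arises in this way, and \<open>P(w) = \<Sum>\<^sub>j \<gamma>\<^sub>j D\<^sub>j\<close>. With
  \<open>t\<^sub>j = 1 - \<gamma>\<^sub>j\<close>, the loss is \<open>\<Sum>\<^sub>j \<parallel>t\<^sub>j D\<^sub>j \<mu> - \<gamma>\<^sub>j D\<^sub>j e\<parallel>\<^sup>2\<close> and the criterion is, up to a constant,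
  \<open>\<Sum>\<^sub>j (t\<^sub>j\<^sup>2 \<parallel>D\<^sub>j y\<parallel>\<^sup>2 + \<phi> s \<gamma>\<^sub>j (k\<^sub>j - k\<^sub>j\<^sub>-\<^sub>1))\<close> with \<open>s\<close> the variance estimate. For \<open>j > T\<close> the
  increments of \<open>\<mu>\<close> vanish, so both split into an underfitting part \<open>j \<le> T\<close> and an overfitting part
  \<open>j > T\<close>, which can be modified separately: setting \<open>\<gamma>\<^sub>j = 1\<close> for \<open>j \<le> T\<close> or \<open>\<gamma>\<^sub>j = 0\<close> for \<open>j > T\<close>
  keeps the sequence decreasing. The true model has loss \<open>V = \<parallel>P\<^sub>T e\<parallel>\<^sup>2\<close>, and \<open>\<parallel>D\<^sub>T \<mu>\<parallel>\<^sup>2 \<ge> n \<kappa> \<eta>\<close> by the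
  eigenvalue condition (\<open>omitted_signal_bound\<close>), where \<open>\<eta>\<close> is the signal.

  \<^emph>\<open>Underfitting part of the selected weights.\<close> Comparing the minimiser with the sequence raised to 1 on
  \<open>{1..T}\<close> gives \<open>\<Sum>\<^sub>j\<^sub>\<le>\<^sub>T t\<^sub>j\<^sup>2 \<parallel>D\<^sub>j y\<parallel>\<^sup>2 \<le> (\<phi> s)\<^sup>2 (k\<^sub>T - k\<^sub>1)\<^sup>2 / \<parallel>D\<^sub>T y\<parallel>\<^sup>2\<close> (\<open>minimiser_underfit\<close>). Hence
  the underfitting part of the loss is close to \<open>V\<close> (\<open>under_deviation\<close>).

  \<^emph>\<open>Overfitting part.\<close> For \<open>\<phi> = 2\<close> it is at most \<open>\<parallel>(P\<^sub>M - P\<^sub>T) e\<parallel>\<^sup>2\<close>, of mean \<open>\<sigma>\<^sup>2 (k\<^sub>M - k\<^sub>T)\<close>. For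
  \<open>\<phi> \<rightarrow> \<infinity>\<close> it is zero as soon as \<open>2 \<parallel>(P\<^sub>m - P\<^sub>T) e\<parallel>\<^sup>2 \<le> \<phi> s (k\<^sub>m - k\<^sub>T)\<close> for all \<open>m > T\<close>
  (\<open>minimiser_overfit\<close>), which has probability tending to 1 by Chebyshev's inequality on dyadic
  blocks (\<open>overfit_maximal\<close>); this needs no more than the variance of quadratic forms
  (\<open>quad_variance\<close>).

  \<^emph>\<open>Infimum of the loss.\<close> When \<open>\<parallel>(P\<^sub>T - P\<^sub>1) e\<parallel>\<^sup>2\<close> is small compared with \<open>n \<kappa> \<eta>\<close>, a weight
  vector better than the true model has \<open>t\<^sub>T\<close>, and with it every \<open>t\<^sub>j\<close> with \<open>j \<le> T\<close>, close to 0, so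
  it gains at most a small fraction of \<open>V\<close> and a sum of \<open>M0\<close> terms of mean at most \<open>\<sigma>\<^sup>2\<close> from the cross terms (\<open>loss_lower_bound\<close>). If \<open>k\<^sub>T \<rightarrow> \<infinity>\<close> then \<open>V\<close> is of exact order \<open>k\<^sub>T\<close> and all
  corrections are of smaller order (\<open>loss_optimality\<close>). If the true model is fixed, \<open>V\<close> is bounded in
  probability while moving a little weight to model \<open>M0\<close> lowers the loss by about
  \<open>(\<mu>\<^sup>T D\<^sub>T e)\<^sup>2 / \<parallel>D\<^sub>T \<mu>\<parallel>\<^sup>2\<close> whenever \<open>\<mu>\<^sup>T D\<^sub>T e > 0\<close>. A Paley-Zygmund argument shows that this gain exceeds
  a constant with probability bounded away from 0 (\<open>fixed_model_not_optimal\<close>). Finally, the overfitting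
  part is at least \<open>\<Sum>\<^sub>m\<^sub>>\<^sub>T w\<^sub>m\<^sup>2 \<parallel>(P\<^sub>m - P\<^sub>T) e\<parallel>\<^sup>2\<close>, and the underfitting part is itself the loss of a weight
  vector, so loss optimality forces the excess in the statement to vanish
  (\<open>optimal_imp_no_overfit\<close>).\<close>

section \<open>Full column rank and hat matrices\<close>

lemma scalar_prod_self_nonneg: "0 \<le> (v :: real vec) \<bullet> v"
  by (simp add: scalar_prod_def sum_nonneg)

lemma scalar_prod_self_eq_0:
  assumes "(v :: real vec) \<in> carrier_vec n" "v \<bullet> v = 0"
  shows "v = 0\<^sub>v n"
proof
  show "dim_vec v = dim_vec (0\<^sub>v n :: real vec)" using assms by simp
  fix i assume "i < dim_vec (0\<^sub>v n :: real vec)"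
  then have i: "i < n" by simp
  have "(\<Sum>i\<in>{0..<n}. v $ i * v $ i) = 0" using assms by (simp add: scalar_prod_def)
  then have "\<forall>i\<in>{0..<n}. v $ i * v $ i = 0"
    by (subst (asm) sum_nonneg_eq_0_iff) auto
  then show "v $ i = 0\<^sub>v n $ i" using i by auto
qed

lemma full_col_rank_kernel:
  assumes X: "X \<in> carrier_mat n q" and rank: "full_col_rank X"
    and v: "v \<in> carrier_vec q" and Xv: "X *\<^sub>v v = 0\<^sub>v n"
  shows "v = 0\<^sub>v q"
proof (rule ccontr)
  assume nz: "v \<noteq> 0\<^sub>v q"
  interpret vec_space "TYPE(real)" n .
  have r: "rank X = q" using rank X by (auto simp: full_col_rank_def)
  show False
  proof (cases "distinct (cols X)")
    case True
    then show False
      using full_rank_lin_indpt[OF X r True] lin_depI[OF X v nz Xv True] by blast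
  next
    case False
    obtain S where S: "maximal S (\<lambda>T. T \<subseteq> set (cols X) \<and> lin_indpt T)"
      using maximal_exists[of "(\<lambda>T. T \<subseteq> set (cols X) \<and> lin_indpt T)" "card (set (cols X))" "{}"]
      by (meson List.finite_set card_mono empty_iff empty_subsetI finite_lin_indpt2 rev_finite_subset)
    then have "card S \<le> card (set (cols X))" by (simp add: card_mono maximal_def)
    also have "\<dots> < q"
      using X False by (metis card_distinct card_length carrier_matD(2) cols_length le_neq_implies_less)
    finally show False using rank_card_indpt[OF X S] r by simp
  qed
qed

lemma mat_inv_inverse:
  assumes A: "A \<in> carrier_mat q q" and inj: "\<And>v. v \<in> carrier_vec q \<Longrightarrow> A *\<^sub>v v = 0\<^sub>v q \<Longrightarrow> v = 0\<^sub>v q"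
  shows "A * mat_inv A = 1\<^sub>m q" "mat_inv A * A = 1\<^sub>m q" "mat_inv A \<in> carrier_mat q q"
proof -
  have "det A \<noteq> 0" using det_0_iff_vec_prod_zero_field[OF A] inj by blast
  then have "A \<in> Units (ring_mat TYPE(real) q ())" by (rule det_non_zero_imp_unit[OF A])
  then obtain B where B: "mat_inverse A = Some B" using mat_inverse(1)[OF A, where b = "()"] by (cases "mat_inverse A") auto
  show "A * mat_inv A = 1\<^sub>m q" "mat_inv A * A = 1\<^sub>m q" "mat_inv A \<in> carrier_mat q q"
    using mat_inverse(2)[OF A B] B by (auto simp: mat_inv_def)
qed

lemma gram_inverse:
  assumes X: "X \<in> carrier_mat n q" and rank: "full_col_rank X"
  shows "(X\<^sup>T * X) * mat_inv (X\<^sup>T * X) = 1\<^sub>m q" "mat_inv (X\<^sup>T * X) * (X\<^sup>T * X) = 1\<^sub>m q"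
    "mat_inv (X\<^sup>T * X) \<in> carrier_mat q q" "(mat_inv (X\<^sup>T * X))\<^sup>T = mat_inv (X\<^sup>T * X)"
proof -
  let ?G = "X\<^sup>T * X" let ?B = "mat_inv ?G"
  have G: "?G \<in> carrier_mat q q" using X by simp
  have inj: "v = 0\<^sub>v q" if v: "v \<in> carrier_vec q" and 0: "?G *\<^sub>v v = 0\<^sub>v q" for v
  proof -
    have "(X *\<^sub>v v) \<bullet> (X *\<^sub>v v) = v \<bullet> (X\<^sup>T *\<^sub>v (X *\<^sub>v v))"
      using transpose_vec_mult_scalar[of "X\<^sup>T" q n "X *\<^sub>v v" v] X v by simp
    also have "X\<^sup>T *\<^sub>v (X *\<^sub>v v) = ?G *\<^sub>v v"
      using assoc_mult_mat_vec[of "X\<^sup>T" q n X q v] X v by simp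
    finally have "(X *\<^sub>v v) \<bullet> (X *\<^sub>v v) = 0" using 0 v by simp
    then have "X *\<^sub>v v = 0\<^sub>v n" using scalar_prod_self_eq_0[of "X *\<^sub>v v" n] X v by simp
    then show ?thesis by (rule full_col_rank_kernel[OF X rank v])
  qed
  note * = mat_inv_inverse[OF G inj]
  show 1: "?G * ?B = 1\<^sub>m q" and 2: "?B * ?G = 1\<^sub>m q" and 3: "?B \<in> carrier_mat q q" using * by blast+
  have Gt: "?G\<^sup>T = ?G" using X by (simp add: transpose_mult[of _ q n _ q])
  have "?B\<^sup>T * ?G = 1\<^sub>m q"
    using arg_cong[OF 1, of transpose_mat] transpose_mult[OF G 3] Gt by simp
  then have "?B\<^sup>T * ?G * ?B = ?B" using 3 by simp
  then show "?B\<^sup>T = ?B" using 1 3 G assoc_mult_mat[of "?B\<^sup>T" q q ?G q ?B q] by simp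
qed

lemma trace_mult_comm:
  assumes A: "A \<in> carrier_mat n q" and B: "(B :: real mat) \<in> carrier_mat q n"
  shows "(\<Sum>i<n. (A * B) $$ (i, i)) = (\<Sum>i<q. (B * A) $$ (i, i))"
proof -
  have "(\<Sum>i<n. (A * B) $$ (i, i)) = (\<Sum>i<n. \<Sum>j<q. A $$ (i, j) * B $$ (j, i))"
    using A B by (intro sum.cong) (auto simp: scalar_prod_def atLeast0LessThan)
  also have "\<dots> = (\<Sum>j<q. \<Sum>i<n. B $$ (j, i) * A $$ (i, j))"
    by (subst sum.swap) (simp add: mult.commute)
  also have "\<dots> = (\<Sum>i<q. (B * A) $$ (i, i))"
    using A B by (intro sum.cong) (auto simp: scalar_prod_def atLeast0LessThan)
  finally show ?thesis .
qed

lemma hat_matrix_props: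
  assumes X: "X \<in> carrier_mat n q" and rank: "full_col_rank X"
  shows "hat_matrix X \<in> carrier_mat n n" "(hat_matrix X)\<^sup>T = hat_matrix X" "hat_matrix X * X = X"
    "(\<Sum>i<n. hat_matrix X $$ (i, i)) = real q"
    "hat_matrix X = X * (mat_inv (X\<^sup>T * X) * X\<^sup>T)" "mat_inv (X\<^sup>T * X) * X\<^sup>T \<in> carrier_mat q n"
proof -
  note G = gram_inverse[OF X rank]
  let ?B = "mat_inv (X\<^sup>T * X)"
  have Xt: "X\<^sup>T \<in> carrier_mat q n" using X by simp
  show "hat_matrix X \<in> carrier_mat n n" using X G(3) by (simp add: hat_matrix_def)
  show BX: "?B * X\<^sup>T \<in> carrier_mat q n" using G(3) X by simp
  show eq: "hat_matrix X = X * (?B * X\<^sup>T)" unfolding hat_matrix_def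
    by (rule assoc_mult_mat[OF X G(3) Xt])
  have "(hat_matrix X)\<^sup>T = (X\<^sup>T)\<^sup>T * (X * ?B)\<^sup>T"
    unfolding hat_matrix_def by (rule transpose_mult[of _ n q _ n]) (use X G(3) in auto)
  also have "\<dots> = X * (?B * X\<^sup>T)" using transpose_mult[OF X G(3)] G(4) by simp
  finally show "(hat_matrix X)\<^sup>T = hat_matrix X" using eq by simp
  have BXX: "(?B * X\<^sup>T) * X = 1\<^sub>m q" using assoc_mult_mat[OF G(3) Xt X] G(2) by simp
  show "hat_matrix X * X = X" unfolding eq
    using assoc_mult_mat[OF X BX X] BXX X by simp
  show "(\<Sum>i<n. hat_matrix X $$ (i, i)) = real q" unfolding eq trace_mult_comm[OF X BX] BXX by simp
qed

lemma design_carrier [simp]: "design x n q \<in> carrier_mat n q"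
  by (simp add: design_def)

lemma design_submodel:
  assumes "q \<le> r"
  shows "design x n q = design x n r * mat r q (\<lambda>(i, j). if i = j then 1 else 0)"
proof (rule eq_matI)
  fix i j assume "i < dim_row (design x n r * mat r q (\<lambda>(i, j). if i = j then 1 else 0))"
    "j < dim_col (design x n r * mat r q (\<lambda>(i, j). if i = j then 1 else (0::real)))"
  then have i: "i < n" and j: "j < q" by (auto simp: design_def)
  have "(\<Sum>l\<in>{0..<r}. x (Suc i) (Suc l) * (if l = j then 1 else 0)) = x (Suc i) (Suc j)"
    using j assms by (subst sum.cong[OF refl, of _ _ "\<lambda>l. if l = j then x (Suc i) (Suc l) else 0"]) auto
  then show "design x n q $$ (i, j) =
      (design x n r * mat r q (\<lambda>(i, j). if i = j then 1 else 0)) $$ (i, j)"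
    using i j assms by (simp add: design_def scalar_prod_def)
qed (auto simp: design_def)

lemma hat_matrix_nested:
  assumes "q \<le> r" and rq: "full_col_rank (design x n q)" and rr: "full_col_rank (design x n r)"
  shows "hat_matrix (design x n r) * hat_matrix (design x n q) = hat_matrix (design x n q)"
    "hat_matrix (design x n q) * hat_matrix (design x n r) = hat_matrix (design x n q)"
    "hat_matrix (design x n r) * design x n q = design x n q"
proof -
  let ?Xq = "design x n q" let ?Xr = "design x n r"
  let ?J = "mat r q (\<lambda>(i, j). if i = j then 1 else (0::real))"
  note hq = hat_matrix_props[OF design_carrier rq] and hr = hat_matrix_props[OF design_carrier rr]
  have J: "?J \<in> carrier_mat r q" by simp
  show 1: "hat_matrix ?Xr * ?Xq = ?Xq"
    using assoc_mult_mat[OF hr(1) design_carrier[of x n r] J] hr(3) design_submodel[OF assms(1), of x n] by simp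
  show 2: "hat_matrix ?Xr * hat_matrix ?Xq = hat_matrix ?Xq"
    using assoc_mult_mat[OF hr(1) design_carrier[of x n q] hq(6)] 1 hq(5) by simp
  show "hat_matrix ?Xq * hat_matrix ?Xr = hat_matrix ?Xq"
    using arg_cong[OF 2, of transpose_mat] transpose_mult[OF hr(1) hq(1)] hq(2) hr(2) by simp
qed

lemma mean_vec_finite:
  assumes "\<forall>j>q. b j = 0"
  shows "mean_vec x n b = design x n q *\<^sub>v vec q (\<lambda>j. b (Suc j))"
proof
  show "dim_vec (mean_vec x n b) = dim_vec (design x n q *\<^sub>v vec q (\<lambda>j. b (Suc j)))"
    by (simp add: mean_vec_def design_def)
  fix i assume "i < dim_vec (design x n q *\<^sub>v vec q (\<lambda>j. b (Suc j)))"
  then have i: "i < n" by (simp add: design_def)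
  have "(\<Sum>j. b (Suc j) * x (Suc i) (Suc j)) = (\<Sum>j<q. b (Suc j) * x (Suc i) (Suc j))"
    by (rule suminf_finite) (use assms in auto)
  then show "mean_vec x n b $ i = (design x n q *\<^sub>v vec q (\<lambda>j. b (Suc j))) $ i"
    using i by (simp add: mean_vec_def design_def scalar_prod_def atLeast0LessThan mult.commute)
qed

section \<open>The smallest eigenvalue of a symmetric matrix\<close>

lemma quadratic_form_bounded:
  assumes A: "(A :: real mat) \<in> carrier_mat q q"
  obtains C where "C > 0" "\<And>v. v \<in> carrier_vec q \<Longrightarrow> (A *\<^sub>v v) \<bullet> (A *\<^sub>v v) \<le> C * (v \<bullet> v)"
proof -
  define C where "C = (\<Sum>i<q. \<Sum>j<q. (A $$ (i, j))\<^sup>2) + 1"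
  have pos: "C > 0" unfolding C_def by (simp add: sum_nonneg add_nonneg_pos)
  have "(A *\<^sub>v v) \<bullet> (A *\<^sub>v v) \<le> C * (v \<bullet> v)" if v: "v \<in> carrier_vec q" for v
  proof -
    have "(A *\<^sub>v v) \<bullet> (A *\<^sub>v v) = (\<Sum>i<q. (\<Sum>j<q. A $$ (i, j) * v $ j)\<^sup>2)"
      using A v by (simp add: scalar_prod_def atLeast0LessThan power2_eq_square)
    also have "\<dots> \<le> (\<Sum>i<q. (\<Sum>j<q. (A $$ (i, j))\<^sup>2) * (\<Sum>j<q. (v $ j)\<^sup>2))"
      by (intro sum_mono Cauchy_Schwarz_ineq_sum)
    also have "\<dots> = (\<Sum>i<q. \<Sum>j<q. (A $$ (i, j))\<^sup>2) * (v \<bullet> v)"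
      using v by (simp add: sum_distrib_right scalar_prod_def atLeast0LessThan power2_eq_square)
    also have "\<dots> \<le> C * (v \<bullet> v)"
      unfolding C_def by (intro mult_right_mono scalar_prod_self_nonneg) simp
    finally show ?thesis .
  qed
  then show thesis using that pos by blast
qed

lemma symmetric_form_swap:
  assumes A: "(A :: real mat) \<in> carrier_mat q q" and sym: "A\<^sup>T = A"
    and u: "u \<in> carrier_vec q" and v: "v \<in> carrier_vec q"
  shows "u \<bullet> (A *\<^sub>v v) = v \<bullet> (A *\<^sub>v u)"
  using transpose_vec_mult_scalar[OF A v u] sym comm_scalar_prod[of "A *\<^sub>v u" q v] A u v by simp

lemma quadratic_form_add:
  assumes A: "(A :: real mat) \<in> carrier_mat q q" and sym: "A\<^sup>T = A"
    and u: "u \<in> carrier_vec q" and v: "v \<in> carrier_vec q"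
  shows "(u + c \<cdot>\<^sub>v v) \<bullet> (A *\<^sub>v (u + c \<cdot>\<^sub>v v)) =
    u \<bullet> (A *\<^sub>v u) + 2 * c * (u \<bullet> (A *\<^sub>v v)) + c\<^sup>2 * (v \<bullet> (A *\<^sub>v v))"
proof -
  have "A *\<^sub>v (u + c \<cdot>\<^sub>v v) = A *\<^sub>v u + c \<cdot>\<^sub>v (A *\<^sub>v v)"
    using A u v by (simp add: mult_add_distrib_mat_vec mult_mat_vec)
  then have "(u + c \<cdot>\<^sub>v v) \<bullet> (A *\<^sub>v (u + c \<cdot>\<^sub>v v)) =
    u \<bullet> (A *\<^sub>v u) + c * (u \<bullet> (A *\<^sub>v v)) + (c * (v \<bullet> (A *\<^sub>v u)) + c * (c * (v \<bullet> (A *\<^sub>v v))))"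
    using A u v
    by (simp add: add_scalar_prod_distrib[of _ q] scalar_prod_add_distrib[of _ q] algebra_simps)
  then show ?thesis using symmetric_form_swap[OF A sym u v] by (simp add: power2_eq_square algebra_simps)
qed

lemma psd_Cauchy_Schwarz:
  assumes A: "(A :: real mat) \<in> carrier_mat q q" and sym: "A\<^sup>T = A"
    and psd: "\<And>v. v \<in> carrier_vec q \<Longrightarrow> v \<bullet> (A *\<^sub>v v) \<ge> 0"
    and u: "u \<in> carrier_vec q" and v: "v \<in> carrier_vec q"
  shows "(u \<bullet> (A *\<^sub>v v))\<^sup>2 \<le> (u \<bullet> (A *\<^sub>v u)) * (v \<bullet> (A *\<^sub>v v))"
proof -
  let ?a = "u \<bullet> (A *\<^sub>v u)" and ?b = "u \<bullet> (A *\<^sub>v v)" and ?c = "v \<bullet> (A *\<^sub>v v)"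
  have q: "0 \<le> ?a + 2 * c * ?b + c\<^sup>2 * ?c" for c
    using psd[of "u + c \<cdot>\<^sub>v v"] quadratic_form_add[OF A sym u v, of c] u v by simp
  show ?thesis
  proof (cases "?c = 0")
    case True
    \<comment> \<open>otherwise the affine function \<open>?a + 2 * c * ?b\<close> of \<open>c\<close> would take negative values\<close>
    have "?b = 0"
    proof (rule ccontr)
      assume b: "?b \<noteq> 0"
      have "0 \<le> ?a + 2 * (- (?a + 1) / (2 * ?b)) * ?b" using q[of "- (?a + 1) / (2 * ?b)"] True by simp
      also have "\<dots> = -1" using b by (simp add: field_simps)
      finally show False by simp
    qed
    then show ?thesis using True by simp
  next
    case False
    then have c: "?c > 0" using psd[OF v] by simp
    have "0 \<le> ?a - ?b\<^sup>2 / ?c" using q[of "- ?b / ?c"] c by (simp add: field_simps power2_eq_square)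
    then show ?thesis using c by (simp add: field_simps)
  qed
qed

text \<open>The infimum \<open>l\<close> of the Rayleigh quotient is an eigenvalue: otherwise \<open>A - l I\<close> is positive
  semidefinite and invertible, hence bounded below by a positive multiple of the identity.\<close>

lemma lambda_min_le_quadratic_form:
  assumes A: "A \<in> carrier_mat q q" and sym: "A\<^sup>T = A" and v: "v \<in> carrier_vec q"
  shows "lambda_min A * (v \<bullet> v) \<le> v \<bullet> (A *\<^sub>v v)"
proof (cases "v = 0\<^sub>v q")
  case True
  then show ?thesis using A by simp
next
  case False
  have nz: "u \<bullet> u > 0" if "u \<in> carrier_vec q" "u \<noteq> 0\<^sub>v q" for u :: "real vec"
    using scalar_prod_self_eq_0[OF that(1)] that(2) scalar_prod_self_nonneg[of u] by (metis less_eq_real_def)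
  define R where "R = (\<lambda>u. (u \<bullet> (A *\<^sub>v u)) / (u \<bullet> u)) ` {u \<in> carrier_vec q. u \<noteq> 0\<^sub>v q}"
  define l where "l = Inf R"
  obtain C where C: "C > 0" "\<And>u. u \<in> carrier_vec q \<Longrightarrow> (A *\<^sub>v u) \<bullet> (A *\<^sub>v u) \<le> C * (u \<bullet> u)"
    using quadratic_form_bounded[OF A] by blast
  have ne: "R \<noteq> {}" using False v by (auto simp: R_def)
  have bdd: "bdd_below R"
  proof (rule bdd_belowI)
    fix r assume "r \<in> R"
    then obtain u where u: "u \<in> carrier_vec q" "u \<noteq> 0\<^sub>v q" and r: "r = (u \<bullet> (A *\<^sub>v u)) / (u \<bullet> u)"
      by (auto simp: R_def)
    have one: "1\<^sub>m q *\<^sub>v u = u" using u by simp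
    have "0 \<le> (u + 1 \<cdot>\<^sub>v (A *\<^sub>v u)) \<bullet> (1\<^sub>m q *\<^sub>v (u + 1 \<cdot>\<^sub>v (A *\<^sub>v u)))"
      using u A by (simp add: scalar_prod_self_nonneg)
    also have "\<dots> = u \<bullet> u + 2 * (u \<bullet> (A *\<^sub>v u)) + (A *\<^sub>v u) \<bullet> (A *\<^sub>v u)"
      using quadratic_form_add[of "1\<^sub>m q" q u "A *\<^sub>v u" 1] u A by simp
    also have "\<dots> \<le> u \<bullet> u + 2 * (u \<bullet> (A *\<^sub>v u)) + C * (u \<bullet> u)" using C(2)[OF u(1)] by simp
    finally have "- (1 + C) * (u \<bullet> u) \<le> 2 * (u \<bullet> (A *\<^sub>v u))" by (simp add: algebra_simps)
    then show "- (1 + C) / 2 \<le> r" using nz[OF u] by (simp add: r field_simps)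
  qed
  have le: "l * (u \<bullet> u) \<le> u \<bullet> (A *\<^sub>v u)" if u: "u \<in> carrier_vec q" for u
  proof (cases "u = 0\<^sub>v q")
    case True
    then show ?thesis using A by simp
  next
    case False
    then have "l \<le> (u \<bullet> (A *\<^sub>v u)) / (u \<bullet> u)"
      unfolding l_def using u by (intro cInf_lower bdd) (auto simp: R_def)
    then show ?thesis using nz[OF u False] by (simp add: field_simps)
  qed
  define B where "B = A + (- l) \<cdot>\<^sub>m 1\<^sub>m q"
  have B: "B \<in> carrier_mat q q" using A by (simp add: B_def)
  have Bsym: "B\<^sup>T = B" using A sym by (auto simp: B_def transpose_add)
  have Bv: "B *\<^sub>v u = A *\<^sub>v u + (- l) \<cdot>\<^sub>v u" if "u \<in> carrier_vec q" for u
  proof -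
    have "(- l) \<cdot>\<^sub>m 1\<^sub>m q *\<^sub>v u = (- l) \<cdot>\<^sub>v u" 

    proof (rule eq_vecI)
      fix i assume "i < dim_vec ((- l) \<cdot>\<^sub>v u)"
      then have i: "i < q" using that by simp
      have "((- l) \<cdot>\<^sub>m 1\<^sub>m q *\<^sub>v u) $ i = (\<Sum>j<q. - (l * (if j = i then 1 else 0) * u $ j))"
        using i that by (simp add: scalar_prod_def atLeast0LessThan)
      also have "\<dots> = (\<Sum>j<q. if j = i then - l * u $ i else 0)" by (intro sum.cong) auto
      finally show "((- l) \<cdot>\<^sub>m 1\<^sub>m q *\<^sub>v u) $ i = ((- l) \<cdot>\<^sub>v u) $ i" using i that by simp
    qed (use that in simp)
    then show ?thesis using that A by (simp add: B_def add_mult_distrib_mat_vec[of _ q q])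
  qed
  have Bform: "u \<bullet> (B *\<^sub>v u) = u \<bullet> (A *\<^sub>v u) - l * (u \<bullet> u)" if "u \<in> carrier_vec q" for u
    using that A by (simp add: Bv scalar_prod_add_distrib[of _ q])
  have "\<exists>u\<in>carrier_vec q. u \<noteq> 0\<^sub>v q \<and> B *\<^sub>v u = 0\<^sub>v q"
  proof (rule ccontr)
    assume "\<not> ?thesis"
    then have inj: "u = 0\<^sub>v q" if "u \<in> carrier_vec q" "B *\<^sub>v u = 0\<^sub>v q" for u using that by blast
    note I = mat_inv_inverse[OF B inj]
    let ?I = "mat_inv B"
    obtain C1 where C1: "C1 > 0" "\<And>u. u \<in> carrier_vec q \<Longrightarrow> (B *\<^sub>v u) \<bullet> (B *\<^sub>v u) \<le> C1 * (u \<bullet> u)"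
      using quadratic_form_bounded[OF B] by blast
    obtain C2 where C2: "C2 > 0" "\<And>u. u \<in> carrier_vec q \<Longrightarrow> (?I *\<^sub>v u) \<bullet> (?I *\<^sub>v u) \<le> C2 * (u \<bullet> u)"
      using quadratic_form_bounded[OF I(3)] by blast
    have psd: "0 \<le> u \<bullet> (B *\<^sub>v u)" if "u \<in> carrier_vec q" for u using le[OF that] Bform[OF that] by simp
    have low: "u \<bullet> u \<le> C2 * (1 + C1) * (u \<bullet> (B *\<^sub>v u))" if u: "u \<in> carrier_vec q" for u
    proof -
      let ?w = "B *\<^sub>v u"
      have w: "?w \<in> carrier_vec q" using B u by simp
      have IB: "?I *\<^sub>v ?w = u" using assoc_mult_mat_vec[OF I(3) B u] I(2) u by simp
      have "(?w \<bullet> ?w)\<^sup>2 \<le> (?w \<bullet> (B *\<^sub>v ?w)) * (u \<bullet> ?w)"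
        using psd_Cauchy_Schwarz[OF B Bsym psd w u] by simp
      also have "\<dots> \<le> ((1 + C1) * (?w \<bullet> ?w)) * (u \<bullet> ?w)"
      proof (rule mult_right_mono[OF _ psd[OF u]])
        have "0 \<le> (?w + (-1) \<cdot>\<^sub>v (B *\<^sub>v ?w)) \<bullet> (1\<^sub>m q *\<^sub>v (?w + (-1) \<cdot>\<^sub>v (B *\<^sub>v ?w)))"
          using w B by (simp add: scalar_prod_self_nonneg)
        also have "\<dots> = ?w \<bullet> ?w - 2 * (?w \<bullet> (B *\<^sub>v ?w)) + (B *\<^sub>v ?w) \<bullet> (B *\<^sub>v ?w)"
          using quadratic_form_add[of "1\<^sub>m q" q ?w "B *\<^sub>v ?w" "-1"] w B by simp
        also have "\<dots> \<le> ?w \<bullet> ?w - 2 * (?w \<bullet> (B *\<^sub>v ?w)) + C1 * (?w \<bullet> ?w)" using C1(2)[OF w] by simp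
        finally have "2 * (?w \<bullet> (B *\<^sub>v ?w)) \<le> (1 + C1) * (?w \<bullet> ?w)" by (simp add: algebra_simps)
        then show "?w \<bullet> (B *\<^sub>v ?w) \<le> (1 + C1) * (?w \<bullet> ?w)" using psd[OF w] by linarith
      qed
      finally have *: "(?w \<bullet> ?w)\<^sup>2 \<le> (?w \<bullet> ?w) * ((1 + C1) * (u \<bullet> ?w))" by (simp add: mult.assoc mult.left_commute)
      have "?w \<bullet> ?w \<le> (1 + C1) * (u \<bullet> ?w)"
      proof (cases "?w \<bullet> ?w = 0")
        case True
        then show ?thesis using psd[OF u] C1(1) by simp
      next
        case False
        then have "?w \<bullet> ?w > 0" using scalar_prod_self_nonneg[of ?w] by simp
        then show ?thesis using * by (simp add: power2_eq_square)
      qed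
      then have "C2 * (?w \<bullet> ?w) \<le> C2 * ((1 + C1) * (u \<bullet> ?w))" using C2(1) by simp
      then show ?thesis using C2(2)[OF w] IB by simp
    qed
    \<comment> \<open>\<open>B\<close> is bounded below by \<open>c\<close>, so \<open>l + c\<close> is still a lower bound of the Rayleigh quotients\<close>
    define c where "c = 1 / (C2 * (1 + C1))"
    have c: "c > 0" using C1(1) C2(1) by (simp add: c_def)
    have "l + c \<le> Inf R"
    proof (rule cInf_greatest[OF ne])
      fix r assume "r \<in> R"
      then obtain u where u: "u \<in> carrier_vec q" "u \<noteq> 0\<^sub>v q" and r: "r = (u \<bullet> (A *\<^sub>v u)) / (u \<bullet> u)"
        by (auto simp: R_def)
      have "c * (u \<bullet> u) \<le> u \<bullet> (B *\<^sub>v u)" using low[OF u(1)] C1(1) C2(1) by (simp add: c_def pos_divide_le_eq mult.commute)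
      then show "l + c \<le> r" using nz[OF u] Bform[OF u(1)] by (simp add: r field_simps)
    qed
    then show False using c l_def by simp
  qed
  then obtain u where u: "u \<in> carrier_vec q" "u \<noteq> 0\<^sub>v q" "B *\<^sub>v u = 0\<^sub>v q" by blast
  have "A *\<^sub>v u = l \<cdot>\<^sub>v u"
  proof
    show "dim_vec (A *\<^sub>v u) = dim_vec (l \<cdot>\<^sub>v u)" using A u by simp
    fix i assume "i < dim_vec (l \<cdot>\<^sub>v u)"
    then have i: "i < q" using u by simp
    have "(A *\<^sub>v u + (- l) \<cdot>\<^sub>v u) $ i = 0\<^sub>v q $ i" unfolding Bv[OF u(1), symmetric] u(3) ..
    then show "(A *\<^sub>v u) $ i = (l \<cdot>\<^sub>v u) $ i" using i u A by simp
  qed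
  then have "l \<in> spectrum A" using u A by (auto simp: spectrum_def eigenvalue_def eigenvector_def)
  then have "lambda_min A \<le> l"
    unfolding lambda_min_def using card_finite_spectrum(1)[OF A] by simp
  then have "lambda_min A * (v \<bullet> v) \<le> l * (v \<bullet> v)" using scalar_prod_self_nonneg by (rule mult_right_mono)
  then show ?thesis using le[OF v] by simp
qed


section \<open>Orthogonal projections and the omitted signal\<close>

text \<open>The matrix of an orthogonal projection of \<open>\<real>\<^sup>n\<close>: symmetric and idempotent.\<close>

definition orth_proj :: "nat \<Rightarrow> real mat \<Rightarrow> bool" where
  "orth_proj n Q \<longleftrightarrow> Q \<in> carrier_mat n n \<and> Q\<^sup>T = Q \<and> Q * Q = Q"

lemma orth_proj_form:
  assumes "orth_proj n Q" "u \<in> carrier_vec n"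
  shows "u \<bullet> (Q *\<^sub>v u) = (Q *\<^sub>v u) \<bullet> (Q *\<^sub>v u)" "0 \<le> u \<bullet> (Q *\<^sub>v u)"
proof -
  have Q: "Q \<in> carrier_mat n n" "Q\<^sup>T = Q" "Q * Q = Q" using assms by (auto simp: orth_proj_def)
  have "(Q *\<^sub>v u) \<bullet> (Q *\<^sub>v u) = u \<bullet> (Q *\<^sub>v (Q *\<^sub>v u))"
    using transpose_vec_mult_scalar[OF Q(1) mult_mat_vec_carrier[OF Q(1) assms(2)] assms(2)] Q(2) by simp
  also have "Q *\<^sub>v (Q *\<^sub>v u) = Q *\<^sub>v u" using assoc_mult_mat_vec[of Q n n Q n u] Q assms(2) by simp
  finally show 1: "u \<bullet> (Q *\<^sub>v u) = (Q *\<^sub>v u) \<bullet> (Q *\<^sub>v u)" by simp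
  show "0 \<le> u \<bullet> (Q *\<^sub>v u)" unfolding 1 by (rule scalar_prod_self_nonneg)
qed

text \<open>The squared Frobenius norm of a projection is its trace. This turns the variance bound for
  quadratic forms into a bound by the rank.\<close>

lemma orth_proj_Frobenius:
  assumes "orth_proj n Q"
  shows "(\<Sum>i<n. \<Sum>j<n. (Q $$ (i, j))\<^sup>2) = (\<Sum>i<n. Q $$ (i, i))"
proof -
  have Q: "Q \<in> carrier_mat n n" "Q\<^sup>T = Q" "Q * Q = Q" using assms by (auto simp: orth_proj_def)
  have sw: "Q $$ (j, i) = Q $$ (i, j)" if "i < n" "j < n" for i j
    using Q that by (metis carrier_matD index_transpose_mat(1))
  have "(\<Sum>i<n. Q $$ (i, i)) = (\<Sum>i<n. (Q * Q) $$ (i, i))" using Q by simp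
  also have "\<dots> = (\<Sum>i<n. \<Sum>j<n. Q $$ (i, j) * Q $$ (j, i))"
  proof (intro sum.cong refl)
    fix i assume "i \<in> {..<n}"
    then show "(Q * Q) $$ (i, i) = (\<Sum>j<n. Q $$ (i, j) * Q $$ (j, i))"
      using Q(1) by (subst index_mult_mat(1)) (auto simp: scalar_prod_def atLeast0LessThan)
  qed
  also have "\<dots> = (\<Sum>i<n. \<Sum>j<n. (Q $$ (i, j))\<^sup>2)"
    by (intro sum.cong refl) (auto simp: sw power2_eq_square)
  finally show ?thesis by simp
qed

lemma scalar_prod_mult_mat_vec:
  assumes "(Q :: real mat) \<in> carrier_mat n n" "u \<in> carrier_vec n" "v \<in> carrier_vec n"
  shows "u \<bullet> (Q *\<^sub>v v) = (\<Sum>i<n. \<Sum>j<n. Q $$ (i, j) * (u $ i * v $ j))"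
proof -
  have "u \<bullet> (Q *\<^sub>v v) = (\<Sum>i<n. u $ i * (\<Sum>j<n. Q $$ (i, j) * v $ j))"
    using assms by (simp add: scalar_prod_def atLeast0LessThan)
  then show ?thesis by (simp add: sum_distrib_left mult_ac)
qed

lemma orth_proj_diff:
  assumes "orth_proj n Q" "orth_proj n R" "Q * R = R" "R * Q = R"
  shows "orth_proj n (Q - R)"
proof -
  have Q: "Q \<in> carrier_mat n n" "Q\<^sup>T = Q" "Q * Q = Q" and R: "R \<in> carrier_mat n n" "R\<^sup>T = R" "R * R = R"
    using assms by (auto simp: orth_proj_def)
  have "(Q - R) * (Q - R) = (Q - R) * Q - (Q - R) * R"
    using Q R by (intro mult_minus_distrib_mat[of _ n n]) auto
  also have "(Q - R) * Q = Q - R" using minus_mult_distrib_mat[of Q n n R Q n] Q R assms by simp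
  also have "(Q - R) * R = R - R" using minus_mult_distrib_mat[of Q n n R R n] Q R assms by simp
  also have "Q - R - (R - R) = Q - R" using Q R by (intro eq_matI) auto
  finally show ?thesis using Q R by (auto simp: orth_proj_def transpose_minus)
qed

lemma diff_form:
  assumes "(Q :: real mat) \<in> carrier_mat n n" "R \<in> carrier_mat n n" "u \<in> carrier_vec n" "v \<in> carrier_vec n"
  shows "u \<bullet> ((Q - R) *\<^sub>v v) = u \<bullet> (Q *\<^sub>v v) - u \<bullet> (R *\<^sub>v v)"
proof -
  have "(Q - R) *\<^sub>v v = Q *\<^sub>v v - R *\<^sub>v v" using assms by (intro minus_mult_distrib_mat_vec)
  then show ?thesis using assms by (simp add: scalar_prod_minus_distrib[of _ n])
qed

lemma gram_form:
  assumes "n > 0" and d: "d \<in> carrier_vec q"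
  shows "(design x n q *\<^sub>v d) \<bullet> (design x n q *\<^sub>v d) = real n * (d \<bullet> (gram x n q *\<^sub>v d))"
proof -
  let ?X = "design x n q" let ?G = "?X\<^sup>T * ?X"
  have X: "?X \<in> carrier_mat n q" by simp
  then have Xt: "?X\<^sup>T \<in> carrier_mat q n" by simp
  have G: "?G \<in> carrier_mat q q" using Xt X by (rule mult_carrier_mat)
  have "(?X *\<^sub>v d) \<bullet> (?X *\<^sub>v d) = d \<bullet> (?X\<^sup>T *\<^sub>v (?X *\<^sub>v d))"
    using transpose_vec_mult_scalar[OF Xt mult_mat_vec_carrier[OF X d] d] by simp
  also have "?X\<^sup>T *\<^sub>v (?X *\<^sub>v d) = ?G *\<^sub>v d"
    using assoc_mult_mat_vec[OF Xt X d] by simp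
  also have "d \<bullet> (?G *\<^sub>v d) = real n * (d \<bullet> (gram x n q *\<^sub>v d))"
  proof -
    have sm: "d \<bullet> ((c \<cdot>\<^sub>m A) *\<^sub>v d) = c * (d \<bullet> (A *\<^sub>v d))" if "A \<in> carrier_mat q q" for c A
      using that d by (simp add: scalar_prod_mult_mat_vec[of _ q] sum_distrib_left mult.assoc)
    show ?thesis using sm[OF G] assms(1) by (simp add: gram_def)
  qed
  finally show ?thesis .
qed

lemma gram_carrier [simp]: "gram x n q \<in> carrier_mat q q"
proof -
  have "(design x n q)\<^sup>T \<in> carrier_mat q n" using design_carrier by (rule transpose_carrier_mat[THEN iffD2])
  then show ?thesis unfolding gram_def using design_carrier by (intro smult_carrier_mat mult_carrier_mat)
qed

lemma gram_symmetric: "(gram x n q)\<^sup>T = gram x n q"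
proof -
  let ?X = "design x n q"
  have X: "?X \<in> carrier_mat n q" by simp
  have "(?X\<^sup>T * ?X)\<^sup>T = ?X\<^sup>T * ?X" using transpose_mult[of "?X\<^sup>T" q n ?X q] X by simp
  moreover have "(c \<cdot>\<^sub>m A)\<^sup>T = c \<cdot>\<^sub>m A\<^sup>T" for c and A :: "real mat" by (intro eq_matI) auto
  ultimately show ?thesis unfolding gram_def by simp
qed

text \<open>Omitting covariates leaves at least \<open>n \<kappa>\<close> times the squared length of the omitted
  coefficients unexplained.\<close>

lemma omitted_signal_bound:
  assumes qr: "q \<le> r" and n: "n > 0" and rq: "full_col_rank (design x n q)"
    and rr: "full_col_rank (design x n r)" and b: "\<forall>j>r. b j = 0"
    and k: "\<kappa> \<le> lambda_min (gram x n r)" "\<kappa> \<ge> 0"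
  defines "\<mu> \<equiv> mean_vec x n b"
  shows "real n * \<kappa> * (\<Sum>j\<in>{q<..r}. (b j)\<^sup>2) \<le>
      \<mu> \<bullet> ((hat_matrix (design x n r) - hat_matrix (design x n q)) *\<^sub>v \<mu>)"
    and "hat_matrix (design x n r) *\<^sub>v \<mu> = \<mu>"
proof -
  let ?X = "design x n r" and ?Xq = "design x n q"
  let ?P = "hat_matrix ?X" and ?Q = "hat_matrix ?Xq"
  let ?J = "mat r q (\<lambda>(i, j). if i = j then 1 else (0::real))"
  note hq = hat_matrix_props[OF design_carrier rq] and hr = hat_matrix_props[OF design_carrier rr]
  define bv where "bv = vec r (\<lambda>j. b (Suc j))"
  have bv: "bv \<in> carrier_vec r" by (simp add: bv_def)
  have mu: "\<mu> = ?X *\<^sub>v bv" unfolding \<mu>_def bv_def by (rule mean_vec_finite[OF b])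
  have mu_c: "\<mu> \<in> carrier_vec n" by (simp add: \<mu>_def mean_vec_def)
  show Pmu: "?P *\<^sub>v \<mu> = \<mu>"
    using assoc_mult_mat_vec[OF hr(1) design_carrier[of x n r] bv] hr(3) mu by simp
  define c where "c = (mat_inv (?Xq\<^sup>T * ?Xq) * ?Xq\<^sup>T) *\<^sub>v \<mu>"
  have c: "c \<in> carrier_vec q" using hq(6) mu_c by (simp add: c_def)
  have Qmu: "?Q *\<^sub>v \<mu> = ?X *\<^sub>v (?J *\<^sub>v c)"
  proof -
    have "?Q *\<^sub>v \<mu> = ?Xq *\<^sub>v c" unfolding c_def
      using assoc_mult_mat_vec[OF design_carrier hq(6) mu_c] hq(5) by simp
    also have "\<dots> = ?X *\<^sub>v (?J *\<^sub>v c)" by (subst design_submodel[OF qr, of x n], rule assoc_mult_mat_vec[of _ n r _ q]) (use c in auto)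
    finally show ?thesis .
  qed
  define d where "d = bv - ?J *\<^sub>v c"
  have Jc: "?J *\<^sub>v c \<in> carrier_vec r" by (rule mult_mat_vec_carrier[OF _ c]) simp
  have d: "d \<in> carrier_vec r" unfolding d_def by (rule minus_carrier_vec[OF bv Jc])
  have res: "(?P - ?Q) *\<^sub>v \<mu> = ?X *\<^sub>v d"
  proof -
    have "(?P - ?Q) *\<^sub>v \<mu> = \<mu> - ?X *\<^sub>v (?J *\<^sub>v c)"
      unfolding minus_mult_distrib_mat_vec[OF hr(1) hq(1) mu_c] Pmu Qmu ..
    also have "\<dots> = ?X *\<^sub>v d"
      unfolding d_def mult_minus_distrib_mat_vec[OF design_carrier[of x n r] bv Jc] mu ..
    finally show ?thesis .
  qed
  have P: "orth_proj n ?P" "orth_proj n ?Q"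
    using hat_matrix_nested[OF order_refl rr rr] hat_matrix_nested[OF order_refl rq rq] hr hq
    by (auto simp: orth_proj_def)
  have PQ: "orth_proj n (?P - ?Q)"
    by (rule orth_proj_diff[OF P]) (use hat_matrix_nested[OF qr rq rr] in auto)
  have dj: "d $ j = b (Suc j)" if "j < r" "q \<le> j" for j
  proof -
    have "(?J *\<^sub>v c) $ j = (\<Sum>l\<in>{0..<q}. (if j = l then 1 else 0) * c $ l)"
      using that c by (simp add: scalar_prod_def)
    also have "\<dots> = 0" using that by (intro sum.neutral) auto
    finally show ?thesis using that c bv by (simp add: d_def bv_def)
  qed
  have "(\<Sum>j\<in>{q<..r}. (b j)\<^sup>2) = (\<Sum>j\<in>{q..<r}. (b (Suc j))\<^sup>2)"
    by (rule sum.reindex_bij_witness[of _ Suc "\<lambda>j. j - 1"]) auto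
  also have "\<dots> = (\<Sum>j\<in>{q..<r}. d $ j * d $ j)" using dj by (simp add: power2_eq_square)
  also have "\<dots> \<le> (\<Sum>j\<in>{0..<r}. d $ j * d $ j)" by (intro sum_mono2) auto
  also have "\<dots> = d \<bullet> d" using d by (simp add: scalar_prod_def)
  finally have 1: "(\<Sum>j\<in>{q<..r}. (b j)\<^sup>2) \<le> d \<bullet> d" .
  have "\<kappa> * (\<Sum>j\<in>{q<..r}. (b j)\<^sup>2) \<le> lambda_min (gram x n r) * (d \<bullet> d)"
    using 1 k by (intro mult_mono) (auto simp: sum_nonneg)
  also have "\<dots> \<le> d \<bullet> (gram x n r *\<^sub>v d)"
    by (rule lambda_min_le_quadratic_form[OF gram_carrier gram_symmetric d])
  finally have "real n * \<kappa> * (\<Sum>j\<in>{q<..r}. (b j)\<^sup>2) \<le> real n * (d \<bullet> (gram x n r *\<^sub>v d))"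
    using n by (simp add: mult.assoc)
  also have "\<dots> = \<mu> \<bullet> ((?P - ?Q) *\<^sub>v \<mu>)"
    using gram_form[OF n d, of x] orth_proj_form(1)[OF PQ mu_c] res by simp
  finally show "real n * \<kappa> * (\<Sum>j\<in>{q<..r}. (b j)\<^sup>2) \<le> \<mu> \<bullet> ((?P - ?Q) *\<^sub>v \<mu>)" .
qed

section \<open>Moments of quadratic forms in the errors\<close>

text \<open>A probability space with independent, identically distributed, centred errors \<open>e 1, e 2, \<dots>\<close> of
  variance \<open>\<sigma>\<^sup>2 > 0\<close> whose absolute moment of some order above 4 is finite.\<close>

locale iid_model = prob_space \<Omega> for \<Omega> :: "'a measure" +
  fixes e :: "nat \<Rightarrow> 'a \<Rightarrow> real" and \<sigma> :: real
  assumes iid: "iid_errors \<Omega> e \<sigma>"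
begin

lemma error_measurable [measurable]: "i \<ge> 1 \<Longrightarrow> e i \<in> borel_measurable \<Omega>"
  using iid by (auto simp: iid_errors_def indep_vars_def)

lemma sigma_pos: "\<sigma>\<^sup>2 > 0"
  using iid by (auto simp: iid_errors_def)

text \<open>The moments of the common distribution of the errors; they exist up to order 4.\<close>

definition mom :: "nat \<Rightarrow> real" where
  "mom c = (\<integral>\<omega>. e 1 \<omega> ^ c \<partial>\<Omega>)"

lemma error_power:
  assumes "i \<ge> 1" "c \<le> 4"
  shows "integrable \<Omega> (\<lambda>\<omega>. e i \<omega> ^ c)" "(\<integral>\<omega>. e i \<omega> ^ c \<partial>\<Omega>) = mom c"
proof -
  obtain \<zeta> where \<zeta>: "\<zeta> > 0" "integrable \<Omega> (\<lambda>\<omega>. \<bar>e i \<omega>\<bar> powr (4 + \<zeta>))"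
    using iid assms(1) unfolding iid_errors_def by blast
  have bound: "\<bar>z ^ c\<bar> \<le> 1 + \<bar>z\<bar> powr (4 + \<zeta>)" for z :: real
  proof (cases "\<bar>z\<bar> \<le> 1")
    case True
    then have "\<bar>z ^ c\<bar> \<le> 1" by (simp add: power_abs power_le_one)
    then show ?thesis by (simp add: add_increasing2)
  next
    case False
    then have "\<bar>z ^ c\<bar> = \<bar>z\<bar> powr real c" by (simp add: power_abs powr_realpow)
    also have "\<dots> \<le> \<bar>z\<bar> powr (4 + \<zeta>)" using False assms(2) \<zeta>(1) by (intro powr_mono) auto
    finally show ?thesis by simp
  qed
  have m: "e i \<in> borel_measurable \<Omega>" "e 1 \<in> borel_measurable \<Omega>" using assms(1) by auto
  show "integrable \<Omega> (\<lambda>\<omega>. e i \<omega> ^ c)"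
  proof (rule Bochner_Integration.integrable_bound)
    show "integrable \<Omega> (\<lambda>\<omega>. 1 + \<bar>e i \<omega>\<bar> powr (4 + \<zeta>))" using \<zeta>(2) by simp
    show "(\<lambda>\<omega>. e i \<omega> ^ c) \<in> borel_measurable \<Omega>" using m by simp
    show "AE \<omega> in \<Omega>. norm (e i \<omega> ^ c) \<le> norm (1 + \<bar>e i \<omega>\<bar> powr (4 + \<zeta>))"
      using bound by (intro AE_I2) (auto intro: order.trans)
  qed
  have "(\<integral>\<omega>. e i \<omega> ^ c \<partial>\<Omega>) = (\<integral>z. z ^ c \<partial>distr \<Omega> borel (e i))"
    using m by (simp add: integral_distr)
  also have "distr \<Omega> borel (e i) = distr \<Omega> borel (e 1)" using iid assms(1) unfolding iid_errors_def by blast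
  also have "(\<integral>z. z ^ c \<partial>distr \<Omega> borel (e 1)) = mom c" using m by (simp add: integral_distr mom_def)
  finally show "(\<integral>\<omega>. e i \<omega> ^ c \<partial>\<Omega>) = mom c" .
qed

lemma mom_simps [simp]: "mom 0 = 1" "mom (Suc 0) = 0" "mom 2 = \<sigma>\<^sup>2"
  using iid by (auto simp: mom_def iid_errors_def prob_space)

lemma mom_Suc [simp]: "mom (Suc (Suc 0)) = \<sigma>\<^sup>2" "mom (Suc (Suc (Suc (Suc 0)))) = mom 4"
  using mom_simps(3) by (simp_all add: numeral_eq_Suc)

lemma mom4_nonneg: "mom 4 \<ge> 0"
  by (simp add: mom_def)

lemma moment_product:
  assumes "finite J" "J \<subseteq> {1..}" "\<And>i. i \<in> J \<Longrightarrow> c i \<le> 4"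
  shows "integrable \<Omega> (\<lambda>\<omega>. \<Prod>i\<in>J. e i \<omega> ^ c i)"
    "(\<integral>\<omega>. (\<Prod>i\<in>J. e i \<omega> ^ c i) \<partial>\<Omega>) = (\<Prod>i\<in>J. mom (c i))"
proof -
  have ind: "indep_vars (\<lambda>_. borel) (\<lambda>i \<omega>. e i \<omega> ^ c i) J"
    by (rule indep_vars_compose2[where M' = "\<lambda>_. borel", OF indep_vars_subset[where I = "{1..}"]])
      (use iid assms in \<open>auto simp: iid_errors_def\<close>)
  have int: "integrable \<Omega> (\<lambda>\<omega>. e i \<omega> ^ c i)" if "i \<in> J" for i
    using that assms by (intro error_power) auto
  show "integrable \<Omega> (\<lambda>\<omega>. \<Prod>i\<in>J. e i \<omega> ^ c i)"
    by (rule indep_vars_integrable[OF assms(1) ind int])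
  have "(\<integral>\<omega>. (\<Prod>i\<in>J. e i \<omega> ^ c i) \<partial>\<Omega>) = (\<Prod>i\<in>J. \<integral>\<omega>. e i \<omega> ^ c i \<partial>\<Omega>)"
    by (rule indep_vars_lebesgue_integral[OF assms(1) ind int])
  also have "\<dots> = (\<Prod>i\<in>J. mom (c i))" using assms by (intro prod.cong error_power refl) auto
  finally show "(\<integral>\<omega>. (\<Prod>i\<in>J. e i \<omega> ^ c i) \<partial>\<Omega>) = (\<Prod>i\<in>J. mom (c i))" .
qed

text \<open>The number of times that \<open>s\<close> occurs in the list \<open>[a, b, c, d]\<close>.\<close>

definition occurrences :: "nat \<Rightarrow> nat \<Rightarrow> nat \<Rightarrow> nat \<Rightarrow> nat \<Rightarrow> nat" where
  "occurrences a b c d s = of_bool (s = a) + of_bool (s = b) + of_bool (s = c) + of_bool (s = d)"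

lemma fourth_moment:
  assumes "a \<ge> 1" "b \<ge> 1" "c \<ge> 1" "d \<ge> 1"
  shows "integrable \<Omega> (\<lambda>\<omega>. e a \<omega> * e b \<omega> * (e c \<omega> * e d \<omega>))"
    "(\<integral>\<omega>. e a \<omega> * e b \<omega> * (e c \<omega> * e d \<omega>) \<partial>\<Omega>) = (\<Prod>s\<in>{a, b, c, d}. mom (occurrences a b c d s))"
proof -
  have one: "(\<Prod>s\<in>{a, b, c, d}. e s \<omega> ^ of_bool (s = t)) = e t \<omega>" if "t \<in> {a, b, c, d}" for t \<omega>
  proof -
    have "(\<Prod>s\<in>{a, b, c, d}. e s \<omega> ^ of_bool (s = t)) = (\<Prod>s\<in>{a, b, c, d}. if s = t then e s \<omega> else 1)"
      by (intro prod.cong) auto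
    also have "\<dots> = e t \<omega>" using that by (subst prod.delta) auto
    finally show ?thesis .
  qed
  have "(\<Prod>s\<in>{a, b, c, d}. e s \<omega> ^ occurrences a b c d s) = e a \<omega> * e b \<omega> * (e c \<omega> * e d \<omega>)" for \<omega>
    unfolding occurrences_def power_add prod.distrib by (simp only: one insertI1 insertI2 mult.assoc)
  moreover have "occurrences a b c d s \<le> 4" for s by (simp add: occurrences_def)
  ultimately show "integrable \<Omega> (\<lambda>\<omega>. e a \<omega> * e b \<omega> * (e c \<omega> * e d \<omega>))"
    "(\<integral>\<omega>. e a \<omega> * e b \<omega> * (e c \<omega> * e d \<omega>) \<partial>\<Omega>) = (\<Prod>s\<in>{a, b, c, d}. mom (occurrences a b c d s))"
    using moment_product[of "{a, b, c, d}" "occurrences a b c d"] assms(1-4) by auto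
qed

text \<open>Products \<open>e\<^sub>i e\<^sub>j\<close> with \<open>i < j\<close> are orthogonal: unless the two pairs agree, some index occurs exactly
  once among the four, and the errors have mean 0.\<close>

lemma fourth_moment_cross:
  assumes "i < j" "k < l" "i \<ge> 1" "k \<ge> 1"
  shows "(\<integral>\<omega>. e i \<omega> * e j \<omega> * (e k \<omega> * e l \<omega>) \<partial>\<Omega>) = (if (i, j) = (k, l) then (\<sigma>\<^sup>2)\<^sup>2 else 0)"
proof (cases "(i, j) = (k, l)")
  case True
  then have *: "k = i" "l = j" by auto
  show ?thesis using assms unfolding *
    by (subst fourth_moment) (auto simp: occurrences_def insert_absorb simp flip: power_mult power_add)
next
  case False
  let ?c = "occurrences i j k l"
  have "\<exists>s\<in>{i, j, k, l}. ?c s = 1"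
  proof (cases "j = l")
    case True
    then have "?c i = 1" using False assms by (auto simp: occurrences_def)
    then show ?thesis by blast
  next
    case jl: False
    show ?thesis
    proof (cases "j > l")
      case True
      then have "?c j = 1" using assms by (auto simp: occurrences_def)
      then show ?thesis by blast
    next
      case False
      then have "?c l = 1" using assms jl by (auto simp: occurrences_def)
      then show ?thesis by blast
    qed
  qed
  then have "(\<Prod>s\<in>{i, j, k, l}. mom (?c s)) = 0" by (intro prod_zero) auto
  then show ?thesis using False assms by (subst fourth_moment) auto
qed

lemma fourth_moment_squares:
  assumes "i \<ge> 1" "j \<ge> 1"
  shows "(\<integral>\<omega>. e i \<omega> * e i \<omega> * (e j \<omega> * e j \<omega>) \<partial>\<Omega>) = (if i = j then mom 4 else (\<sigma>\<^sup>2)\<^sup>2)"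
  using assms by (subst fourth_moment) (auto simp: occurrences_def insert_absorb simp flip: power_mult power_add)

lemma second_moment:
  assumes "i \<ge> 1" "j \<ge> 1"
  shows "integrable \<Omega> (\<lambda>\<omega>. e i \<omega> * e j \<omega>)"
    "(\<integral>\<omega>. e i \<omega> * e j \<omega> \<partial>\<Omega>) = (if i = j then \<sigma>\<^sup>2 else 0)"
proof -
  have *: "e i \<omega> * e j \<omega> = (if i = j then e i \<omega> ^ 2 else (\<Prod>s\<in>{i, j}. e s \<omega> ^ 1))" for \<omega>
    by (auto simp: power2_eq_square)
  show "integrable \<Omega> (\<lambda>\<omega>. e i \<omega> * e j \<omega>)"
    unfolding * using assms error_power(1)[of i 2] moment_product(1)[of "{i, j}" "\<lambda>_. 1"]
    by (cases "i = j") auto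
  show "(\<integral>\<omega>. e i \<omega> * e j \<omega> \<partial>\<Omega>) = (if i = j then \<sigma>\<^sup>2 else 0)"
    unfolding * using assms error_power(2)[of i 2] moment_product(2)[of "{i, j}" "\<lambda>_. 1"]
    by (cases "i = j") auto
qed

lemma orthogonal_sum_second_moment:
  assumes "finite J" "\<And>p q. p \<in> J \<Longrightarrow> q \<in> J \<Longrightarrow> integrable \<Omega> (\<lambda>\<omega>. Y p \<omega> * Y q \<omega> :: real)"
    and "\<And>p q. p \<in> J \<Longrightarrow> q \<in> J \<Longrightarrow> (\<integral>\<omega>. Y p \<omega> * Y q \<omega> \<partial>\<Omega>) = (if p = q then v else 0)"
  shows "integrable \<Omega> (\<lambda>\<omega>. (\<Sum>p\<in>J. a p * Y p \<omega>)\<^sup>2)"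
    "(\<integral>\<omega>. (\<Sum>p\<in>J. a p * Y p \<omega>)\<^sup>2 \<partial>\<Omega>) = v * (\<Sum>p\<in>J. (a p)\<^sup>2)"
proof -
  have *: "(\<Sum>p\<in>J. a p * Y p \<omega>)\<^sup>2 = (\<Sum>p\<in>J. \<Sum>q\<in>J. a p * a q * (Y p \<omega> * Y q \<omega>))" for \<omega>
    by (simp add: power2_eq_square sum_product mult_ac)
  show "integrable \<Omega> (\<lambda>\<omega>. (\<Sum>p\<in>J. a p * Y p \<omega>)\<^sup>2)"
    unfolding * using assms by (intro Bochner_Integration.integrable_sum integrable_mult_right)
  have "(\<integral>\<omega>. (\<Sum>p\<in>J. a p * Y p \<omega>)\<^sup>2 \<partial>\<Omega>) = (\<Sum>p\<in>J. \<Sum>q\<in>J. \<integral>\<omega>. a p * a q * (Y p \<omega> * Y q \<omega>) \<partial>\<Omega>)"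
  proof -
    have int: "integrable \<Omega> (\<lambda>\<omega>. a p * a q * (Y p \<omega> * Y q \<omega>))" if "p \<in> J" "q \<in> J" for p q
      using that assms by (intro integrable_mult_right)
    then have "integrable \<Omega> (\<lambda>\<omega>. \<Sum>q\<in>J. a p * a q * (Y p \<omega> * Y q \<omega>))" if "p \<in> J" for p
      using that by (intro Bochner_Integration.integrable_sum)
    then show ?thesis unfolding *
      by (subst Bochner_Integration.integral_sum)
        (assumption | intro sum.cong[OF refl] Bochner_Integration.integral_sum int)+
  qed
  also have "\<dots> = (\<Sum>p\<in>J. \<Sum>q\<in>J. if p = q then v * (a p)\<^sup>2 else 0)"
    using assms by (intro sum.cong refl) (auto simp: power2_eq_square)
  also have "\<dots> = v * (\<Sum>p\<in>J. (a p)\<^sup>2)" using assms(1) by (simp add: sum_distrib_left)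
  finally show "(\<integral>\<omega>. (\<Sum>p\<in>J. a p * Y p \<omega>)\<^sup>2 \<partial>\<Omega>) = v * (\<Sum>p\<in>J. (a p)\<^sup>2)" .
qed

text \<open>The quadratic form \<open>e\<^sup>T Q e\<close> in the first \<open>n\<close> errors, for a matrix given by its entries, whose
  indices start at 0.\<close>

definition quad :: "nat \<Rightarrow> (nat \<Rightarrow> nat \<Rightarrow> real) \<Rightarrow> 'a \<Rightarrow> real" where
  "quad n Q \<omega> = (\<Sum>i<n. \<Sum>j<n. Q i j * (e (Suc i) \<omega> * e (Suc j) \<omega>))"

text \<open>A constant such that the variance of \<open>quad n Q\<close> is at most \<open>var_const\<close> times the squared
  Frobenius norm of \<open>Q\<close>.\<close>

definition var_const :: real where
  "var_const = 2 * mom 4 + 4 * (\<sigma>\<^sup>2)\<^sup>2"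

lemma var_const_pos: "var_const > 0"
  using mom4_nonneg sigma_pos by (simp add: var_const_def add_nonneg_pos)

lemma quad_measurable [measurable]: "quad n Q \<in> borel_measurable \<Omega>"
  unfolding quad_def by measurable

lemma quad_expectation:
  shows "integrable \<Omega> (quad n Q)" "(\<integral>\<omega>. quad n Q \<omega> \<partial>\<Omega>) = \<sigma>\<^sup>2 * (\<Sum>i<n. Q i i)"
proof -
  show "integrable \<Omega> (quad n Q)"
    unfolding quad_def by (intro Bochner_Integration.integrable_sum integrable_mult_right second_moment) auto
  have "(\<integral>\<omega>. quad n Q \<omega> \<partial>\<Omega>) = (\<Sum>i<n. \<Sum>j<n. \<integral>\<omega>. Q i j * (e (Suc i) \<omega> * e (Suc j) \<omega>) \<partial>\<Omega>)"
  proof -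
    have int: "integrable \<Omega> (\<lambda>\<omega>. Q i j * (e (Suc i) \<omega> * e (Suc j) \<omega>))" for i j
      by (intro integrable_mult_right second_moment) auto
    then have "integrable \<Omega> (\<lambda>\<omega>. \<Sum>j<n. Q i j * (e (Suc i) \<omega> * e (Suc j) \<omega>))" for i
      by (intro Bochner_Integration.integrable_sum)
    then show ?thesis unfolding quad_def
      by (subst Bochner_Integration.integral_sum)
        (assumption | intro sum.cong[OF refl] Bochner_Integration.integral_sum int)+
  qed
  also have "\<dots> = (\<Sum>i<n. \<Sum>j<n. if i = j then \<sigma>\<^sup>2 * Q i i else 0)"
    by (intro sum.cong refl) (auto simp: second_moment)
  also have "\<dots> = \<sigma>\<^sup>2 * (\<Sum>i<n. Q i i)" by (simp add: sum_distrib_left)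
  finally show "(\<integral>\<omega>. quad n Q \<omega> \<partial>\<Omega>) = \<sigma>\<^sup>2 * (\<Sum>i<n. Q i i)" .
qed

text \<open>Centred at its mean, the form is the sum of a diagonal part \<open>D\<close> and an off-diagonal part \<open>R\<close>, each
  of which is a combination of orthogonal variables.\<close>

lemma quad_variance:
  assumes sym: "\<And>i j. i < n \<Longrightarrow> j < n \<Longrightarrow> Q i j = Q j i"
  shows "integrable \<Omega> (\<lambda>\<omega>. (quad n Q \<omega> - \<sigma>\<^sup>2 * (\<Sum>i<n. Q i i))\<^sup>2)"
    "(\<integral>\<omega>. (quad n Q \<omega> - \<sigma>\<^sup>2 * (\<Sum>i<n. Q i i))\<^sup>2 \<partial>\<Omega>) \<le> var_const * (\<Sum>i<n. \<Sum>j<n. (Q i j)\<^sup>2)"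
proof -
  define J where "J = {p. fst p < snd p \<and> snd p < n}"
  have J: "finite J" by (rule finite_subset[of _ "{..<n} \<times> {..<n}"]) (auto simp: J_def)
  define Y where "Y p \<omega> = e (Suc (fst p)) \<omega> * e (Suc (snd p)) \<omega>" for p \<omega>
  define Z where "Z i \<omega> = e (Suc i) \<omega> * e (Suc i) \<omega> - \<sigma>\<^sup>2" for i \<omega>
  define D where "D \<omega> = (\<Sum>i<n. Q i i * Z i \<omega>)" for \<omega>
  define R where "R \<omega> = (\<Sum>p\<in>J. (2 * Q (fst p) (snd p)) * Y p \<omega>)" for \<omega>
  have split: "(\<Sum>i<n. \<Sum>j<n. g i j) = (\<Sum>i<n. g i i) + (\<Sum>p\<in>J. g (fst p) (snd p) + g (snd p) (fst p))"
    for g :: "nat \<Rightarrow> nat \<Rightarrow> real"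
  proof -
    define J' where "J' = {p. snd p < fst p \<and> fst p < n}"
    have J': "finite J'" by (rule finite_subset[of _ "{..<n} \<times> {..<n}"]) (auto simp: J'_def)
    have eq: "{..<n} \<times> {..<n} = ((\<lambda>i. (i, i)) ` {..<n} \<union> J) \<union> J'"
      by (auto simp: J_def J'_def image_iff)
    have "(\<Sum>i<n. \<Sum>j<n. g i j) = (\<Sum>p\<in>{..<n} \<times> {..<n}. g (fst p) (snd p))"
      by (simp add: sum.cartesian_product case_prod_unfold)
    also have "\<dots> = (\<Sum>p\<in>(\<lambda>i. (i, i)) ` {..<n}. g (fst p) (snd p)) + (\<Sum>p\<in>J. g (fst p) (snd p))
        + (\<Sum>p\<in>J'. g (fst p) (snd p))"
      unfolding eq using J J'
      by (subst sum.union_disjoint; (subst sum.union_disjoint)?) (auto simp: J_def J'_def)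
    also have "(\<Sum>p\<in>(\<lambda>i. (i, i)) ` {..<n}. g (fst p) (snd p)) = (\<Sum>i<n. g i i)"
      by (subst sum.reindex) (auto simp: inj_on_def)
    also have "(\<Sum>p\<in>J'. g (fst p) (snd p)) = (\<Sum>p\<in>J. g (snd p) (fst p))"
      by (rule sum.reindex_bij_witness[of _ prod.swap prod.swap]) (auto simp: J_def J'_def)
    finally show ?thesis by (simp add: sum.distrib)
  qed
  have decomp: "quad n Q \<omega> - \<sigma>\<^sup>2 * (\<Sum>i<n. Q i i) = D \<omega> + R \<omega>" for \<omega>
  proof -
    have "quad n Q \<omega> = (\<Sum>i<n. Q i i * (e (Suc i) \<omega> * e (Suc i) \<omega>)) + R \<omega>"
      unfolding quad_def split R_def
      by (intro arg_cong2[where f = "(+)"] sum.cong refl) (auto simp: J_def Y_def sym algebra_simps)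
    then show ?thesis by (simp add: D_def Z_def right_diff_distrib sum_subtractf sum_distrib_left mult.commute)
  qed
  have R: "integrable \<Omega> (\<lambda>\<omega>. (R \<omega>)\<^sup>2)"
    "(\<integral>\<omega>. (R \<omega>)\<^sup>2 \<partial>\<Omega>) = (\<sigma>\<^sup>2)\<^sup>2 * (\<Sum>p\<in>J. (2 * Q (fst p) (snd p))\<^sup>2)"
  proof -
    have "integrable \<Omega> (\<lambda>\<omega>. Y p \<omega> * Y q \<omega>)" for p q
      unfolding Y_def by (intro fourth_moment(1)) auto
    moreover have "(\<integral>\<omega>. Y p \<omega> * Y q \<omega> \<partial>\<Omega>) = (if p = q then (\<sigma>\<^sup>2)\<^sup>2 else 0)" if "p \<in> J" "q \<in> J" for p q
      unfolding Y_def using that by (subst fourth_moment_cross) (auto simp: J_def prod_eq_iff)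
    ultimately show "integrable \<Omega> (\<lambda>\<omega>. (R \<omega>)\<^sup>2)"
      "(\<integral>\<omega>. (R \<omega>)\<^sup>2 \<partial>\<Omega>) = (\<sigma>\<^sup>2)\<^sup>2 * (\<Sum>p\<in>J. (2 * Q (fst p) (snd p))\<^sup>2)"
      unfolding R_def by (intro orthogonal_sum_second_moment[OF J]; blast)+
  qed
  have ZZ: "Z i \<omega> * Z j \<omega> = e (Suc i) \<omega> * e (Suc i) \<omega> * (e (Suc j) \<omega> * e (Suc j) \<omega>)
      - \<sigma>\<^sup>2 * (e (Suc i) \<omega> * e (Suc i) \<omega>) - \<sigma>\<^sup>2 * (e (Suc j) \<omega> * e (Suc j) \<omega>) + (\<sigma>\<^sup>2)\<^sup>2" for i j \<omega>
    by (simp add: Z_def algebra_simps power2_eq_square)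
  have D: "integrable \<Omega> (\<lambda>\<omega>. (D \<omega>)\<^sup>2)"
    "(\<integral>\<omega>. (D \<omega>)\<^sup>2 \<partial>\<Omega>) = (mom 4 - (\<sigma>\<^sup>2)\<^sup>2) * (\<Sum>i<n. (Q i i)\<^sup>2)"
  proof -
    have int: "integrable \<Omega> (\<lambda>\<omega>. Z i \<omega> * Z j \<omega>)" for i j
      unfolding ZZ by (simp add: fourth_moment(1) second_moment(1))
    have val: "(\<integral>\<omega>. Z i \<omega> * Z j \<omega> \<partial>\<Omega>) = (if i = j then mom 4 - (\<sigma>\<^sup>2)\<^sup>2 else 0)" for i j
      unfolding ZZ
      by (simp add: fourth_moment(1) fourth_moment_squares second_moment prob_space power2_eq_square[of "\<sigma>\<^sup>2"])
    show "integrable \<Omega> (\<lambda>\<omega>. (D \<omega>)\<^sup>2)"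
      "(\<integral>\<omega>. (D \<omega>)\<^sup>2 \<partial>\<Omega>) = (mom 4 - (\<sigma>\<^sup>2)\<^sup>2) * (\<Sum>i<n. (Q i i)\<^sup>2)"
      unfolding D_def using int val by (intro orthogonal_sum_second_moment[OF finite_lessThan]; blast)+
  qed
  have Dm: "D \<in> borel_measurable \<Omega>" "R \<in> borel_measurable \<Omega>"
    unfolding D_def R_def Z_def Y_def by measurable
  have le: "(D \<omega> + R \<omega>)\<^sup>2 \<le> 2 * (D \<omega>)\<^sup>2 + 2 * (R \<omega>)\<^sup>2" for \<omega>
    using sum_squares_bound[of "D \<omega>" "R \<omega>"] by (simp add: power2_sum)
  show int: "integrable \<Omega> (\<lambda>\<omega>. (quad n Q \<omega> - \<sigma>\<^sup>2 * (\<Sum>i<n. Q i i))\<^sup>2)"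
    unfolding decomp
    by (rule Bochner_Integration.integrable_bound[of _ "\<lambda>\<omega>. 2 * (D \<omega>)\<^sup>2 + 2 * (R \<omega>)\<^sup>2"])
      (use R D Dm le in auto)
  have diag: "(\<Sum>i<n. (Q i i)\<^sup>2) \<le> (\<Sum>i<n. \<Sum>j<n. (Q i j)\<^sup>2)"
    by (subst split[of "\<lambda>i j. (Q i j)\<^sup>2"]) (simp add: sum_nonneg)
  have off: "(\<Sum>p\<in>J. (2 * Q (fst p) (snd p))\<^sup>2) \<le> 2 * (\<Sum>i<n. \<Sum>j<n. (Q i j)\<^sup>2)"
  proof -
    have "(\<Sum>p\<in>J. (2 * Q (fst p) (snd p))\<^sup>2) = 2 * (\<Sum>p\<in>J. (Q (fst p) (snd p))\<^sup>2 + (Q (snd p) (fst p))\<^sup>2)"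
      unfolding sum_distrib_left using sym by (intro sum.cong refl) (auto simp: J_def)
    then show ?thesis by (subst split[of "\<lambda>i j. (Q i j)\<^sup>2"]) (simp add: sum_nonneg)
  qed
  have "(\<integral>\<omega>. (quad n Q \<omega> - \<sigma>\<^sup>2 * (\<Sum>i<n. Q i i))\<^sup>2 \<partial>\<Omega>) \<le> (\<integral>\<omega>. 2 * (D \<omega>)\<^sup>2 + 2 * (R \<omega>)\<^sup>2 \<partial>\<Omega>)"
    using int R D le unfolding decomp by (intro integral_mono) auto
  also have "\<dots> = 2 * ((mom 4 - (\<sigma>\<^sup>2)\<^sup>2) * (\<Sum>i<n. (Q i i)\<^sup>2)) + 2 * ((\<sigma>\<^sup>2)\<^sup>2 * (\<Sum>p\<in>J. (2 * Q (fst p) (snd p))\<^sup>2))"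
    using R D by simp
  also have "\<dots> \<le> 2 * (mom 4 * (\<Sum>i<n. \<Sum>j<n. (Q i j)\<^sup>2)) + 2 * ((\<sigma>\<^sup>2)\<^sup>2 * (2 * (\<Sum>i<n. \<Sum>j<n. (Q i j)\<^sup>2)))"
  proof -
    have "(mom 4 - (\<sigma>\<^sup>2)\<^sup>2) * (\<Sum>i<n. (Q i i)\<^sup>2) \<le> mom 4 * (\<Sum>i<n. (Q i i)\<^sup>2)"
      by (intro mult_right_mono) (auto simp: sum_nonneg)
    also have "\<dots> \<le> mom 4 * (\<Sum>i<n. \<Sum>j<n. (Q i j)\<^sup>2)" using diag mom4_nonneg by (rule mult_left_mono)
    finally have "(mom 4 - (\<sigma>\<^sup>2)\<^sup>2) * (\<Sum>i<n. (Q i i)\<^sup>2) \<le> mom 4 * (\<Sum>i<n. \<Sum>j<n. (Q i j)\<^sup>2)" .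
    moreover have "(\<sigma>\<^sup>2)\<^sup>2 * (\<Sum>p\<in>J. (2 * Q (fst p) (snd p))\<^sup>2) \<le> (\<sigma>\<^sup>2)\<^sup>2 * (2 * (\<Sum>i<n. \<Sum>j<n. (Q i j)\<^sup>2))"
      using off by (rule mult_left_mono) simp
    ultimately show ?thesis by simp
  qed
  also have "\<dots> = var_const * (\<Sum>i<n. \<Sum>j<n. (Q i j)\<^sup>2)" by (simp add: var_const_def algebra_simps)
  finally show "(\<integral>\<omega>. (quad n Q \<omega> - \<sigma>\<^sup>2 * (\<Sum>i<n. Q i i))\<^sup>2 \<partial>\<Omega>) \<le> var_const * (\<Sum>i<n. \<Sum>j<n. (Q i j)\<^sup>2)" .
qed

lemma quad_Chebyshev:
  assumes "\<And>i j. i < n \<Longrightarrow> j < n \<Longrightarrow> Q i j = Q j i" "t > 0"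
  shows "prob {\<omega> \<in> space \<Omega>. \<bar>quad n Q \<omega> - \<sigma>\<^sup>2 * (\<Sum>i<n. Q i i)\<bar> \<ge> t} \<le>
    var_const * (\<Sum>i<n. \<Sum>j<n. (Q i j)\<^sup>2) / t\<^sup>2"
proof -
  let ?Z = "\<lambda>\<omega>. (quad n Q \<omega> - \<sigma>\<^sup>2 * (\<Sum>i<n. Q i i))\<^sup>2"
  have "{\<omega> \<in> space \<Omega>. \<bar>quad n Q \<omega> - \<sigma>\<^sup>2 * (\<Sum>i<n. Q i i)\<bar> \<ge> t} = {\<omega> \<in> space \<Omega>. ?Z \<omega> \<ge> t\<^sup>2}"
  proof -
    have "t \<le> \<bar>z\<bar> \<longleftrightarrow> t\<^sup>2 \<le> z\<^sup>2" for z :: real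
      using abs_le_square_iff[of t z] assms(2) by simp
    then show ?thesis by simp
  qed
  also have "prob \<dots> \<le> (\<integral>\<omega>. ?Z \<omega> \<partial>\<Omega>) / t\<^sup>2"
    by (rule integral_Markov_inequality_measure[OF quad_variance(1), of n Q "{}"]) (use assms in auto)
  also have "\<dots> \<le> var_const * (\<Sum>i<n. \<Sum>j<n. (Q i j)\<^sup>2) / t\<^sup>2"
    by (intro divide_right_mono quad_variance(2)) (use assms in auto)
  finally show ?thesis .
qed

text \<open>A centred variable whose fourth moment is controlled by its variance is bounded below by a
  positive constant with a probability bounded below. The first pointwise inequality, with \<open>a\<^sup>2 = 2 C / s\<close>,
  bounds \<open>E|Z|\<close> from below by \<open>m\<close>; the positive part of \<open>Z\<close> has half of this mean, and the second
  one, with \<open>b = 8 s / m\<close>, shows that not all of it comes from values below \<open>m / 8\<close>.\<close>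

lemma positive_part_probability:
  fixes Z :: "'a \<Rightarrow> real"
  assumes Z: "integrable \<Omega> Z" "(\<integral>\<omega>. Z \<omega> \<partial>\<Omega>) = 0"
    and Z2: "integrable \<Omega> (\<lambda>\<omega>. (Z \<omega>)\<^sup>2)" "(\<integral>\<omega>. (Z \<omega>)\<^sup>2 \<partial>\<Omega>) = s"
    and Z4: "integrable \<Omega> (\<lambda>\<omega>. (Z \<omega>) ^ 4)" "(\<integral>\<omega>. (Z \<omega>) ^ 4 \<partial>\<Omega>) \<le> C"
    and pos: "s > 0" "C > 0"
  defines "m \<equiv> s / (2 * sqrt (2 * C / s))"
  shows "m\<^sup>2 / (32 * s) \<le> prob {\<omega> \<in> space \<Omega>. Z \<omega> \<ge> m / 8}"
proof -
  note [measurable] = borel_measurable_integrable[OF Z(1)]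
  define a where "a = sqrt (2 * C / s)"
  have a: "a > 0" "a\<^sup>2 = 2 * C / s" using pos by (auto simp: a_def)
  have m: "m = s / (2 * a)" "m > 0" using pos a by (auto simp: m_def a_def)
  have abs_int: "integrable \<Omega> (\<lambda>\<omega>. \<bar>Z \<omega>\<bar>)" using Z(1) by simp
  have p1: "z\<^sup>2 \<le> a * \<bar>z\<bar> + z ^ 4 / a\<^sup>2" for z :: real
  proof (cases "\<bar>z\<bar> \<le> a")
    case True
    then have "z\<^sup>2 \<le> a * \<bar>z\<bar>" by (metis abs_ge_zero mult_right_mono power2_abs power2_eq_square)
    then show ?thesis by (simp add: add_increasing2)
  next
    case False
    then have "a\<^sup>2 \<le> z\<^sup>2" using a(1) by (simp add: abs_le_square_iff[symmetric])
    then have "a\<^sup>2 * z\<^sup>2 \<le> z ^ 4"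
      using mult_right_mono[of "a\<^sup>2" "z\<^sup>2" "z\<^sup>2"] by (simp add: power_add[symmetric])
    then have "z\<^sup>2 \<le> z ^ 4 / a\<^sup>2" using a(1) by (simp add: field_simps)
    then show ?thesis using a(1) by (simp add: add_increasing)
  qed
  have "s \<le> (\<integral>\<omega>. a * \<bar>Z \<omega>\<bar> + Z \<omega> ^ 4 / a\<^sup>2 \<partial>\<Omega>)"
    unfolding Z2(2)[symmetric] using Z2(1) Z4(1) abs_int p1 by (intro integral_mono) auto
  also have "\<dots> = a * (\<integral>\<omega>. \<bar>Z \<omega>\<bar> \<partial>\<Omega>) + (\<integral>\<omega>. Z \<omega> ^ 4 \<partial>\<Omega>) / a\<^sup>2"
    using Z4(1) abs_int by simp
  also have "\<dots> \<le> a * (\<integral>\<omega>. \<bar>Z \<omega>\<bar> \<partial>\<Omega>) + C / a\<^sup>2" using Z4(2) by (simp add: divide_right_mono)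
  also have "C / a\<^sup>2 = s / 2" using a(2) pos by simp
  finally have absm: "m \<le> (\<integral>\<omega>. \<bar>Z \<omega>\<bar> \<partial>\<Omega>)" unfolding m(1) using a(1) by (simp add: field_simps)
  define b where "b = 8 * s / m"
  have b: "b > 0" using pos m(2) by (simp add: b_def)
  let ?A = "{\<omega> \<in> space \<Omega>. Z \<omega> \<ge> m / 8}"
  have p2: "(\<bar>Z \<omega>\<bar> + Z \<omega>) / 2 \<le> m / 8 + b * indicator ?A \<omega> + (Z \<omega>)\<^sup>2 / b" if "\<omega> \<in> space \<Omega>" for \<omega>
  proof (cases "\<omega> \<in> ?A")
    case True
    then have z: "Z \<omega> \<ge> 0" using m(2) by auto
    have "Z \<omega> \<le> b + (Z \<omega>)\<^sup>2 / b"
    proof (cases "Z \<omega> \<le> b")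
      case True
      then show ?thesis using b by (simp add: add_increasing2)
    next
      case False
      then have "Z \<omega> * b \<le> (Z \<omega>)\<^sup>2" using z by (simp add: power2_eq_square mult_left_mono)
      then have "Z \<omega> \<le> (Z \<omega>)\<^sup>2 / b" using b by (simp add: field_simps)
      then show ?thesis using b by simp
    qed
    then show ?thesis using True z m(2) by simp
  next
    case False
    then have "(\<bar>Z \<omega>\<bar> + Z \<omega>) / 2 \<le> m / 8" using that m(2) by (cases "Z \<omega> \<ge> 0") auto
    then show ?thesis using False b by (simp add: add_increasing2)
  qed
  have "m / 2 \<le> (\<integral>\<omega>. (\<bar>Z \<omega>\<bar> + Z \<omega>) / 2 \<partial>\<Omega>)" using absm Z abs_int by simp
  moreover have ind: "integrable \<Omega> (\<lambda>\<omega>. b * indicator ?A \<omega>)"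
    by (intro integrable_mult_right integrable_real_indicator) (auto simp: less_top[symmetric])
  moreover have "(\<integral>\<omega>. (\<bar>Z \<omega>\<bar> + Z \<omega>) / 2 \<partial>\<Omega>) \<le> (\<integral>\<omega>. m / 8 + b * indicator ?A \<omega> + (Z \<omega>)\<^sup>2 / b \<partial>\<Omega>)"
  proof (intro integral_mono)
    show "integrable \<Omega> (\<lambda>\<omega>. m / 8 + b * indicator ?A \<omega> + (Z \<omega>)\<^sup>2 / b)"
      by (intro Bochner_Integration.integrable_add ind) (use Z2 in auto)
  qed (use Z abs_int p2 in auto)
  moreover have "(\<integral>\<omega>. m / 8 + b * indicator ?A \<omega> + (Z \<omega>)\<^sup>2 / b \<partial>\<Omega>) = m / 8 + b * prob ?A + s / b"
    using Z2 ind by (simp add: prob_space)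
  moreover have "s / b = m / 8" using pos m(2) by (simp add: b_def)
  ultimately have "m / 4 \<le> b * prob ?A" by simp
  then show ?thesis using pos m(2) by (simp add: b_def field_simps power2_eq_square)
qed

text \<open>The bound is uniform over all unit vectors \<open>a\<close> of all dimensions, because the fourth moment of a
  linear form is the second moment of a quadratic form of Frobenius norm 1.\<close>

lemma linear_form_positive_probability:
  "\<exists>c \<delta>. c > 0 \<and> \<delta> > 0 \<and> (\<forall>n a. (\<Sum>i<n. (a i)\<^sup>2) = 1 \<longrightarrow>
     \<delta> \<le> prob {\<omega> \<in> space \<Omega>. (\<Sum>i<n. a i * e (Suc i) \<omega>) \<ge> c})"
proof -
  define C where "C = var_const + (\<sigma>\<^sup>2)\<^sup>2"
  define m where "m = \<sigma>\<^sup>2 / (2 * sqrt (2 * C / \<sigma>\<^sup>2))"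
  have C: "C > 0" using var_const_pos by (simp add: C_def add_pos_nonneg)
  then have m: "m > 0" using sigma_pos by (simp add: m_def)
  have "m\<^sup>2 / (32 * \<sigma>\<^sup>2) \<le> prob {\<omega> \<in> space \<Omega>. (\<Sum>i<n. a i * e (Suc i) \<omega>) \<ge> m / 8}"
    if one: "(\<Sum>i<n. (a i)\<^sup>2) = 1" for n a
  proof -
    let ?Z = "\<lambda>\<omega>. \<Sum>i<n. a i * e (Suc i) \<omega>"
    let ?Q = "\<lambda>i j. a i * a j"
    have q: "quad n ?Q = (\<lambda>\<omega>. (?Z \<omega>)\<^sup>2)"
      by (rule ext) (simp add: quad_def power2_eq_square sum_product mult_ac)
    have tr: "(\<Sum>i<n. ?Q i i) = 1" using one by (simp add: power2_eq_square)
    have fr: "(\<Sum>i<n. \<Sum>j<n. (?Q i j)\<^sup>2) = 1"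
      using one by (simp add: power_mult_distrib sum_distrib_left[symmetric] sum_distrib_right[symmetric])
    have Z2: "integrable \<Omega> (\<lambda>\<omega>. (?Z \<omega>)\<^sup>2)" "(\<integral>\<omega>. (?Z \<omega>)\<^sup>2 \<partial>\<Omega>) = \<sigma>\<^sup>2"
      using quad_expectation[of n ?Q] unfolding q tr by auto
    have V: "integrable \<Omega> (\<lambda>\<omega>. ((?Z \<omega>)\<^sup>2 - \<sigma>\<^sup>2)\<^sup>2)" "(\<integral>\<omega>. ((?Z \<omega>)\<^sup>2 - \<sigma>\<^sup>2)\<^sup>2 \<partial>\<Omega>) \<le> var_const"
      using quad_variance[of n ?Q] unfolding q tr fr by (auto simp: mult.commute)
    have Z4eq: "(?Z \<omega>) ^ 4 = ((?Z \<omega>)\<^sup>2 - \<sigma>\<^sup>2)\<^sup>2 + (2 * \<sigma>\<^sup>2 * (?Z \<omega>)\<^sup>2 - (\<sigma>\<^sup>2)\<^sup>2)" for \<omega>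
    proof -
      have "z ^ 4 = (z\<^sup>2 - s)\<^sup>2 + (2 * s * z\<^sup>2 - s\<^sup>2)" for z s :: real
        by (simp add: power2_eq_square power4_eq_xxxx algebra_simps)
      then show ?thesis .
    qed
    have Z4: "integrable \<Omega> (\<lambda>\<omega>. (?Z \<omega>) ^ 4)" "(\<integral>\<omega>. (?Z \<omega>) ^ 4 \<partial>\<Omega>) \<le> C"
      unfolding Z4eq using V Z2 by (auto simp: prob_space C_def power2_eq_square)
    have int1: "integrable \<Omega> (e (Suc i))" "(\<integral>\<omega>. e (Suc i) \<omega> \<partial>\<Omega>) = 0" for i
      using iid by (auto simp: iid_errors_def)
    have Z: "integrable \<Omega> ?Z" "(\<integral>\<omega>. ?Z \<omega> \<partial>\<Omega>) = 0"
      using int1 by (auto simp: Bochner_Integration.integral_sum)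
    show ?thesis unfolding m_def by (rule positive_part_probability[OF Z Z2 Z4 sigma_pos C])
  qed
  moreover have "m\<^sup>2 / (32 * \<sigma>\<^sup>2) > 0" "m / 8 > 0" using m sigma_pos by auto
  ultimately show ?thesis by blast
qed

end

section \<open>Tail sums of weights\<close>

text \<open>The tail sum \<open>w\<^sub>j + \<dots> + w\<^sub>M\<close>.\<close>

definition tail :: "nat \<Rightarrow> (nat \<Rightarrow> real) \<Rightarrow> nat \<Rightarrow> real" where
  "tail M w j = (\<Sum>m=j..M. w m)"

lemma tail_weights:
  assumes "w \<in> weights M"
  shows "tail M w 1 = 1" "j \<ge> 1 \<Longrightarrow> 0 \<le> tail M w j" "1 \<le> i \<Longrightarrow> i \<le> j \<Longrightarrow> tail M w j \<le> tail M w i"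
    "j \<ge> 1 \<Longrightarrow> tail M w j \<le> 1"
proof -
  have nn: "0 \<le> w m" if "m \<in> {1..M}" for m using assms that by (auto simp: weights_def)
  show 1: "tail M w 1 = 1" using assms by (auto simp: weights_def tail_def)
  show "0 \<le> tail M w j" if "j \<ge> 1" using nn that by (auto simp: tail_def intro!: sum_nonneg)
  show 2: "tail M w j \<le> tail M w i" if "1 \<le> i" "i \<le> j" for i j
    unfolding tail_def using nn that by (intro sum_mono2) auto
  show "tail M w j \<le> 1" if "j \<ge> 1" using 2[of 1 j] 1 that by simp
qed

text \<open>The weights with prescribed tail sums \<open>g 1, \<dots>, g M\<close>.\<close>

definition steps :: "nat \<Rightarrow> (nat \<Rightarrow> real) \<Rightarrow> nat \<Rightarrow> real" where
  "steps M g m = g m - (if m < M then g (Suc m) else 0)"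

lemma tail_steps:
  assumes "j \<le> M"
  shows "tail M (steps M g) j = g j"
  using assms
proof (induction j rule: inc_induct)
  case base
  show ?case by (simp add: tail_def steps_def)
next
  case (step j)
  have "tail M (steps M g) j = steps M g j + tail M (steps M g) (Suc j)"
    using step.hyps by (simp add: tail_def sum.atLeast_Suc_atMost)
  then show ?case using step.IH step.hyps by (simp add: steps_def[of _ _ j])
qed

lemma steps_weights:
  assumes M: "M \<ge> 1" and "g 1 = 1" and anti: "\<And>j. 1 \<le> j \<Longrightarrow> j < M \<Longrightarrow> g (Suc j) \<le> g j" and "0 \<le> g M"
  shows "steps M g \<in> weights M"
proof -
  have nn: "0 \<le> steps M g m" if "m \<in> {1..M}" for m
    using that anti[of m] assms(4) by (cases "m = M") (auto simp: steps_def)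
  have one: "(\<Sum>m=1..M. steps M g m) = 1" using tail_steps[OF M, of g] assms(2) by (simp add: tail_def)
  have "steps M g m \<le> 1" if "m \<in> {1..M}" for m
    using member_le_sum[of m "{1..M}" "steps M g"] that nn one by auto
  then show ?thesis using nn one by (auto simp: weights_def)
qed

lemma weights_of_tail:
  assumes "M \<ge> 1" "g 1 = 1" "\<And>j. 1 \<le> j \<Longrightarrow> j < M \<Longrightarrow> g (Suc j) \<le> g j" "0 \<le> g M"
  obtains w where "w \<in> weights M" "\<And>j. 1 \<le> j \<Longrightarrow> j \<le> M \<Longrightarrow> tail M w j = g j"
  using that steps_weights[OF assms] tail_steps by blast

text \<open>Rounding the tail sums down to multiples of \<open>1 / (N + 1)\<close> gives a countable dense set of weights.\<close>

lemma countable_dense_weights: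
  assumes "M \<ge> 1"
  obtains D where "countable D" "D \<subseteq> weights M"
    "\<And>w. w \<in> weights M \<Longrightarrow> \<exists>v. (\<forall>N. v N \<in> D) \<and> (\<forall>j\<in>{1..M}. (\<lambda>N. tail M (v N) j) \<longlonglongrightarrow> tail M w j)"
proof -
  define R :: "nat \<times> int list \<Rightarrow> nat \<Rightarrow> real" where
    "R p = steps M (\<lambda>j. of_int (snd p ! j) / real (Suc (fst p)))" for p
  define D where "D = range R \<inter> weights M"
  have "\<exists>v. (\<forall>N. v N \<in> D) \<and> (\<forall>j\<in>{1..M}. (\<lambda>N. tail M (v N) j) \<longlonglongrightarrow> tail M w j)" if w: "w \<in> weights M" for w
  proof -
    define l where "l N = map (\<lambda>j. \<lfloor>real (Suc N) * tail M w j\<rfloor>) [0..<Suc M]" for N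
    have lj: "l N ! j = \<lfloor>real (Suc N) * tail M w j\<rfloor>" if "j \<le> M" for N j
      using that by (simp add: l_def del: upt_Suc)
    define v where "v N = R (N, l N)" for N
    have tv: "tail M (v N) j = of_int \<lfloor>real (Suc N) * tail M w j\<rfloor> / real (Suc N)" if "j \<le> M" for N j
      using that by (simp add: v_def R_def tail_steps lj)
    have "v N \<in> weights M" for N
      unfolding v_def R_def
    proof (rule steps_weights[OF assms])
      show "of_int (snd (N, l N) ! 1) / real (Suc (fst (N, l N))) = 1"
        using assms tail_weights(1)[OF w] by (simp add: lj)
      show "of_int (snd (N, l N) ! Suc j) / real (Suc (fst (N, l N))) \<le> of_int (snd (N, l N) ! j) / real (Suc (fst (N, l N)))"
        if "1 \<le> j" "j < M" for j
        using that tail_weights(3)[OF w, of j "Suc j"] unfolding snd_conv fst_conv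
        by (intro divide_right_mono) (auto simp: lj intro!: floor_mono mult_left_mono)
      show "0 \<le> of_int (snd (N, l N) ! M) / real (Suc (fst (N, l N)))"
        using tail_weights(2)[OF w, of M] assms by (simp add: lj)
    qed
    then have vD: "v N \<in> D" for N unfolding D_def v_def by blast
    have "(\<lambda>N. tail M (v N) j) \<longlonglongrightarrow> tail M w j" if "j \<in> {1..M}" for j
    proof -
      have bound: "\<bar>tail M (v N) j - tail M w j\<bar> \<le> 1 / real (Suc N)" for N
      proof -
        let ?z = "real (Suc N) * tail M w j"
        have "tail M (v N) j - tail M w j = (of_int \<lfloor>?z\<rfloor> - ?z) / real (Suc N)"
          using tv[of j N] that by (simp add: field_simps del: of_nat_Suc)
        moreover have "\<bar>of_int \<lfloor>?z\<rfloor> - ?z\<bar> \<le> 1" by linarith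
        ultimately show ?thesis by (simp add: abs_divide divide_right_mono del: of_nat_Suc)
      qed
      have null: "(\<lambda>N. 1 / real (Suc N)) \<longlonglongrightarrow> 0"
        using LIMSEQ_inverse_real_of_nat by (simp only: inverse_eq_divide)
      have "(\<lambda>N. tail M (v N) j - tail M w j) \<longlonglongrightarrow> 0"
        by (rule Lim_null_comparison[OF always_eventually[OF allI] null])
          (use bound in \<open>simp only: real_norm_def\<close>)
      then show ?thesis by (simp add: LIM_zero_iff)
    qed
    then show ?thesis using vD by blast
  qed
  moreover have "countable D" unfolding D_def by (intro countable_Int1 countable_image) simp
  moreover have "D \<subseteq> weights M" by (simp add: D_def)
  ultimately show thesis using that by blast
qed

lemma tail_sum:
  "(\<Sum>j=a..M. tail M w j * f j) = (\<Sum>m=a..M. w m * (\<Sum>j=a..m. f j))"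
proof -
  have "(\<Sum>j=a..M. tail M w j * f j) = (\<Sum>j=a..M. \<Sum>m=a..M. if j \<le> m then w m * f j else 0)"
  proof (intro sum.cong refl)
    fix j assume "j \<in> {a..M}"
    then have "{j..M} = {a..M} \<inter> {m. j \<le> m}" by auto
    then show "tail M w j * f j = (\<Sum>m=a..M. if j \<le> m then w m * f j else 0)"
      by (simp add: tail_def sum.inter_restrict sum_distrib_right if_distrib[of "\<lambda>z. z * _"] cong: if_cong)
  qed
  also have "\<dots> = (\<Sum>m=a..M. \<Sum>j=a..M. if j \<le> m then w m * f j else 0)" by (rule sum.swap)
  also have "\<dots> = (\<Sum>m=a..M. w m * (\<Sum>j=a..m. f j))"
  proof (intro sum.cong refl)
    fix m assume "m \<in> {a..M}"
    then have "{a..m} = {a..M} \<inter> {j. j \<le> m}" by auto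
    then show "(\<Sum>j=a..M. if j \<le> m then w m * f j else 0) = w m * (\<Sum>j=a..m. f j)"
      by (simp add: sum.inter_restrict sum_distrib_left if_distrib[of "\<lambda>z. _ * z"] cong: if_cong)
  qed
  finally show ?thesis .
qed

text \<open>The quadratic form of the averaged projection, whose pairwise products are the smaller
  projections, is diagonal in the tail sums.\<close>

lemma tail_sum_square:
  "(\<Sum>j=1..M. (tail M w j)\<^sup>2 * f j) = (\<Sum>m=1..M. \<Sum>l=1..M. w m * w l * (\<Sum>j=1..min m l. f j))"
proof -
  have "(\<Sum>j=1..M. (tail M w j)\<^sup>2 * f j) = (\<Sum>m=1..M. w m * (\<Sum>j=1..m. tail M w j * f j))"
    using tail_sum[of M w "\<lambda>j. tail M w j * f j" 1] by (simp add: power2_eq_square mult.assoc)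
  also have "\<dots> = (\<Sum>m=1..M. \<Sum>l=1..M. w m * w l * (\<Sum>j=1..min m l. f j))"
  proof (intro sum.cong refl)
    fix m assume m: "m \<in> {1..M}"
    have "(\<Sum>j=1..m. tail M w j * f j) = (\<Sum>j=1..M. tail M w j * (if j \<le> m then f j else 0))"
    proof -
      have "{1..m} = {1..M} \<inter> {j. j \<le> m}" using m by auto
      then show ?thesis by (simp add: sum.inter_restrict if_distrib[of "\<lambda>z. _ * z"] cong: if_cong)
    qed
    also have "\<dots> = (\<Sum>l=1..M. w l * (\<Sum>j=1..l. if j \<le> m then f j else 0))" by (rule tail_sum)
    also have "\<dots> = (\<Sum>l=1..M. w l * (\<Sum>j=1..min m l. f j))"
    proof (intro sum.cong refl)
      fix l
      have "{1..min m l} = {1..l} \<inter> {j. j \<le> m}" by auto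
      then show "w l * (\<Sum>j=1..l. if j \<le> m then f j else 0) = w l * (\<Sum>j=1..min m l. f j)"
        by (simp add: sum.inter_restrict)
    qed
    finally show "w m * (\<Sum>j=1..m. tail M w j * f j) = (\<Sum>l=1..M. w m * w l * (\<Sum>j=1..min m l. f j))"
      by (simp add: sum_distrib_left mult.assoc)
  qed
  finally show ?thesis .
qed

lemma binary_form_nonneg:
  assumes "0 \<le> a" "0 \<le> e" "b\<^sup>2 \<le> a * (e::real)"
  shows "0 \<le> u\<^sup>2 * a + 2 * u * v * b + v\<^sup>2 * e"
proof (cases "a = 0")
  case True
  then have "b = 0" using assms(3) by simp
  then show ?thesis using assms True by simp
next
  case False
  have "0 \<le> (u * a + v * b)\<^sup>2 + v\<^sup>2 * (a * e - b\<^sup>2)" using assms by simp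
  also have "\<dots> = a * (u\<^sup>2 * a + 2 * u * v * b + v\<^sup>2 * e)" by (simp add: power2_eq_square algebra_simps)
  finally show ?thesis using False assms(1) by (simp add: zero_le_mult_iff)
qed

section \<open>Loss and criterion as separable functions of the tail sums\<close>

text \<open>In this locale, \<open>A j\<close>, \<open>B j\<close> and \<open>E j\<close> stand for \<open>\<mu>\<^sup>T D\<^sub>j \<mu>\<close>, \<open>\<mu>\<^sup>T D\<^sub>j e\<close> and \<open>e\<^sup>T D\<^sub>j e\<close>, where \<open>D\<^sub>j\<close> is
  the \<open>j\<close>-th increment of the projections, \<open>T\<close> for the index of the true model and \<open>M\<close> for the number
  of models. Everything is deterministic.\<close>

locale canonical =
  fixes M T :: nat and A B E :: "nat \<Rightarrow> real"
  assumes T: "2 \<le> T" "T < M"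
    and A_nonneg: "\<And>j. 1 \<le> j \<Longrightarrow> j \<le> M \<Longrightarrow> 0 \<le> A j"
    and E_nonneg: "\<And>j. 1 \<le> j \<Longrightarrow> j \<le> M \<Longrightarrow> 0 \<le> E j"
    and BAE: "\<And>j. 1 \<le> j \<Longrightarrow> j \<le> M \<Longrightarrow> (B j)\<^sup>2 \<le> A j * E j"
    and A_zero: "\<And>j. T < j \<Longrightarrow> j \<le> M \<Longrightarrow> A j = 0"
begin

text \<open>\<open>Y j\<close> is \<open>y\<^sup>T D\<^sub>j y\<close> and \<open>C j\<close> is \<open>e\<^sup>T D\<^sub>j y\<close>, where \<open>y = \<mu> + e\<close>; \<open>t w j\<close> is the amount by which the
  \<open>j\<close>-th increment is shrunk. \<open>crit\<close> is the criterion up to an additive constant, with \<open>d j\<close> the number of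
  covariates that model \<open>j\<close> adds and \<open>\<psi>\<close> the product of penalty factor and variance
  estimate. The loss is the sum of its underfitting part \<open>under\<close> and its overfitting part \<open>over\<close>, and \<open>r2\<close>
  is the squared distance that shrinkage moves the fit of the true model. \<open>V\<close> is the loss of the true
  model, \<open>S\<close> the part of it outside the smallest model, and \<open>W\<close> bounds what the cross terms can
  gain; a term of \<open>W\<close> with \<open>A j = 0\<close> has \<open>B j = 0\<close> as well and counts as 0.\<close>

definition Y where "Y j = A j + 2 * B j + E j"
definition C where "C j = B j + E j"
definition t where "t w j = 1 - tail M w j"
definition loss where
  "loss w = (\<Sum>j=1..M. (t w j)\<^sup>2 * A j - 2 * t w j * tail M w j * B j + (tail M w j)\<^sup>2 * E j)"
definition crit where
  "crit d \<psi> w = (\<Sum>j=1..M. (t w j)\<^sup>2 * Y j + \<psi> * (tail M w j * d j))"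
definition under where "under w = (\<Sum>j=1..T. (t w j)\<^sup>2 * Y j - 2 * t w j * C j + E j)"
definition over where "over w = (\<Sum>j=Suc T..M. (tail M w j)\<^sup>2 * E j)"
definition r2 where "r2 w = (\<Sum>j=1..T. (t w j)\<^sup>2 * Y j)"
definition V where "V = (\<Sum>j=1..T. E j)"
definition S where "S = (\<Sum>j=2..T. E j)"
definition W where "W = (\<Sum>j=2..T. (B j)\<^sup>2 / A j)"

lemma Y_nonneg: "1 \<le> j \<Longrightarrow> j \<le> M \<Longrightarrow> 0 \<le> Y j"
  using binary_form_nonneg[OF A_nonneg E_nonneg BAE, of j 1 1] by (simp add: Y_def)

lemma CYE: "1 \<le> j \<Longrightarrow> j \<le> M \<Longrightarrow> (C j)\<^sup>2 \<le> Y j * E j"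
  using BAE[of j] by (simp add: Y_def C_def power2_eq_square algebra_simps)

lemma B_zero: "T < j \<Longrightarrow> j \<le> M \<Longrightarrow> B j = 0"
  using BAE[of j] A_zero[of j] T by simp

lemma sum_first: "(\<Sum>j=1..T. f j) = f 1 + (\<Sum>j=2..T. f j :: real)"
  using sum.atLeast_Suc_atMost[of 1 T f] T by (simp add: numeral_2_eq_2)

lemma V_nonneg: "0 \<le> V" and S_nonneg: "0 \<le> S" and V_split: "V = E 1 + S"
  proof -
  show "0 \<le> V" "0 \<le> S" unfolding V_def S_def using T E_nonneg by (intro sum_nonneg; simp)+
  show "V = E 1 + S" unfolding V_def S_def by (rule sum_first)
qed

lemma E_T_le_S: "E T \<le> S"
  unfolding S_def using T E_nonneg by (intro member_le_sum) auto

lemma term_eq: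
  "(t w j)\<^sup>2 * A j - 2 * t w j * tail M w j * B j + (tail M w j)\<^sup>2 * E j =
   (t w j)\<^sup>2 * Y j - 2 * t w j * C j + E j"
  by (simp add: t_def Y_def C_def power2_eq_square algebra_simps)

lemma term_nonneg:
  assumes "1 \<le> j" "j \<le> M"
  shows "0 \<le> (t w j)\<^sup>2 * Y j - 2 * t w j * C j + E j"
  using binary_form_nonneg[OF Y_nonneg E_nonneg CYE, of j "t w j" "-1"] assms by simp

lemma loss_split: "loss w = under w + over w"
proof -
  have "loss w = (\<Sum>j\<in>{1..T} \<union> {Suc T..M}. (t w j)\<^sup>2 * A j - 2 * t w j * tail M w j * B j + (tail M w j)\<^sup>2 * E j)"
    unfolding loss_def using T by (intro sum.cong) auto
  also have "\<dots> = (\<Sum>j=1..T. (t w j)\<^sup>2 * A j - 2 * t w j * tail M w j * B j + (tail M w j)\<^sup>2 * E j) +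
    (\<Sum>j=Suc T..M. (t w j)\<^sup>2 * A j - 2 * t w j * tail M w j * B j + (tail M w j)\<^sup>2 * E j)"
    by (rule sum.union_disjoint) auto
  also have "(\<Sum>j=Suc T..M. (t w j)\<^sup>2 * A j - 2 * t w j * tail M w j * B j + (tail M w j)\<^sup>2 * E j) = over w"
    unfolding over_def by (intro sum.cong) (auto simp: A_zero B_zero)
  finally show ?thesis by (simp add: under_def term_eq)
qed

lemma over_nonneg: "0 \<le> over w"
  unfolding over_def using E_nonneg by (intro sum_nonneg) auto

lemma under_nonneg: "0 \<le> under w"
  unfolding under_def using term_nonneg T by (intro sum_nonneg) auto

lemma loss_nonneg: "0 \<le> loss w"
  using loss_split over_nonneg under_nonneg by simp

lemma loss_bdd_below: "bdd_below (loss ` X)"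
  using loss_nonneg by (intro bdd_belowI[of _ 0]) auto

lemma t_weights:
  assumes "w \<in> weights M"
  shows "t w 1 = 0" "1 \<le> j \<Longrightarrow> 0 \<le> t w j" "1 \<le> j \<Longrightarrow> t w j \<le> 1" "1 \<le> j \<Longrightarrow> j \<le> T \<Longrightarrow> t w j \<le> t w T"
  using tail_weights[OF assms] by (auto simp: t_def)

text \<open>All weight beyond the true model may be moved to the true model.\<close>

lemma truncated_weights:
  assumes "w \<in> weights M"
  obtains w' where "w' \<in> weights M" "\<And>j. 1 \<le> j \<Longrightarrow> j \<le> T \<Longrightarrow> tail M w' j = tail M w j"
    "\<And>j. T < j \<Longrightarrow> j \<le> M \<Longrightarrow> tail M w' j = 0"
proof -
  obtain w' where w': "w' \<in> weights M"
    "\<And>j. 1 \<le> j \<Longrightarrow> j \<le> M \<Longrightarrow> tail M w' j = (if j \<le> T then tail M w j else 0)"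
    by (rule weights_of_tail[of M "\<lambda>j. if j \<le> T then tail M w j else 0"])
      (use tail_weights[OF assms] T in auto)
  show thesis by (rule that[of w']) (use w' T in auto)
qed

text \<open>Hence the underfitting part of any loss is bounded below by the infimum of the loss.\<close>

lemma loss_truncated:
  assumes "w \<in> weights M"
  shows "\<exists>w'\<in>weights M. loss w' = under w"
proof -
  obtain w' where w': "w' \<in> weights M" "\<And>j. 1 \<le> j \<Longrightarrow> j \<le> T \<Longrightarrow> tail M w' j = tail M w j"
    "\<And>j. T < j \<Longrightarrow> j \<le> M \<Longrightarrow> tail M w' j = 0" using truncated_weights[OF assms] by blast
  have "under w' = under w" unfolding under_def t_def using w'(2) by (intro sum.cong) auto
  moreover have "over w' = 0" unfolding over_def using w'(3) by (intro sum.neutral) auto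
  ultimately have "loss w' = under w" using loss_split[of w'] by simp
  then show ?thesis using w'(1) by blast
qed

text \<open>The excess \<open>\<Sum>m>T. w\<^sub>m\<^sup>2 e\<^sup>T (P\<^sub>m - P\<^sub>T) e\<close> is paid on top of the infimum, since the square of a tail sum is
  at least the tail sum of the squares.\<close>

lemma overfit_lower_bound:
  assumes "w \<in> weights M"
  shows "(INF v\<in>weights M. loss v) + (\<Sum>m=Suc T..M. (w m)\<^sup>2 * (\<Sum>j=Suc T..m. E j)) \<le> loss w"
proof -
  have "(INF v\<in>weights M. loss v) \<le> under w"
    using loss_truncated[OF assms] cINF_lower[OF loss_bdd_below] by metis
  moreover have "(\<Sum>m=Suc T..M. (w m)\<^sup>2 * (\<Sum>j=Suc T..m. E j)) \<le> over w"
  proof -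
    have sq: "tail M (\<lambda>m. (w m)\<^sup>2) j \<le> (tail M w j)\<^sup>2" if "j \<ge> 1" for j
    proof -
      have nn: "0 \<le> w m" if "m \<in> {j..M}" for m using assms that \<open>j \<ge> 1\<close> by (auto simp: weights_def)
      have "(\<Sum>m=j..M. w m * w m) \<le> (\<Sum>m=j..M. w m * (\<Sum>l=j..M. w l))"
        using nn by (intro sum_mono mult_left_mono member_le_sum) auto
      then show ?thesis by (simp add: tail_def power2_eq_square sum_distrib_right)
    qed
    show ?thesis unfolding over_def tail_sum[symmetric]
      using sq E_nonneg by (intro sum_mono mult_right_mono) auto
  qed
  ultimately show ?thesis using loss_split[of w] by simp
qed

lemma loss_true_model: "\<exists>w\<in>weights M. loss w = V"
proof -
  obtain w where w: "w \<in> weights M" "\<And>j. 1 \<le> j \<Longrightarrow> j \<le> M \<Longrightarrow> tail M w j = (if j \<le> T then 1 else 0)"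
    by (rule weights_of_tail[of M "\<lambda>j. if j \<le> T then 1 else 0"]) (use T in auto)
  have "under w = V" unfolding under_def V_def t_def using w(2) T by (intro sum.cong) auto
  moreover have "over w = 0" unfolding over_def using w(2) T by (intro sum.neutral) auto
  ultimately have "loss w = V" using loss_split[of w] by simp
  then show ?thesis using w(1) by blast
qed

text \<open>Weights \<open>s\<close> and \<open>1 - s\<close> on the models \<open>T - 1\<close> and \<open>T\<close> change the loss of the true model
  by \<open>s\<^sup>2 Y\<^sub>T - 2 s C\<^sub>T\<close>, which is minimal at \<open>s = C\<^sub>T / Y\<^sub>T\<close>.\<close>

lemma loss_shrunk:
  assumes "0 \<le> C T" "C T \<le> Y T" "0 < Y T"
  shows "\<exists>w\<in>weights M. loss w = V - (C T)\<^sup>2 / Y T"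
proof -
  let ?s = "C T / Y T"
  have s: "0 \<le> ?s" "?s \<le> 1" using assms by auto
  obtain w where w: "w \<in> weights M"
    "\<And>j. 1 \<le> j \<Longrightarrow> j \<le> M \<Longrightarrow> tail M w j = (if j < T then 1 else if j = T then 1 - ?s else 0)"
    by (rule weights_of_tail[of M "\<lambda>j. if j < T then 1 else if j = T then 1 - ?s else 0"]) (use T s in auto)
  have "under w = (\<Sum>j=1..T. E j - (if j = T then (C T)\<^sup>2 / Y T else 0))"
    unfolding under_def t_def using w(2) T assms(3)
    by (intro sum.cong refl) (auto simp: power2_eq_square field_simps)
  then have "under w = V - (C T)\<^sup>2 / Y T" using T by (simp add: sum_subtractf V_def)
  moreover have "over w = 0" unfolding over_def using w(2) T by (intro sum.neutral) auto
  ultimately have "loss w = V - (C T)\<^sup>2 / Y T" using loss_split[of w] by simp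
  then show ?thesis using w(1) by blast
qed

text \<open>The underfitting part is \<open>\<parallel>P\<^sub>T e - v\<parallel>\<^sup>2\<close> for a vector \<open>v\<close> with \<open>\<parallel>v\<parallel>\<^sup>2 = r2 w\<close>.\<close>

lemma under_deviation: "\<bar>under w - V\<bar> \<le> r2 w + 2 * sqrt (r2 w) * sqrt V"
proof -
  have Yn: "0 \<le> (t w j)\<^sup>2 * Y j" and En: "0 \<le> E j" if "j \<in> {1..T}" for j
    using that T Y_nonneg[of j] E_nonneg[of j] by auto
  have eq: "under w - V = r2 w - 2 * (\<Sum>j=1..T. t w j * C j)"
    by (simp add: under_def V_def r2_def sum.distrib sum_subtractf sum_distrib_left mult.assoc)
  have "\<bar>\<Sum>j=1..T. t w j * C j\<bar> \<le> (\<Sum>j=1..T. sqrt ((t w j)\<^sup>2 * Y j) * sqrt (E j))"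
  proof (rule order.trans[OF sum_abs], rule sum_mono)
    fix j assume j: "j \<in> {1..T}"
    have "(t w j * C j)\<^sup>2 \<le> (t w j)\<^sup>2 * Y j * E j"
      using CYE[of j] j T by (simp add: power_mult_distrib mult.assoc mult_left_mono)
    then have "\<bar>t w j * C j\<bar> \<le> sqrt ((t w j)\<^sup>2 * Y j * E j)" by (metis real_sqrt_abs real_sqrt_le_mono)
    then show "\<bar>t w j * C j\<bar> \<le> sqrt ((t w j)\<^sup>2 * Y j) * sqrt (E j)" by (simp add: real_sqrt_mult)
  qed
  also have "\<dots> \<le> sqrt (r2 w) * sqrt V"
  proof -
    have "(\<Sum>j=1..T. sqrt ((t w j)\<^sup>2 * Y j) * sqrt (E j))\<^sup>2 \<le>
        (\<Sum>j=1..T. (sqrt ((t w j)\<^sup>2 * Y j))\<^sup>2) * (\<Sum>j=1..T. (sqrt (E j))\<^sup>2)"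
      by (rule Cauchy_Schwarz_ineq_sum)
    also have "(\<Sum>j=1..T. (sqrt ((t w j)\<^sup>2 * Y j))\<^sup>2) = r2 w"
      unfolding r2_def using Yn by (intro sum.cong refl) simp
    also have "(\<Sum>j=1..T. (sqrt (E j))\<^sup>2) = V" unfolding V_def using En by (intro sum.cong refl) simp
    finally have "\<bar>\<Sum>j=1..T. sqrt ((t w j)\<^sup>2 * Y j) * sqrt (E j)\<bar> \<le> sqrt (r2 w * V)"
      by (metis real_sqrt_abs real_sqrt_le_mono)
    then show ?thesis by (simp add: real_sqrt_mult)
  qed
  finally have "\<bar>\<Sum>j=1..T. t w j * C j\<bar> \<le> sqrt (r2 w) * sqrt V" .
  moreover have "0 \<le> r2 w" unfolding r2_def using Yn by (intro sum_nonneg)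
  ultimately show ?thesis unfolding eq by linarith
qed

text \<open>A competitor beating the true model has \<open>t w T \<le> \<tau>\<close>, hence \<open>t w j \<le> \<tau>\<close> for all
  \<open>j \<le> T\<close> by monotonicity; the remaining gain from the cross terms is at most \<open>W\<close>.\<close>

lemma loss_lower_bound:
  assumes w: "w \<in> weights M" and \<tau>: "0 \<le> \<tau>" "\<tau> \<le> 1" "4 * S \<le> \<tau>\<^sup>2 * Y T" "0 < Y T"
  shows "(1 - \<tau>)\<^sup>2 * V - W \<le> loss w"
proof -
  have W: "0 \<le> W" unfolding W_def using A_nonneg T by (intro sum_nonneg divide_nonneg_nonneg) auto
  have \<tau>V: "(1 - \<tau>)\<^sup>2 * V \<le> V" using \<tau> V_nonneg by (simp add: mult_left_le_one_le power_le_one)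
  show ?thesis
  proof (cases "loss w \<ge> V")
    case True
    then show ?thesis using W \<tau>V by simp
  next
    case False
    then have uV: "under w < V" using loss_split over_nonneg[of w] by simp
    have u2: "under w = E 1 + (\<Sum>j=2..T. (t w j)\<^sup>2 * Y j - 2 * t w j * C j + E j)"
      unfolding under_def sum_first using t_weights(1)[OF w] by simp
    have "(t w T)\<^sup>2 * Y T - 2 * t w T * C T + E T \<le> (\<Sum>j=2..T. (t w j)\<^sup>2 * Y j - 2 * t w j * C j + E j)"
      using T term_nonneg by (intro member_le_sum) auto
    then have 1: "(t w T)\<^sup>2 * Y T - 2 * t w T * C T + E T \<le> S" using uV u2 V_split by simp
    have "0 \<le> (t w T)\<^sup>2 * Y T - 4 * t w T * C T + 4 * E T"
      using binary_form_nonneg[OF Y_nonneg E_nonneg CYE, of T "t w T" "-2"] T by simp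
    then have "(t w T)\<^sup>2 * Y T \<le> 2 * S + 2 * E T" using 1 by simp
    also have "\<dots> \<le> \<tau>\<^sup>2 * Y T" using E_T_le_S \<tau>(3) by simp
    finally have "(t w T)\<^sup>2 \<le> \<tau>\<^sup>2" using \<tau>(4) by simp
    then have tT: "t w T \<le> \<tau>" using \<tau>(1) by (rule power2_le_imp_le)
    have "(1 - \<tau>)\<^sup>2 * E j - (B j)\<^sup>2 / A j \<le> (t w j)\<^sup>2 * Y j - 2 * t w j * C j + E j" if j: "j \<in> {2..T}" for j
    proof -
      have tj: "0 \<le> t w j" "t w j \<le> \<tau>" using t_weights(2,4)[OF w, of j] tT j by auto
      have "(1 - \<tau>)\<^sup>2 * E j \<le> (1 - t w j)\<^sup>2 * E j"
        using tj \<tau> E_nonneg[of j] j T by (intro mult_right_mono power_mono) auto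
      \<comment> \<open>complete the square in \<open>t w j\<close>\<close>
      moreover have "- ((B j)\<^sup>2 / A j) \<le> (t w j)\<^sup>2 * A j - 2 * t w j * (1 - t w j) * B j"
      proof (cases "A j = 0")
        case True
        then have "B j = 0" using BAE[of j] j T by simp
        then show ?thesis using True by simp
      next
        case False
        then have A: "A j > 0" using A_nonneg[of j] j T by simp
        let ?v = "1 - t w j"
        have v: "0 \<le> ?v" "?v \<le> 1" using tj \<tau> by auto
        have "0 \<le> (t w j * A j - ?v * B j)\<^sup>2 / A j" using A by simp
        also have "\<dots> = (t w j)\<^sup>2 * A j - 2 * t w j * ?v * B j + ?v\<^sup>2 * ((B j)\<^sup>2 / A j)"
          using A by (simp add: power2_eq_square field_simps)
        also have "?v\<^sup>2 * ((B j)\<^sup>2 / A j) \<le> (B j)\<^sup>2 / A j"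
          using v A by (intro mult_left_le_one_le) (auto simp: power_le_one)
        finally show ?thesis by simp
      qed
      ultimately show ?thesis unfolding term_eq[symmetric] by (simp add: t_def)
    qed
    then have "(\<Sum>j=2..T. (1 - \<tau>)\<^sup>2 * E j - (B j)\<^sup>2 / A j) \<le> (\<Sum>j=2..T. (t w j)\<^sup>2 * Y j - 2 * t w j * C j + E j)"
      by (rule sum_mono)
    then have "(1 - \<tau>)\<^sup>2 * S - W \<le> under w - E 1"
      using u2 by (simp add: sum_subtractf sum_distrib_left S_def W_def)
    moreover have "(1 - \<tau>)\<^sup>2 * E 1 \<le> E 1"
      using \<tau> E_nonneg[of 1] T by (intro mult_left_le_one_le) (auto simp: power_le_one)
    ultimately show ?thesis using loss_split[of w] over_nonneg[of w] by (simp add: V_split algebra_simps)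
  qed
qed

context
  fixes d :: "nat \<Rightarrow> real" and \<psi> :: real and w :: "nat \<Rightarrow> real"
  assumes d_nonneg: "\<And>j. 1 \<le> j \<Longrightarrow> j \<le> M \<Longrightarrow> 0 \<le> d j" and psi_nonneg: "0 \<le> \<psi>"
    and w: "w \<in> weights M" and minimal: "\<And>v. v \<in> weights M \<Longrightarrow> crit d \<psi> w \<le> crit d \<psi> v"
begin

lemma crit_split:
  "crit d \<psi> v = (\<Sum>j=1..T. (t v j)\<^sup>2 * Y j + \<psi> * (tail M v j * d j)) +
    (\<Sum>j=Suc T..M. (t v j)\<^sup>2 * Y j + \<psi> * (tail M v j * d j))"
proof -
  have "crit d \<psi> v = (\<Sum>j\<in>{1..T} \<union> {Suc T..M}. (t v j)\<^sup>2 * Y j + \<psi> * (tail M v j * d j))"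
    unfolding crit_def using T by (intro sum.cong) auto
  then show ?thesis by (subst (asm) sum.union_disjoint) auto
qed

text \<open>Raising the tail sums to 1 up to \<open>T\<close> does not lower the criterion. As the penalty saved
  by shrinking is at most \<open>\<psi> * t w T * (\<Sum>j=2..T. d j)\<close>, this bounds \<open>t w T\<close> first and then \<open>r2 w\<close>.\<close>

lemma minimiser_underfit:
  assumes "0 < Y T"
  shows "r2 w \<le> \<psi>\<^sup>2 * (\<Sum>j=2..T. d j)\<^sup>2 / Y T" "0 \<le> r2 w"
proof -
  let ?D = "\<Sum>j=2..T. d j"
  obtain v where v: "v \<in> weights M" "\<And>j. 1 \<le> j \<Longrightarrow> j \<le> M \<Longrightarrow> tail M v j = (if j \<le> T then 1 else tail M w j)"
    by (rule weights_of_tail[of M "\<lambda>j. if j \<le> T then 1 else tail M w j"]) (use tail_weights[OF w] T in auto)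
  have "(\<Sum>j=Suc T..M. (t v j)\<^sup>2 * Y j + \<psi> * (tail M v j * d j)) =
      (\<Sum>j=Suc T..M. (t w j)\<^sup>2 * Y j + \<psi> * (tail M w j * d j))"
    using v(2) T by (intro sum.cong) (auto simp: t_def)
  moreover have "(\<Sum>j=1..T. (t v j)\<^sup>2 * Y j + \<psi> * (tail M v j * d j)) = (\<Sum>j=1..T. \<psi> * d j)"
    using v(2) T by (intro sum.cong) (auto simp: t_def)
  ultimately have "(\<Sum>j=1..T. (t w j)\<^sup>2 * Y j + \<psi> * (tail M w j * d j)) \<le> (\<Sum>j=1..T. \<psi> * d j)"
    using minimal[OF v(1)] crit_split[of v] crit_split[of w] by simp
  then have "r2 w \<le> \<psi> * (\<Sum>j=1..T. t w j * d j)"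
    by (simp add: r2_def sum.distrib t_def sum_distrib_left sum_subtractf left_diff_distrib right_diff_distrib algebra_simps)
  also have "(\<Sum>j=1..T. t w j * d j) = (\<Sum>j=2..T. t w j * d j)"
    unfolding sum_first using t_weights(1)[OF w] by simp
  also have "\<psi> * \<dots> \<le> \<psi> * (\<Sum>j=2..T. t w T * d j)"
    using T t_weights(4)[OF w] d_nonneg psi_nonneg by (intro mult_left_mono sum_mono mult_right_mono) auto
  finally have r: "r2 w \<le> \<psi> * (t w T * ?D)" by (simp add: sum_distrib_left)
  show nn: "0 \<le> r2 w" unfolding r2_def using Y_nonneg T by (intro sum_nonneg) auto
  have "(t w T)\<^sup>2 * Y T \<le> r2 w" unfolding r2_def using T Y_nonneg by (intro member_le_sum) auto
  then have *: "t w T * (t w T * Y T) \<le> t w T * (\<psi> * ?D)" using r by (simp add: power2_eq_square algebra_simps)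
  have D: "0 \<le> ?D" using d_nonneg T by (intro sum_nonneg) auto
  have "t w T * Y T \<le> \<psi> * ?D"
  proof (cases "t w T = 0")
    case True
    then show ?thesis using D psi_nonneg by simp
  next
    case False
    then have "t w T > 0" using t_weights(2)[OF w, of T] T by simp
    then show ?thesis using * by simp
  qed
  then have "t w T \<le> \<psi> * ?D / Y T" using assms by (simp add: field_simps)
  then have "\<psi> * ?D * t w T \<le> \<psi> * ?D * (\<psi> * ?D / Y T)" using D psi_nonneg by (intro mult_left_mono) auto
  then show "r2 w \<le> \<psi>\<^sup>2 * ?D\<^sup>2 / Y T" using r by (simp add: power2_eq_square algebra_simps)
qed

text \<open>Setting the tail sums beyond \<open>T\<close> to 0 does not lower the criterion either, so \<open>over w\<close> is
  at most \<open>\<Sum>j>T. tail M w j * (2 * E j - \<psi> * d j)\<close>. By summation by parts this is a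
  combination of the partial sums in the assumption with the nonnegative coefficients \<open>w m\<close>.\<close>

lemma minimiser_overfit:
  assumes F: "\<And>m. T < m \<Longrightarrow> m \<le> M \<Longrightarrow> 2 * (\<Sum>j=Suc T..m. E j) \<le> \<psi> * (\<Sum>j=Suc T..m. d j)"
  shows "over w \<le> 0"
proof -
  obtain v where v: "v \<in> weights M" "\<And>j. 1 \<le> j \<Longrightarrow> j \<le> T \<Longrightarrow> tail M v j = tail M w j"
    "\<And>j. T < j \<Longrightarrow> j \<le> M \<Longrightarrow> tail M v j = 0" using truncated_weights[OF w] by blast
  have YE: "Y j = E j" if "T < j" "j \<le> M" for j using that A_zero B_zero by (simp add: Y_def)
  have "(\<Sum>j=Suc T..M. (t v j)\<^sup>2 * Y j + \<psi> * (tail M v j * d j)) = (\<Sum>j=Suc T..M. E j)"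
    using v(3) YE by (intro sum.cong) (auto simp: t_def)
  moreover have "(\<Sum>j=1..T. (t v j)\<^sup>2 * Y j + \<psi> * (tail M v j * d j)) =
      (\<Sum>j=1..T. (t w j)\<^sup>2 * Y j + \<psi> * (tail M w j * d j))"
    using v(2) T by (intro sum.cong) (auto simp: t_def)
  ultimately have "(\<Sum>j=Suc T..M. (t w j)\<^sup>2 * Y j + \<psi> * (tail M w j * d j)) \<le> (\<Sum>j=Suc T..M. E j)"
    using minimal[OF v(1)] crit_split[of v] crit_split[of w] by simp
  moreover have "(\<Sum>j=Suc T..M. (t w j)\<^sup>2 * Y j + \<psi> * (tail M w j * d j)) - (\<Sum>j=Suc T..M. E j) =
      over w - (\<Sum>j=Suc T..M. tail M w j * (2 * E j - \<psi> * d j))"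
    unfolding over_def sum_subtractf[symmetric]
    by (intro sum.cong refl) (auto simp: YE t_def power2_eq_square algebra_simps)
  ultimately have "over w \<le> (\<Sum>j=Suc T..M. tail M w j * (2 * E j - \<psi> * d j))" by simp
  also have "\<dots> = (\<Sum>m=Suc T..M. w m * (\<Sum>j=Suc T..m. 2 * E j - \<psi> * d j))" by (rule tail_sum)
  also have "\<dots> \<le> 0"
  proof (rule sum_nonpos)
    fix m assume m: "m \<in> {Suc T..M}"
    have "0 \<le> w m" using w m by (auto simp: weights_def)
    moreover have "(\<Sum>j=Suc T..m. 2 * E j - \<psi> * d j) \<le> 0"
      using F[of m] m by (simp add: sum_subtractf sum_distrib_left)
    ultimately show "w m * (\<Sum>j=Suc T..m. 2 * E j - \<psi> * d j) \<le> 0" by (rule mult_nonneg_nonpos)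
  qed
  finally show ?thesis .
qed

end

lemma over_le:
  assumes "w \<in> weights M"
  shows "over w \<le> (\<Sum>j=Suc T..M. E j)"
  unfolding over_def using E_nonneg tail_weights[OF assms]
  by (intro sum_mono mult_left_le_one_le) (auto simp: power_le_one)

lemma Y_T_lower: "4 * E T \<le> A T \<Longrightarrow> A T \<le> 4 * Y T"
  using binary_form_nonneg[OF A_nonneg E_nonneg BAE, of T 1 2] T by (simp add: Y_def)

lemma Y_T_upper: "Y T \<le> 2 * A T + 2 * E T"
  using binary_form_nonneg[OF A_nonneg E_nonneg BAE, of T 1 "-1"] T by (simp add: Y_def)

text \<open>The loss is at most \<open>(1 + 4 \<delta>) V\<close> and its infimum at least \<open>(1 - 3 \<delta>) V \<ge> V / 2\<close>.\<close>

lemma loss_ratio: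
  assumes w: "w \<in> weights M" and V: "0 < V" and \<delta>: "0 < \<delta>" "\<delta> \<le> 1 / 6"
    and "r2 w \<le> \<delta>\<^sup>2 * V" "0 \<le> r2 w" "over w \<le> \<delta> * V" "W \<le> \<delta> * V" "4 * S \<le> \<delta>\<^sup>2 * Y T" "0 < Y T"
  shows "\<bar>loss w / (INF v\<in>weights M. loss v) - 1\<bar> \<le> 14 * \<delta>"
proof -
  let ?I = "INF v\<in>weights M. loss v"
  have I: "(1 - 3 * \<delta>) * V \<le> ?I"
  proof (rule cINF_greatest)
    show "weights M \<noteq> {}" using w by auto
    fix v assume v: "v \<in> weights M"
    have "(1 - 3 * \<delta>) * V \<le> (1 - \<delta>)\<^sup>2 * V - W"
    proof -
      have "0 \<le> \<delta>\<^sup>2 * V" using V by simp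
      then show ?thesis using assms(8) by (simp add: power2_eq_square algebra_simps)
    qed
    also have "\<dots> \<le> loss v" using v \<delta> assms by (intro loss_lower_bound) auto
    finally show "(1 - 3 * \<delta>) * V \<le> loss v" .
  qed
  have half: "1 / 2 * V \<le> (1 - 3 * \<delta>) * V" using \<delta> V by (intro mult_right_mono) auto
  have "V / 2 \<le> ?I" using order.trans[OF half I] by simp
  with V have I2: "V / 2 \<le> ?I" "0 < ?I" by linarith+
  have le: "?I \<le> loss w" by (rule cINF_lower[OF loss_bdd_below w])
  have "sqrt (r2 w) \<le> \<delta> * sqrt V"
    using real_sqrt_le_mono[OF assms(5)] \<delta> by (simp add: real_sqrt_mult)
  then have "sqrt (r2 w) * sqrt V \<le> \<delta> * sqrt V * sqrt V" by (rule mult_right_mono) (use V in simp)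
  moreover have "\<delta> * sqrt V * sqrt V = \<delta> * V" using V by (simp add: mult.assoc)
  ultimately have "sqrt (r2 w) * sqrt V \<le> \<delta> * V" by linarith
  moreover have "\<delta>\<^sup>2 * V \<le> \<delta> * V" using \<delta> V by (intro mult_right_mono) (auto simp: power2_eq_square)
  ultimately have "loss w \<le> (1 + 4 * \<delta>) * V"
    using under_deviation[of w] loss_split[of w] assms(5,7) by (simp add: algebra_simps)
  then have "loss w - ?I \<le> 7 * \<delta> * V" using I by (simp add: algebra_simps)
  also have "\<dots> \<le> 14 * \<delta> * ?I" using I2 \<delta> by (simp add: mult_left_mono)
  finally have "(loss w - ?I) / ?I \<le> 14 * \<delta>" using I2 by (simp add: field_simps)
  moreover have "loss w / ?I - 1 = (loss w - ?I) / ?I" using I2 by (simp add: field_simps)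
  ultimately show ?thesis using le I2 by simp
qed

end

section \<open>Nested projections and their increments\<close>

lemma nested_proj:
  assumes nc: "nested_candidates x n K M"
  shows proj_carrier: "m \<in> {1..M} \<Longrightarrow> proj x n K m \<in> carrier_mat n n"
    and proj_orth: "m \<in> {1..M} \<Longrightarrow> orth_proj n (proj x n K m)"
    and proj_trace: "m \<in> {1..M} \<Longrightarrow> (\<Sum>i<n. proj x n K m $$ (i, i)) = real (K m)"
    and proj_mult: "l \<in> {1..M} \<Longrightarrow> m \<in> {1..M} \<Longrightarrow> proj x n K m * proj x n K l = proj x n K (min m l)"
    and K_less: "l \<in> {1..M} \<Longrightarrow> m \<in> {1..M} \<Longrightarrow> l < m \<Longrightarrow> K l < K m"
    and K_le: "l \<in> {1..M} \<Longrightarrow> m \<in> {1..M} \<Longrightarrow> l \<le> m \<Longrightarrow> K l \<le> K m"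
proof -
  have rank: "full_col_rank (design x n (K m))" if "m \<in> {1..M}" for m
    using nc that by (auto simp: nested_candidates_def)
  have mono: "strict_mono_on {1..M} K" using nc by (auto simp: nested_candidates_def)
  show less: "K l < K m" if "l \<in> {1..M}" "m \<in> {1..M}" "l < m" for l m
    using mono that by (auto simp: strict_mono_on_def)
  show le: "K l \<le> K m" if "l \<in> {1..M}" "m \<in> {1..M}" "l \<le> m" for l m
    using less[of l m] that by (cases "l = m") auto
  show "proj x n K m \<in> carrier_mat n n" "(\<Sum>i<n. proj x n K m $$ (i, i)) = real (K m)" if "m \<in> {1..M}" for m
    unfolding proj_def using hat_matrix_props[OF design_carrier rank[OF that]] by auto
  show mult: "proj x n K m * proj x n K l = proj x n K (min m l)" if "l \<in> {1..M}" "m \<in> {1..M}" for l m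
  proof (cases "l \<le> m")
    case True
    then show ?thesis
      unfolding proj_def using hat_matrix_nested(1)[OF le rank rank] that by (simp add: min_absorb2)
  next
    case False
    then show ?thesis
      unfolding proj_def using hat_matrix_nested(2)[OF le rank rank, of m l] that by (simp add: min_absorb1)
  qed
  show "orth_proj n (proj x n K m)" if "m \<in> {1..M}" for m
    unfolding orth_proj_def using mult[OF that that] hat_matrix_props[OF design_carrier rank[OF that]]
    by (simp add: proj_def)
qed

text \<open>The increment of the projections at model \<open>j\<close>, the bilinear form that it defines, and the
  number of covariates that model \<open>j\<close> adds. The first increment starts from the zero model.\<close>

definition incr :: "(nat \<Rightarrow> nat \<Rightarrow> real) \<Rightarrow> nat \<Rightarrow> (nat \<Rightarrow> nat) \<Rightarrow> nat \<Rightarrow> real mat" where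
  "incr x n K j = (if j = 1 then proj x n K 1 else proj x n K j - proj x n K (j - 1))"

definition iform :: "(nat \<Rightarrow> nat \<Rightarrow> real) \<Rightarrow> nat \<Rightarrow> (nat \<Rightarrow> nat) \<Rightarrow> real vec \<Rightarrow> real vec \<Rightarrow> nat \<Rightarrow> real" where
  "iform x n K u v j = u \<bullet> (incr x n K j *\<^sub>v v)"

definition kinc :: "(nat \<Rightarrow> nat) \<Rightarrow> nat \<Rightarrow> real" where
  "kinc K j = (if j = 1 then real (K 1) else real (K j) - real (K (j - 1)))"

lemma sum_kinc:
  assumes "m \<ge> 1"
  shows "(\<Sum>j=1..m. kinc K j) = real (K m)"
  using assms
proof (induction m rule: dec_induct)
  case base
  show ?case by (simp add: kinc_def)
next
  case (step m)
  then show ?case by (simp add: kinc_def)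
qed

lemma sum_between:
  fixes f :: "nat \<Rightarrow> real"
  assumes "l \<le> m"
  shows "(\<Sum>j=Suc l..m. f j) = (\<Sum>j=1..m. f j) - (\<Sum>j=1..l. f j)"
proof -
  have "{1..m} = {1..l} \<union> {Suc l..m}" using assms by auto
  then have "(\<Sum>j=1..m. f j) = (\<Sum>j=1..l. f j) + (\<Sum>j=Suc l..m. f j)"
    by (metis sum.union_disjoint finite_atLeastAtMost ivl_disj_int_two(8) Suc_eq_plus1 atLeastSucAtMost_greaterThanAtMost)
  then show ?thesis by simp
qed

lemma proj_diff_orth:
  assumes "nested_candidates x n K M" "1 \<le> l" "l \<le> m" "m \<le> M"
  shows "orth_proj n (proj x n K m - proj x n K l)"
    "(\<Sum>i<n. (proj x n K m - proj x n K l) $$ (i, i)) = real (K m) - real (K l)"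
proof -
  have lm: "l \<in> {1..M}" "m \<in> {1..M}" using assms by auto
  note N = nested_proj[OF assms(1)]
  show "orth_proj n (proj x n K m - proj x n K l)"
    using N(4)[OF lm] N(4)[OF lm(2,1)] assms(3)
    by (intro orth_proj_diff N lm) (auto simp: min_absorb1 min_absorb2)
  have "(\<Sum>i<n. (proj x n K m - proj x n K l) $$ (i, i)) = (\<Sum>i<n. proj x n K m $$ (i, i) - proj x n K l $$ (i, i))"
    using N(1)[OF lm(1)] N(1)[OF lm(2)] by (intro sum.cong) auto
  then show "(\<Sum>i<n. (proj x n K m - proj x n K l) $$ (i, i)) = real (K m) - real (K l)"
    using N(3)[OF lm(1)] N(3)[OF lm(2)] by (simp add: sum_subtractf)
qed

lemma incr_orth:
  assumes "nested_candidates x n K M" "j \<in> {1..M}"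
  shows "orth_proj n (incr x n K j)"
  using proj_diff_orth(1)[OF assms(1), of "j - 1" j] proj_orth[OF assms(1), of 1] assms(2)
  by (auto simp: incr_def)

lemma sum_iform:
  assumes nc: "nested_candidates x n K M" and uv: "u \<in> carrier_vec n" "v \<in> carrier_vec n"
    and "1 \<le> m" "m \<le> M"
  shows "(\<Sum>j=1..m. iform x n K u v j) = u \<bullet> (proj x n K m *\<^sub>v v)"
  using assms(4,5)
proof (induction m rule: dec_induct)
  case base
  show ?case by (simp add: iform_def incr_def)
next
  case (step m)
  have "u \<bullet> ((proj x n K (Suc m) - proj x n K m) *\<^sub>v v) =
      u \<bullet> (proj x n K (Suc m) *\<^sub>v v) - u \<bullet> (proj x n K m *\<^sub>v v)"
    using step by (intro diff_form[of _ n] proj_carrier[OF nc] uv) auto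
  then show ?case using step by (simp add: iform_def incr_def)
qed

lemma sum_iform_between:
  assumes nc: "nested_candidates x n K M" and uv: "u \<in> carrier_vec n" "v \<in> carrier_vec n"
    and lm: "1 \<le> l" "l \<le> m" "m \<le> M"
  shows "(\<Sum>j=Suc l..m. iform x n K u v j) = u \<bullet> ((proj x n K m - proj x n K l) *\<^sub>v v)"
proof -
  have "u \<bullet> ((proj x n K m - proj x n K l) *\<^sub>v v) = u \<bullet> (proj x n K m *\<^sub>v v) - u \<bullet> (proj x n K l *\<^sub>v v)"
    using lm by (intro diff_form[of _ n] proj_carrier[OF nc] uv) auto
  then show ?thesis
    unfolding sum_between[OF lm(2)] using sum_iform[OF nc uv, of m] sum_iform[OF nc uv, of l] lm by simp
qed

lemma avg_proj_carrier: "avg_proj x n K M w \<in> carrier_mat n n"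
  by (simp add: avg_proj_def)

lemma avg_proj_sum:
  assumes nc: "nested_candidates x n K M" and uv: "u \<in> carrier_vec n" "v \<in> carrier_vec n"
  shows "u \<bullet> (avg_proj x n K M w *\<^sub>v v) = (\<Sum>m=1..M. w m * (u \<bullet> (proj x n K m *\<^sub>v v)))"
proof -
  have "u \<bullet> (avg_proj x n K M w *\<^sub>v v) =
      (\<Sum>i<n. \<Sum>j<n. (\<Sum>m=1..M. w m * proj x n K m $$ (i, j)) * (u $ i * v $ j))"
    by (subst scalar_prod_mult_mat_vec[OF avg_proj_carrier uv]) (auto simp: avg_proj_def intro!: sum.cong)
  also have "\<dots> = (\<Sum>i<n. \<Sum>j<n. \<Sum>m=1..M. w m * (proj x n K m $$ (i, j) * (u $ i * v $ j)))"
    by (simp add: sum_distrib_right mult.assoc)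
  also have "\<dots> = (\<Sum>i<n. \<Sum>m=1..M. \<Sum>j<n. w m * (proj x n K m $$ (i, j) * (u $ i * v $ j)))"
    by (intro sum.cong refl sum.swap)
  also have "\<dots> = (\<Sum>m=1..M. \<Sum>i<n. \<Sum>j<n. w m * (proj x n K m $$ (i, j) * (u $ i * v $ j)))"
    by (rule sum.swap)
  also have "\<dots> = (\<Sum>m=1..M. w m * (u \<bullet> (proj x n K m *\<^sub>v v)))"
  proof (intro sum.cong refl)
    fix m assume "m \<in> {1..M}"
    then show "(\<Sum>i<n. \<Sum>j<n. w m * (proj x n K m $$ (i, j) * (u $ i * v $ j))) = w m * (u \<bullet> (proj x n K m *\<^sub>v v))"
      by (subst scalar_prod_mult_mat_vec[OF proj_carrier[OF nc] uv]) (auto simp: sum_distrib_left)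
  qed
  finally show ?thesis .
qed

lemma avg_proj_tail:
  assumes nc: "nested_candidates x n K M" and uv: "u \<in> carrier_vec n" "v \<in> carrier_vec n"
  shows "u \<bullet> (avg_proj x n K M w *\<^sub>v v) = (\<Sum>j=1..M. tail M w j * iform x n K u v j)"
  unfolding avg_proj_sum[OF assms] tail_sum
proof (intro sum.cong refl)
  fix m assume "m \<in> {1..M}"
  then show "w m * (u \<bullet> (proj x n K m *\<^sub>v v)) = w m * (\<Sum>j=1..m. iform x n K u v j)"
    using sum_iform[OF assms, of m] by simp
qed

text \<open>This is where nestedness enters: \<open>P\<^sub>m P\<^sub>l\<close> is the projection with the smaller index.\<close>

lemma avg_proj_norm:
  assumes nc: "nested_candidates x n K M" and y: "y \<in> carrier_vec n"
  shows "(avg_proj x n K M w *\<^sub>v y) \<bullet> (avg_proj x n K M w *\<^sub>v y) = (\<Sum>j=1..M. (tail M w j)\<^sup>2 * iform x n K y y j)"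
proof -
  let ?z = "avg_proj x n K M w *\<^sub>v y"
  have z: "?z \<in> carrier_vec n" using avg_proj_carrier y by (rule mult_mat_vec_carrier)
  have "?z \<bullet> ?z = (\<Sum>m=1..M. w m * (?z \<bullet> (proj x n K m *\<^sub>v y)))" by (rule avg_proj_sum[OF nc z y])
  also have "\<dots> = (\<Sum>m=1..M. \<Sum>l=1..M. w m * w l * (\<Sum>j=1..min m l. iform x n K y y j))"
  proof (intro sum.cong refl)
    fix m assume m: "m \<in> {1..M}"
    have Pm: "proj x n K m *\<^sub>v y \<in> carrier_vec n" using proj_carrier[OF nc m] y by (rule mult_mat_vec_carrier)
    have "?z \<bullet> (proj x n K m *\<^sub>v y) = (proj x n K m *\<^sub>v y) \<bullet> ?z" by (rule comm_scalar_prod[OF z Pm])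
    also have "\<dots> = (\<Sum>l=1..M. w l * ((proj x n K m *\<^sub>v y) \<bullet> (proj x n K l *\<^sub>v y)))" by (rule avg_proj_sum[OF nc Pm y])
    also have "\<dots> = (\<Sum>l=1..M. w l * (\<Sum>j=1..min m l. iform x n K y y j))"
    proof (intro sum.cong refl)
      fix l assume l: "l \<in> {1..M}"
      have Pl: "proj x n K l *\<^sub>v y \<in> carrier_vec n" using proj_carrier[OF nc l] y by (rule mult_mat_vec_carrier)
      have "(proj x n K m *\<^sub>v y) \<bullet> (proj x n K l *\<^sub>v y) = y \<bullet> (proj x n K m *\<^sub>v (proj x n K l *\<^sub>v y))"
        using transpose_vec_mult_scalar[OF proj_carrier[OF nc m] Pl y] proj_orth[OF nc m]
          comm_scalar_prod[OF Pl Pm] symmetric_form_swap[OF proj_carrier[OF nc m] _ Pl y]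
        by (simp add: orth_proj_def)
      also have "\<dots> = y \<bullet> (proj x n K (min m l) *\<^sub>v y)"
        using assoc_mult_mat_vec[OF proj_carrier[OF nc m] proj_carrier[OF nc l] y] proj_mult[OF nc l m] by simp
      also have "\<dots> = (\<Sum>j=1..min m l. iform x n K y y j)"
        using l m by (intro sum_iform[OF nc y y, symmetric]) auto
      finally show "w l * ((proj x n K m *\<^sub>v y) \<bullet> (proj x n K l *\<^sub>v y)) = w l * (\<Sum>j=1..min m l. iform x n K y y j)"
        by simp
    qed
    finally show "w m * (?z \<bullet> (proj x n K m *\<^sub>v y)) = (\<Sum>l=1..M. w m * w l * (\<Sum>j=1..min m l. iform x n K y y j))"
      by (simp add: sum_distrib_left mult.assoc)
  qed
  finally show ?thesis unfolding tail_sum_square .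
qed

lemma residual_norm:
  assumes nc: "nested_candidates x n K M" and u: "u \<in> carrier_vec n" and y: "y \<in> carrier_vec n"
  shows "sq_norm2 (u - avg_proj x n K M w *\<^sub>v y) =
    u \<bullet> u - 2 * (\<Sum>j=1..M. tail M w j * iform x n K u y j) + (\<Sum>j=1..M. (tail M w j)\<^sup>2 * iform x n K y y j)"
proof -
  let ?z = "avg_proj x n K M w *\<^sub>v y"
  have z: "?z \<in> carrier_vec n" using avg_proj_carrier y by (rule mult_mat_vec_carrier)
  have "sq_norm2 (u - ?z) = u \<bullet> (u - ?z) - ?z \<bullet> (u - ?z)"
    unfolding sq_norm2_def by (rule minus_scalar_prod_distrib[OF u z]) (use u z in auto)
  also have "\<dots> = (u \<bullet> u - u \<bullet> ?z) - (?z \<bullet> u - ?z \<bullet> ?z)"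
    using scalar_prod_minus_distrib[OF u u z] scalar_prod_minus_distrib[OF z u z] by simp
  also have "\<dots> = u \<bullet> u - 2 * (u \<bullet> ?z) + ?z \<bullet> ?z" using comm_scalar_prod[OF u z] by simp
  finally show ?thesis unfolding avg_proj_tail[OF nc u y] avg_proj_norm[OF nc y] .
qed

lemma iform_add:
  assumes nc: "nested_candidates x n K M" and j: "j \<in> {1..M}" and u: "u \<in> carrier_vec n" and v: "v \<in> carrier_vec n"
  shows "iform x n K u (u + v) j = iform x n K u u j + iform x n K u v j"
    "iform x n K (u + v) (u + v) j = iform x n K u u j + 2 * iform x n K u v j + iform x n K v v j"
proof -
  let ?Q = "incr x n K j"
  have Q: "?Q \<in> carrier_mat n n" "?Q\<^sup>T = ?Q" using incr_orth[OF nc j] by (auto simp: orth_proj_def)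
  have "?Q *\<^sub>v (u + v) = ?Q *\<^sub>v u + ?Q *\<^sub>v v" by (rule mult_add_distrib_mat_vec[OF Q(1) u v])
  then show "iform x n K u (u + v) j = iform x n K u u j + iform x n K u v j"
    unfolding iform_def using scalar_prod_add_distrib[OF u, of "?Q *\<^sub>v u" "?Q *\<^sub>v v"] Q(1) u v by simp
  have "u + 1 \<cdot>\<^sub>v v = u + v" using v by simp
  then show "iform x n K (u + v) (u + v) j = iform x n K u u j + 2 * iform x n K u v j + iform x n K v v j"
    unfolding iform_def using quadratic_form_add[OF Q u v, of 1] by simp
qed

lemma iform_nonneg:
  assumes "nested_candidates x n K M" "j \<in> {1..M}" "u \<in> carrier_vec n"
  shows "0 \<le> iform x n K u u j"
  unfolding iform_def by (rule orth_proj_form(2)[OF incr_orth[OF assms(1,2)] assms(3)])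

lemma iform_Cauchy_Schwarz:
  assumes "nested_candidates x n K M" "j \<in> {1..M}" "u \<in> carrier_vec n" "v \<in> carrier_vec n"
  shows "(iform x n K u v j)\<^sup>2 \<le> iform x n K u u j * iform x n K v v j"
  unfolding iform_def using incr_orth[OF assms(1,2)] orth_proj_form(2)[OF incr_orth[OF assms(1,2)]] assms(3,4)
  by (intro psd_Cauchy_Schwarz) (auto simp: orth_proj_def)

section \<open>Events of probability tending to one\<close>

text \<open>\<open>P n\<close> holds with probability tending to 1, in the sense that it can only fail on
  measurable sets whose probability tends to 0. In this form the notion is closed under weakening without any
  measurability of the events themselves.\<close>

definition whp :: "'a measure \<Rightarrow> (nat \<Rightarrow> 'a \<Rightarrow> bool) \<Rightarrow> bool" where
  "whp \<Omega> P \<longleftrightarrow> (\<exists>N. (\<forall>n. N n \<in> sets \<Omega>) \<and> (\<forall>n. \<forall>\<omega>\<in>space \<Omega> - N n. P n \<omega>) \<and> (\<lambda>n. measure \<Omega> (N n)) \<longlonglongrightarrow> 0)"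

context prob_space
begin

lemma whp_eventuallyI:
  assumes "\<forall>\<^sub>F n in sequentially. N n \<in> sets M \<and> (\<forall>\<omega>\<in>space M - N n. P n \<omega>) \<and> measure M (N n) \<le> a n"
    and "a \<longlonglongrightarrow> 0"
  shows "whp M P"
proof -
  obtain n1 where n1: "\<And>n. n \<ge> n1 \<Longrightarrow> N n \<in> sets M \<and> (\<forall>\<omega>\<in>space M - N n. P n \<omega>) \<and> measure M (N n) \<le> a n"
    using assms(1) by (auto simp: eventually_sequentially)
  define N' where "N' n = (if n \<ge> n1 then N n else space M)" for n
  have "(\<lambda>n. measure M (N' n)) \<longlonglongrightarrow> 0"
  proof (rule Lim_null_comparison[OF _ assms(2)])
    show "\<forall>\<^sub>F n in sequentially. norm (measure M (N' n)) \<le> a n"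
      using n1 by (auto simp: eventually_sequentially N'_def intro!: exI[of _ n1])
  qed
  then show ?thesis unfolding whp_def using n1 by (intro exI[of _ N']) (auto simp: N'_def)
qed

lemma whp_conj:
  assumes "whp M P" "whp M Q"
  shows "whp M (\<lambda>n \<omega>. P n \<omega> \<and> Q n \<omega>)"
proof -
  obtain N where N: "\<And>n. N n \<in> sets M" "\<And>n \<omega>. \<omega> \<in> space M - N n \<Longrightarrow> P n \<omega>" "(\<lambda>n. measure M (N n)) \<longlonglongrightarrow> 0"
    using assms(1) by (auto simp: whp_def)
  obtain N' where N': "\<And>n. N' n \<in> sets M" "\<And>n \<omega>. \<omega> \<in> space M - N' n \<Longrightarrow> Q n \<omega>" "(\<lambda>n. measure M (N' n)) \<longlonglongrightarrow> 0"
    using assms(2) by (auto simp: whp_def)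
  have "measure M (N n \<union> N' n) \<le> measure M (N n) + measure M (N' n)" for n
    by (rule measure_Un_le) (use N N' in auto)
  then show ?thesis
    using tendsto_add[OF N(3) N'(3)] N(1,2) N'(1,2)
    by (intro whp_eventuallyI[of "\<lambda>n. N n \<union> N' n" _ "\<lambda>n. measure M (N n) + measure M (N' n)"])
      (auto intro!: always_eventually)
qed

lemma whp_mono:
  assumes "whp M P" "\<And>n \<omega>. n \<ge> n1 \<Longrightarrow> \<omega> \<in> space M \<Longrightarrow> P n \<omega> \<Longrightarrow> Q n \<omega>"
  shows "whp M Q"
proof -
  obtain N where N: "\<And>n. N n \<in> sets M" "\<And>n \<omega>. \<omega> \<in> space M - N n \<Longrightarrow> P n \<omega>" "(\<lambda>n. measure M (N n)) \<longlonglongrightarrow> 0"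
    using assms(1) by (auto simp: whp_def)
  show ?thesis
    by (rule whp_eventuallyI[OF _ N(3), of N], rule eventually_mono[OF eventually_ge_at_top[of n1]])
      (use N(1,2) assms(2) in auto)
qed

lemma whp_of_eventually:
  assumes "\<forall>\<^sub>F n in sequentially. P n"
  shows "whp M (\<lambda>n \<omega>. P n)"
  by (rule whp_eventuallyI[of "\<lambda>_. {}" _ "\<lambda>_. 0"]) (use assms in \<open>auto elim: eventually_mono\<close>)

lemma whp_Markov:
  assumes "\<forall>\<^sub>F n in sequentially. integrable M (Z n) \<and> (\<forall>\<omega>\<in>space M. 0 \<le> Z n \<omega>) \<and> (\<integral>\<omega>. Z n \<omega> \<partial>M) \<le> a n"
    and "a \<longlonglongrightarrow> 0" "(c::real) > 0"
  shows "whp M (\<lambda>n \<omega>. Z n \<omega> \<le> c)"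
proof (rule whp_eventuallyI[of "\<lambda>n. {\<omega>\<in>space M. Z n \<omega> \<ge> c}" _ "\<lambda>n. a n / c"])
  show "(\<lambda>n. a n / c) \<longlonglongrightarrow> 0" using tendsto_divide[OF assms(2) tendsto_const[of c]] assms(3) by simp
  show "\<forall>\<^sub>F n in sequentially. {\<omega>\<in>space M. Z n \<omega> \<ge> c} \<in> sets M \<and>
      (\<forall>\<omega>\<in>space M - {\<omega>\<in>space M. Z n \<omega> \<ge> c}. Z n \<omega> \<le> c) \<and> measure M {\<omega>\<in>space M. Z n \<omega> \<ge> c} \<le> a n / c"
    using assms(1)
  proof eventually_elim
    case (elim n)
    have [measurable]: "Z n \<in> borel_measurable M" using elim by auto
    have "measure M {\<omega>\<in>space M. Z n \<omega> \<ge> c} \<le> (\<integral>\<omega>. Z n \<omega> \<partial>M) / c"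
      by (rule integral_Markov_inequality_measure[of _ _ "{}"]) (use elim assms(3) in auto)
    also have "\<dots> \<le> a n / c" using elim assms(3) by (intro divide_right_mono) auto
    finally show ?case by auto
  qed
qed

text \<open>In contrast to \<open>conv_in_probD\<close>, no measurability is needed here: \<open>measure\<close> is 0 on sets that are
  not measurable.\<close>

lemma conv_in_probI:
  assumes "\<And>\<epsilon>. \<epsilon> > 0 \<Longrightarrow> whp M (\<lambda>n \<omega>. \<bar>X n \<omega> - c\<bar> \<le> \<epsilon>)"
  shows "conv_in_prob M X c"
  unfolding conv_in_prob_def
proof (intro allI impI)
  fix \<epsilon> :: real assume "\<epsilon> > 0"
  then obtain N where N: "\<And>n. N n \<in> sets M" "\<And>n \<omega>. \<omega> \<in> space M - N n \<Longrightarrow> \<bar>X n \<omega> - c\<bar> \<le> \<epsilon>"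
    "(\<lambda>n. measure M (N n)) \<longlonglongrightarrow> 0"
    using assms[of \<epsilon>] by (auto simp: whp_def)
  show "(\<lambda>n. measure M {\<omega> \<in> space M. \<bar>X n \<omega> - c\<bar> > \<epsilon>}) \<longlonglongrightarrow> 0"
  proof (rule Lim_null_comparison[OF always_eventually[OF allI] N(3)])
    fix n
    have "{\<omega> \<in> space M. \<bar>X n \<omega> - c\<bar> > \<epsilon>} \<subseteq> N n" using N(2)[of _ n] by force
    then show "norm (measure M {\<omega> \<in> space M. \<bar>X n \<omega> - c\<bar> > \<epsilon>}) \<le> measure M (N n)"
      using N(1) by (simp add: finite_measure_mono)
  qed
qed

lemma conv_in_probD:
  assumes "conv_in_prob M X c" "\<epsilon> > 0" "\<forall>\<^sub>F n in sequentially. X n \<in> borel_measurable M"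
  shows "whp M (\<lambda>n \<omega>. \<bar>X n \<omega> - c\<bar> \<le> \<epsilon>)"
proof (rule whp_eventuallyI[of "\<lambda>n. {\<omega> \<in> space M. \<bar>X n \<omega> - c\<bar> > \<epsilon>}"])
  show "(\<lambda>n. measure M {\<omega> \<in> space M. \<bar>X n \<omega> - c\<bar> > \<epsilon>}) \<longlonglongrightarrow> 0"
    using assms(1,2) by (simp add: conv_in_prob_def)
  show "\<forall>\<^sub>F n in sequentially. {\<omega> \<in> space M. \<bar>X n \<omega> - c\<bar> > \<epsilon>} \<in> sets M \<and>
      (\<forall>\<omega>\<in>space M - {\<omega> \<in> space M. \<bar>X n \<omega> - c\<bar> > \<epsilon>}. \<bar>X n \<omega> - c\<bar> \<le> \<epsilon>) \<and>
      measure M {\<omega> \<in> space M. \<bar>X n \<omega> - c\<bar> > \<epsilon>} \<le> measure M {\<omega> \<in> space M. \<bar>X n \<omega> - c\<bar> > \<epsilon>}"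
    using assms(3)
  proof eventually_elim
    case (elim n)
    then have [measurable]: "X n \<in> borel_measurable M" .
    show ?case by auto
  qed
qed

text \<open>An event of probability tending to 1 meets every event whose probability stays away from 0.\<close>

lemma whp_meets:
  assumes "whp M P" "\<delta> > 0" "\<forall>\<^sub>F n in sequentially. U n \<in> sets M \<and> \<delta> \<le> measure M (U n)"
  shows "\<forall>\<^sub>F n in sequentially. \<exists>\<omega>\<in>U n. P n \<omega>"
proof -
  obtain N where N: "\<And>n. N n \<in> sets M" "\<And>n \<omega>. \<omega> \<in> space M - N n \<Longrightarrow> P n \<omega>" "(\<lambda>n. measure M (N n)) \<longlonglongrightarrow> 0"
    using assms(1) by (auto simp: whp_def)
  have "\<forall>\<^sub>F n in sequentially. measure M (N n) < \<delta>" using N(3) assms(2) by (rule order_tendstoD(2))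
  then show ?thesis using assms(3)
  proof eventually_elim
    case (elim n)
    have "\<not> U n \<subseteq> N n" using finite_measure_mono[OF _ N(1), of "U n" n] elim by auto
    then obtain \<omega> where "\<omega> \<in> U n" "\<omega> \<notin> N n" by auto
    moreover have "\<omega> \<in> space M" using sets.sets_into_space[of "U n"] elim \<open>\<omega> \<in> U n\<close> by auto
    ultimately show ?case using N(2)[of \<omega> n] by auto
  qed
qed

lemma whp_of_prob_tendsto_1:
  assumes "(\<lambda>n. measure M {\<omega> \<in> space M. P n \<omega>}) \<longlonglongrightarrow> 1"
  shows "whp M P"
proof (rule whp_eventuallyI[of "\<lambda>n. space M - {\<omega> \<in> space M. P n \<omega>}"])
  show "(\<lambda>n. 1 - measure M {\<omega> \<in> space M. P n \<omega>}) \<longlonglongrightarrow> 0"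
    using tendsto_diff[OF tendsto_const assms, of 1] by simp
  have "\<forall>\<^sub>F n in sequentially. 0 < measure M {\<omega> \<in> space M. P n \<omega>}"
    using assms by (rule order_tendstoD(1)) simp
  then show "\<forall>\<^sub>F n in sequentially. space M - {\<omega> \<in> space M. P n \<omega>} \<in> sets M \<and>
      (\<forall>\<omega>\<in>space M - (space M - {\<omega> \<in> space M. P n \<omega>}). P n \<omega>) \<and>
      measure M (space M - {\<omega> \<in> space M. P n \<omega>}) \<le> 1 - measure M {\<omega> \<in> space M. P n \<omega>}"
  proof eventually_elim
    case (elim n)
    then have "{\<omega> \<in> space M. P n \<omega>} \<in> sets M" using measure_notin_sets by fastforce
    then show ?case using prob_compl by auto
  qed
qed

end

context iid_model
begin

lemma error_vec_carrier: "error_vec e n \<omega> \<in> carrier_vec n"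
  by (simp add: error_vec_def)

lemma form_quad:
  assumes "Q \<in> carrier_mat n n"
  shows "error_vec e n \<omega> \<bullet> (Q *\<^sub>v error_vec e n \<omega>) = quad n (\<lambda>i j. Q $$ (i, j)) \<omega>"
  using assms by (subst scalar_prod_mult_mat_vec[of _ n]) (auto simp: quad_def error_vec_def)

lemma orth_proj_quad:
  assumes Q: "orth_proj n Q" and tr: "(\<Sum>i<n. Q $$ (i, i)) = q"
  defines "F \<equiv> \<lambda>\<omega>. error_vec e n \<omega> \<bullet> (Q *\<^sub>v error_vec e n \<omega>)"
  shows "integrable \<Omega> F" "(\<integral>\<omega>. F \<omega> \<partial>\<Omega>) = \<sigma>\<^sup>2 * q" "0 \<le> F \<omega>"
    "t > 0 \<Longrightarrow> prob {\<omega> \<in> space \<Omega>. \<bar>F \<omega> - \<sigma>\<^sup>2 * q\<bar> \<ge> t} \<le> var_const * q / t\<^sup>2"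
proof -
  have Qc: "Q \<in> carrier_mat n n" "Q\<^sup>T = Q" using Q by (auto simp: orth_proj_def)
  have F: "F = quad n (\<lambda>i j. Q $$ (i, j))" unfolding F_def form_quad[OF Qc(1)] ..
  show "integrable \<Omega> F" "(\<integral>\<omega>. F \<omega> \<partial>\<Omega>) = \<sigma>\<^sup>2 * q" unfolding F using quad_expectation tr by auto
  show "0 \<le> F \<omega>" unfolding F_def by (rule orth_proj_form(2)[OF Q error_vec_carrier])
  have sym: "Q $$ (i, j) = Q $$ (j, i)" if "i < n" "j < n" for i j
    using Qc that by (metis carrier_matD index_transpose_mat(1))
  show "prob {\<omega> \<in> space \<Omega>. \<bar>F \<omega> - \<sigma>\<^sup>2 * q\<bar> \<ge> t} \<le> var_const * q / t\<^sup>2" if "t > 0"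
    using quad_Chebyshev[of n "\<lambda>i j. Q $$ (i, j)", OF sym that] orth_proj_Frobenius[OF Q] tr unfolding F by simp
qed

end

section \<open>The loss of the selected weights as a random quantity\<close>

text \<open>The assumptions of the theorem on the model, with the constant \<open>\<kappa>\<close> of the eigenvalue condition.\<close>

locale model = iid_model \<Omega> e \<sigma> for \<Omega> :: "'a measure" and e :: "nat \<Rightarrow> 'a \<Rightarrow> real" and \<sigma> :: real +
  fixes x :: "nat \<Rightarrow> nat \<Rightarrow> real" and \<beta> :: "nat \<Rightarrow> nat \<Rightarrow> real" and k :: "nat \<Rightarrow> nat \<Rightarrow> nat"
    and M M0 :: "nat \<Rightarrow> nat" and \<phi> :: "nat \<Rightarrow> real" and w_hat :: "nat \<Rightarrow> 'a \<Rightarrow> nat \<Rightarrow> real"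
    and n0 :: nat and \<kappa> :: real
  assumes candidates: "\<And>n. n \<ge> n0 \<Longrightarrow> nested_candidates x n (k n) (M n)"
    and truth: "\<And>n. n \<ge> n0 \<Longrightarrow> true_model (\<beta> n) (k n) (M n) (M0 n)"
    and argmin: "\<And>n. n \<ge> n0 \<Longrightarrow> selected_weights \<Omega> x n (k n) (M n) (\<phi> n) (response x \<beta> e n) (w_hat n)"
    and kappa_pos: "\<kappa> > 0"
    and kappa: "\<And>n. n \<ge> n0 \<Longrightarrow> \<kappa> \<le> lambda_min (gram x n (k n (M0 n + 1)))"
begin

text \<open>\<open>T\<close> is the index of the true model, \<open>kT\<close> and \<open>k1\<close> are the sizes of the true and the smallest model,
  \<open>mu\<close>, \<open>eps\<close>, \<open>sig\<close> and \<open>s2\<close> are the mean vector, the error vector, the signal and the variance estimate. \<open>A\<close>,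
  \<open>B\<close> and \<open>E\<close> instantiate the parameters of the locale \<^locale>\<open>canonical\<close>, and \<open>F n m\<close> is
  \<open>e\<^sup>T (P\<^sub>m - P\<^sub>T) e\<close>.\<close>

definition T where "T n = M0 n + 1"
definition mu where "mu n = mean_vec x n (\<beta> n)"
definition eps where "eps n \<omega> = error_vec e n \<omega>"
definition A where "A n = iform x n (k n) (mu n) (mu n)"
definition B where "B n \<omega> = iform x n (k n) (mu n) (eps n \<omega>)"
definition E where "E n \<omega> = iform x n (k n) (eps n \<omega>) (eps n \<omega>)"
definition sig where "sig n = signal (\<beta> n) (k n) (M0 n)"
definition s2 where "s2 n \<omega> = sigma_hat_sq x n (k n) (M n) (response x \<beta> e n \<omega>)"
definition kT where "kT n = real (k n (T n))"
definition k1 where "k1 n = real (k n 1)"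

abbreviation "loss n \<omega> \<equiv> canonical.loss (M n) (A n) (B n \<omega>) (E n \<omega>)"
abbreviation "crit n \<omega> \<equiv> canonical.crit (M n) (A n) (B n \<omega>) (E n \<omega>)"
abbreviation "V n \<omega> \<equiv> canonical.V (T n) (E n \<omega>)"
abbreviation "S n \<omega> \<equiv> canonical.S (T n) (E n \<omega>)"
abbreviation "W n \<omega> \<equiv> canonical.W (T n) (A n) (B n \<omega>)"
abbreviation "Y n \<omega> \<equiv> canonical.Y (A n) (B n \<omega>) (E n \<omega>)"
abbreviation "r2 n \<omega> \<equiv> canonical.r2 (M n) (T n) (A n) (B n \<omega>) (E n \<omega>)"
abbreviation "F n m \<omega> \<equiv> \<Sum>j=Suc (T n)..m. E n \<omega> j"
abbreviation "over n \<omega> \<equiv> canonical.over (M n) (T n) (E n \<omega>)"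

text \<open>The ratio whose convergence to 1 is loss optimality. It is 0, hence far from 1, where the infimum
  vanishes.\<close>

definition ratio where "ratio n \<omega> = loss n \<omega> (w_hat n \<omega>) / (INF v\<in>weights (M n). loss n \<omega> v)"

lemma mu_carrier [simp]: "mu n \<in> carrier_vec n"
  by (simp add: mu_def mean_vec_def)

lemma eps_carrier [simp]: "eps n \<omega> \<in> carrier_vec n"
  by (simp add: eps_def error_vec_def)

context
  fixes n assumes n: "n \<ge> n0"
begin

lemmas nc = candidates[OF n]

lemma T_bounds: "2 \<le> T n" "T n < M n" "1 \<le> M0 n" "M0 n < T n" "1 \<le> M n"
  using truth[OF n] by (auto simp: true_model_def T_def)

lemma n_pos: "n > 0"
  using nc by (auto simp: nested_candidates_def)

lemma k_bounds: "0 < k n 1" "k n 1 < k n (T n)" "k n (M0 n) < k n (T n)" "k n (T n) < n"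
  "m \<in> {1..M n} \<Longrightarrow> k n m < n"
proof -
  show "0 < k n 1" using nc by (auto simp: nested_candidates_def)
  show "k n 1 < k n (T n)" "k n (M0 n) < k n (T n)" using T_bounds by (auto intro!: K_less[OF nc])
  show *: "k n m < n" if "m \<in> {1..M n}" for m
  proof -
    have "k n m \<le> k n (M n)" using that by (auto intro!: K_le[OF nc])
    then show ?thesis using nc by (auto simp: nested_candidates_def)
  qed
  show "k n (T n) < n" using T_bounds by (intro *) auto
qed

lemma kT_pos: "0 < kT n" "0 < kT n - k1 n"
  using k_bounds by (auto simp: kT_def k1_def)

lemma cov_index_diff: "cov_index (k n) (M0 n + 1) \<inter> - cov_index (k n) (M0 n) = {k n (M0 n)<..k n (T n)}"
  by (auto simp: cov_index_def T_def)

lemma sig_sum: "sig n = (\<Sum>j\<in>{k n (M0 n)<..k n (T n)}. (\<beta> n j)\<^sup>2)"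
  unfolding sig_def signal_def cov_index_diff ..

lemma sig_pos: "0 < sig n"
proof -
  obtain j where "j \<in> {k n (M0 n)<..k n (T n)}" "\<beta> n j \<noteq> 0"
    using truth[OF n] unfolding true_model_def cov_index_diff by blast
  then show ?thesis unfolding sig_sum by (intro sum_pos2[of _ j]) auto
qed

lemma design_rank: "m \<in> {1..M n} \<Longrightarrow> full_col_rank (design x n (k n m))"
  using nc by (auto simp: nested_candidates_def)

lemma signal_bound:
  "real n * \<kappa> * sig n \<le> A n (T n)" "proj x n (k n) (T n) *\<^sub>v mu n = mu n"
proof -
  have T: "T n \<in> {1..M n}" "M0 n \<in> {1..M n}" using T_bounds by auto
  have b: "\<forall>j>k n (T n). \<beta> n j = 0" using truth[OF n] by (auto simp: true_model_def T_def)
  have kap: "\<kappa> \<le> lambda_min (gram x n (k n (T n)))" "0 \<le> \<kappa>" using kappa[OF n] kappa_pos by (auto simp: T_def)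
  have le: "k n (M0 n) \<le> k n (T n)" using k_bounds by simp
  note * = omitted_signal_bound[OF le n_pos design_rank[OF T(2)] design_rank[OF T(1)] b kap]
  show "proj x n (k n) (T n) *\<^sub>v mu n = mu n" unfolding proj_def mu_def using *(2) .
  have "incr x n (k n) (T n) = proj x n (k n) (T n) - proj x n (k n) (M0 n)"
    using T_bounds by (simp add: incr_def T_def)
  then show "real n * \<kappa> * sig n \<le> A n (T n)"
    unfolding A_def iform_def mu_def sig_sum proj_def using *(1) by simp
qed

lemma proj_mu: "T n \<le> m \<Longrightarrow> m \<le> M n \<Longrightarrow> proj x n (k n) m *\<^sub>v mu n = mu n"
proof -
  assume m: "T n \<le> m" "m \<le> M n"
  then have I: "m \<in> {1..M n}" "T n \<in> {1..M n}" using T_bounds by auto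
  have "proj x n (k n) m *\<^sub>v (proj x n (k n) (T n) *\<^sub>v mu n) = proj x n (k n) (T n) *\<^sub>v mu n"
    using assoc_mult_mat_vec[OF proj_carrier[OF nc I(1)] proj_carrier[OF nc I(2)] mu_carrier]
      proj_mult[OF nc I(2,1)] m by (simp add: min_absorb2)
  then show ?thesis using signal_bound(2) by simp
qed

lemma A_zero: "T n < j \<Longrightarrow> j \<le> M n \<Longrightarrow> A n j = 0"
proof -
  assume j: "T n < j" "j \<le> M n"
  then have I: "j \<in> {1..M n}" "j - 1 \<in> {1..M n}" using T_bounds by auto
  have "A n j = mu n \<bullet> ((proj x n (k n) j - proj x n (k n) (j - 1)) *\<^sub>v mu n)"
    using j T_bounds by (simp add: A_def iform_def incr_def)
  also have "\<dots> = mu n \<bullet> (proj x n (k n) j *\<^sub>v mu n) - mu n \<bullet> (proj x n (k n) (j - 1) *\<^sub>v mu n)"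
    by (rule diff_form[OF proj_carrier[OF nc I(1)] proj_carrier[OF nc I(2)] mu_carrier mu_carrier])
  also have "\<dots> = 0" using proj_mu[of j] proj_mu[of "j - 1"] j by simp
  finally show ?thesis .
qed

lemma canonical: "canonical (M n) (T n) (A n) (B n \<omega>) (E n \<omega>)"
proof
  fix j assume "1 \<le> j" "j \<le> M n"
  then have j: "j \<in> {1..M n}" by simp
  show "0 \<le> A n j" "0 \<le> E n \<omega> j" "(B n \<omega> j)\<^sup>2 \<le> A n j * E n \<omega> j"
    unfolding A_def B_def E_def by (intro iform_nonneg[OF nc j] iform_Cauchy_Schwarz[OF nc j]; simp)+
qed (use T_bounds A_zero in auto)

lemma response_carrier: "response x \<beta> e n \<omega> = mu n + eps n \<omega>" "response x \<beta> e n \<omega> \<in> carrier_vec n"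
  by (auto simp: response_def mu_def eps_def mean_vec_def error_vec_def)

lemma sum_A: "(\<Sum>j=1..M n. A n j) = mu n \<bullet> mu n"
  unfolding A_def using sum_iform[OF nc mu_carrier mu_carrier, of "M n"] T_bounds proj_mu[of "M n"] by simp

lemma loss_eq: "avg_loss x n (k n) (M n) (mean_vec x n (\<beta> n)) (response x \<beta> e n \<omega>) w = loss n \<omega> w"
proof -
  interpret C: canonical "M n" "T n" "A n" "B n \<omega>" "E n \<omega>" by (rule canonical)
  have I: "iform x n (k n) (mu n) (mu n + eps n \<omega>) j = A n j + B n \<omega> j"
    "iform x n (k n) (mu n + eps n \<omega>) (mu n + eps n \<omega>) j = A n j + 2 * B n \<omega> j + E n \<omega> j"
    if "j \<in> {1..M n}" for j
    using iform_add[OF nc that mu_carrier eps_carrier] by (auto simp: A_def B_def E_def)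
  have "avg_loss x n (k n) (M n) (mean_vec x n (\<beta> n)) (response x \<beta> e n \<omega>) w =
      (\<Sum>j=1..M n. A n j) - 2 * (\<Sum>j=1..M n. tail (M n) w j * (A n j + B n \<omega> j)) +
      (\<Sum>j=1..M n. (tail (M n) w j)\<^sup>2 * (A n j + 2 * B n \<omega> j + E n \<omega> j))"
    unfolding avg_loss_def mu_def[symmetric] response_carrier(1)
    using residual_norm[OF nc mu_carrier, of "mu n + eps n \<omega>" w] sum_A I by simp
  also have "\<dots> = loss n \<omega> w"
    unfolding C.loss_def sum_distrib_left sum_subtractf[symmetric] sum.distrib[symmetric]
    by (intro sum.cong refl) (simp add: C.t_def power2_eq_square algebra_simps)
  finally show ?thesis .
qed

lemma crit_eq:
  "\<exists>c. \<forall>w. weight_criterion x n (k n) (M n) \<phi>' (response x \<beta> e n \<omega>) w =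
     c + crit n \<omega> (kinc (k n)) (\<phi>' * s2 n \<omega>) w"
proof -
  interpret C: canonical "M n" "T n" "A n" "B n \<omega>" "E n \<omega>" by (rule canonical)
  let ?y = "mu n + eps n \<omega>"
  have y: "?y \<in> carrier_vec n" by simp
  have I: "iform x n (k n) ?y ?y j = C.Y j" if "j \<in> {1..M n}" for j
    using iform_add[OF nc that mu_carrier eps_carrier] unfolding C.Y_def unfolding A_def B_def E_def by simp
  have "weight_criterion x n (k n) (M n) \<phi>' (response x \<beta> e n \<omega>) w =
      (?y \<bullet> ?y - (\<Sum>j=1..M n. C.Y j)) + crit n \<omega> (kinc (k n)) (\<phi>' * s2 n \<omega>) w" for w
  proof -
    have "(1\<^sub>m n - avg_proj x n (k n) (M n) w) *\<^sub>v ?y = ?y - avg_proj x n (k n) (M n) w *\<^sub>v ?y"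
      using minus_mult_distrib_mat_vec[OF one_carrier_mat avg_proj_carrier y] y by simp
    moreover have "(\<Sum>m=1..M n. w m * real (k n m)) = (\<Sum>j=1..M n. tail (M n) w j * kinc (k n) j)"
    proof -
      have "(\<Sum>m=1..M n. w m * real (k n m)) = (\<Sum>m=1..M n. w m * (\<Sum>j=1..m. kinc (k n) j))"
      proof (intro sum.cong refl)
        fix m assume "m \<in> {1..M n}"
        then show "w m * real (k n m) = w m * (\<Sum>j=1..m. kinc (k n) j)" using sum_kinc[of m "k n"] by simp
      qed
      then show ?thesis using tail_sum[of "M n" w "kinc (k n)" 1] by simp
    qed
    ultimately have "weight_criterion x n (k n) (M n) \<phi>' (response x \<beta> e n \<omega>) w =
        ?y \<bullet> ?y - 2 * (\<Sum>j=1..M n. tail (M n) w j * C.Y j) + (\<Sum>j=1..M n. (tail (M n) w j)\<^sup>2 * C.Y j)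
        + \<phi>' * s2 n \<omega> * (\<Sum>j=1..M n. tail (M n) w j * kinc (k n) j)"
      unfolding weight_criterion_def s2_def[symmetric]
      unfolding response_carrier(1) using residual_norm[OF nc y y, of w] I by simp
    also have "\<dots> = (?y \<bullet> ?y - (\<Sum>j=1..M n. C.Y j)) + crit n \<omega> (kinc (k n)) (\<phi>' * s2 n \<omega>) w"
    proof -
      have "crit n \<omega> (kinc (k n)) (\<phi>' * s2 n \<omega>) w = (\<Sum>j=1..M n. C.Y j) - 2 * (\<Sum>j=1..M n. tail (M n) w j * C.Y j)
          + (\<Sum>j=1..M n. (tail (M n) w j)\<^sup>2 * C.Y j) + \<phi>' * s2 n \<omega> * (\<Sum>j=1..M n. tail (M n) w j * kinc (k n) j)"
        unfolding C.crit_def sum_distrib_left sum_subtractf[symmetric] sum.distrib[symmetric]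
        by (intro sum.cong refl) (simp add: C.t_def power2_eq_square algebra_simps)
      then show ?thesis by simp
    qed
    finally show ?thesis .
  qed
  then show ?thesis by blast
qed

lemma w_hat_props:
  assumes "\<omega> \<in> space \<Omega>"
  shows "w_hat n \<omega> \<in> weights (M n)"
    "v \<in> weights (M n) \<Longrightarrow> crit n \<omega> (kinc (k n)) (\<phi> n * s2 n \<omega>) (w_hat n \<omega>) \<le> crit n \<omega> (kinc (k n)) (\<phi> n * s2 n \<omega>) v"
proof -
  have am: "is_arg_min (weight_criterion x n (k n) (M n) (\<phi> n) (response x \<beta> e n \<omega>)) (\<lambda>v. v \<in> weights (M n)) (w_hat n \<omega>)"
    using argmin[OF n] assms by (auto simp: selected_weights_def)
  then show "w_hat n \<omega> \<in> weights (M n)" by (simp add: is_arg_min_def)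
  obtain c where c: "\<And>w. weight_criterion x n (k n) (M n) (\<phi> n) (response x \<beta> e n \<omega>) w = c + crit n \<omega> (kinc (k n)) (\<phi> n * s2 n \<omega>) w"
    using crit_eq by blast
  show "crit n \<omega> (kinc (k n)) (\<phi> n * s2 n \<omega>) (w_hat n \<omega>) \<le> crit n \<omega> (kinc (k n)) (\<phi> n * s2 n \<omega>) v"
    if "v \<in> weights (M n)"
    using am that unfolding is_arg_min_def c by (auto simp: not_less)
qed

lemma kinc_nonneg: "1 \<le> j \<Longrightarrow> j \<le> M n \<Longrightarrow> 0 \<le> kinc (k n) j"
  by (cases "j = 1") (auto simp: kinc_def intro!: K_le[OF nc])

lemma sum_kinc_between: "1 \<le> l \<Longrightarrow> l \<le> m \<Longrightarrow> (\<Sum>j=Suc l..m. kinc (k n) j) = real (k n m) - real (k n l)"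
  by (simp add: sum_between sum_kinc del: One_nat_def)

lemma V_form: "V n \<omega> = eps n \<omega> \<bullet> (proj x n (k n) (T n) *\<^sub>v eps n \<omega>)"
  unfolding canonical.V_def[OF canonical] unfolding E_def
  using sum_iform[OF nc eps_carrier eps_carrier, of "T n"] T_bounds by simp

lemma S_form: "S n \<omega> = eps n \<omega> \<bullet> ((proj x n (k n) (T n) - proj x n (k n) 1) *\<^sub>v eps n \<omega>)"
  unfolding canonical.S_def[OF canonical] unfolding E_def
  using sum_iform_between[OF nc eps_carrier eps_carrier, of 1 "T n"] T_bounds by (simp add: numeral_2_eq_2)

lemma F_form: "T n \<le> m \<Longrightarrow> m \<le> M n \<Longrightarrow> F n m \<omega> =
    eps n \<omega> \<bullet> ((proj x n (k n) m - proj x n (k n) (T n)) *\<^sub>v eps n \<omega>)"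
  using sum_iform_between[OF nc eps_carrier eps_carrier, of "T n" m] T_bounds
  by (simp add: E_def)

lemma V_moments:
  "integrable \<Omega> (V n)" "(\<integral>\<omega>. V n \<omega> \<partial>\<Omega>) = \<sigma>\<^sup>2 * kT n"
  "t > 0 \<Longrightarrow> prob {\<omega> \<in> space \<Omega>. \<bar>V n \<omega> - \<sigma>\<^sup>2 * kT n\<bar> \<ge> t} \<le> var_const * kT n / t\<^sup>2"
  unfolding V_form eps_def kT_def
  using orth_proj_quad[OF proj_orth[OF nc, of "T n"] proj_trace[OF nc, of "T n"]] T_bounds by auto

lemma S_moments: "integrable \<Omega> (S n)" "(\<integral>\<omega>. S n \<omega> \<partial>\<Omega>) = \<sigma>\<^sup>2 * (kT n - k1 n)"
  unfolding S_form eps_def kT_def k1_def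
  using orth_proj_quad[OF proj_diff_orth[OF nc, of 1 "T n"]] T_bounds by auto

lemma F_moments:
  assumes m: "T n \<le> m" "m \<le> M n"
  shows "integrable \<Omega> (F n m)" "(\<integral>\<omega>. F n m \<omega> \<partial>\<Omega>) = \<sigma>\<^sup>2 * (real (k n m) - kT n)" "0 \<le> F n m \<omega>"
    "t > 0 \<Longrightarrow> prob {\<omega> \<in> space \<Omega>. \<bar>F n m \<omega> - \<sigma>\<^sup>2 * (real (k n m) - kT n)\<bar> \<ge> t} \<le> var_const * (real (k n m) - kT n) / t\<^sup>2"
  unfolding F_form[OF m] eps_def kT_def
  using orth_proj_quad[OF proj_diff_orth[OF nc, of "T n" m]] T_bounds m by auto

lemma B_linear:
  assumes j: "j \<in> {1..M n}"
  obtains a where "\<And>\<omega>. B n \<omega> j = (\<Sum>i<n. a i * e (Suc i) \<omega>)" "(\<Sum>i<n. (a i)\<^sup>2) = A n j"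
proof -
  let ?Q = "incr x n (k n) j"
  have Q: "?Q \<in> carrier_mat n n" "?Q\<^sup>T = ?Q" using incr_orth[OF nc j] by (auto simp: orth_proj_def)
  define a where "a i = (?Q *\<^sub>v mu n) $ i" for i
  have Qm: "?Q *\<^sub>v mu n \<in> carrier_vec n" using Q(1) mu_carrier by (rule mult_mat_vec_carrier)
  have "B n \<omega> j = (\<Sum>i<n. a i * e (Suc i) \<omega>)" for \<omega>
  proof -
    have "B n \<omega> j = eps n \<omega> \<bullet> (?Q *\<^sub>v mu n)"
      unfolding B_def iform_def by (rule symmetric_form_swap[OF Q mu_carrier eps_carrier])
    also have "\<dots> = (\<Sum>i<n. a i * e (Suc i) \<omega>)"
      using Q(1) by (simp add: scalar_prod_def a_def eps_def error_vec_def atLeast0LessThan mult.commute)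
    finally show ?thesis .
  qed
  moreover have "(\<Sum>i<n. (a i)\<^sup>2) = A n j"
    unfolding A_def iform_def orth_proj_form(1)[OF incr_orth[OF nc j] mu_carrier]
  proof -
    have "(\<Sum>i<n. (v $ i)\<^sup>2) = v \<bullet> v" if "v \<in> carrier_vec n" for v :: "real vec"
      using that by (simp add: scalar_prod_def atLeast0LessThan power2_eq_square)
    from this[OF Qm] show "(\<Sum>i<n. (a i)\<^sup>2) = (?Q *\<^sub>v mu n) \<bullet> (?Q *\<^sub>v mu n)" unfolding a_def .
  qed
  ultimately show thesis using that by blast
qed

lemma B_measurable: "j \<in> {1..M n} \<Longrightarrow> (\<lambda>\<omega>. B n \<omega> j) \<in> borel_measurable \<Omega>"
  by (rule B_linear, assumption) (simp add: borel_measurable_sum)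

lemma E_measurable: "j \<in> {1..M n} \<Longrightarrow> (\<lambda>\<omega>. E n \<omega> j) \<in> borel_measurable \<Omega>"
  unfolding E_def iform_def eps_def
  by (rule borel_measurable_integrable[OF orth_proj_quad(1)[OF incr_orth[OF nc] refl]])

lemma B_second_moment:
  assumes j: "j \<in> {1..M n}"
  shows "integrable \<Omega> (\<lambda>\<omega>. (B n \<omega> j)\<^sup>2)" "(\<integral>\<omega>. (B n \<omega> j)\<^sup>2 \<partial>\<Omega>) = \<sigma>\<^sup>2 * A n j"
proof -
  obtain a where a: "\<And>\<omega>. B n \<omega> j = (\<Sum>i<n. a i * e (Suc i) \<omega>)" "(\<Sum>i<n. (a i)\<^sup>2) = A n j"
    using B_linear[OF j] by blast
  have "(B n \<omega> j)\<^sup>2 = quad n (\<lambda>i j. a i * a j) \<omega>" for \<omega>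
    unfolding a quad_def by (simp add: power2_eq_square sum_product mult_ac)
  then show "integrable \<Omega> (\<lambda>\<omega>. (B n \<omega> j)\<^sup>2)" "(\<integral>\<omega>. (B n \<omega> j)\<^sup>2 \<partial>\<Omega>) = \<sigma>\<^sup>2 * A n j"
    using quad_expectation[of n "\<lambda>i j. a i * a j"] a(2) by (auto simp: power2_eq_square)
qed

lemma W_moments:
  "integrable \<Omega> (W n)" "(\<integral>\<omega>. W n \<omega> \<partial>\<Omega>) \<le> \<sigma>\<^sup>2 * real (M0 n)" "0 \<le> W n \<omega>"
proof -
  have W: "W n \<omega> = (\<Sum>j=2..T n. (B n \<omega> j)\<^sup>2 / A n j)" for \<omega> by (rule canonical.W_def[OF canonical])
  have j: "j \<in> {1..M n}" if "j \<in> {2..T n}" for j using that T_bounds by auto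
  show "integrable \<Omega> (W n)"
    unfolding W using B_second_moment(1)[OF j] by (intro Bochner_Integration.integrable_sum integrable_divide) auto
  have "(\<integral>\<omega>. W n \<omega> \<partial>\<Omega>) = (\<Sum>j=2..T n. (\<integral>\<omega>. (B n \<omega> j)\<^sup>2 / A n j \<partial>\<Omega>))"
    unfolding W using B_second_moment(1)[OF j] by (intro Bochner_Integration.integral_sum integrable_divide) auto
  also have "\<dots> \<le> (\<Sum>j=2..T n. \<sigma>\<^sup>2)"
    using B_second_moment(2)[OF j] by (intro sum_mono) (auto simp: divide_simps)
  finally show "(\<integral>\<omega>. W n \<omega> \<partial>\<Omega>) \<le> \<sigma>\<^sup>2 * real (M0 n)" using T_bounds by (simp add: T_def mult.commute)
  show "0 \<le> W n \<omega>" unfolding W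
    using canonical.A_nonneg[OF canonical] T_bounds by (intro sum_nonneg divide_nonneg_nonneg) auto
qed

lemma loss_measurable:
  assumes "\<And>m. m \<in> {1..M n} \<Longrightarrow> (\<lambda>\<omega>. v \<omega> m) \<in> borel_measurable \<Omega>"
  shows "(\<lambda>\<omega>. loss n \<omega> (v \<omega>)) \<in> borel_measurable \<Omega>"
proof -
  have tl: "(\<lambda>\<omega>. tail (M n) (v \<omega>) j) \<in> borel_measurable \<Omega>" if "j \<in> {1..M n}" for j
    unfolding tail_def using assms that by (intro borel_measurable_sum) auto
  show ?thesis
    unfolding canonical.loss_def[OF canonical] canonical.t_def[OF canonical]
    using tl B_measurable E_measurable
    by (intro borel_measurable_sum borel_measurable_add borel_measurable_diff borel_measurable_times
        borel_measurable_power borel_measurable_const) auto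
qed

text \<open>The infimum may be taken over a countable dense set of weights. Measurability of the ratio matters
  only for refuting optimality: on sets that are not measurable the probability would be 0.\<close>

lemma inf_loss_measurable: "(\<lambda>\<omega>. INF v\<in>weights (M n). loss n \<omega> v) \<in> borel_measurable \<Omega>"
proof -
  obtain D where D: "countable D" "D \<subseteq> weights (M n)"
    "\<And>w. w \<in> weights (M n) \<Longrightarrow> \<exists>v. (\<forall>N. v N \<in> D) \<and> (\<forall>j\<in>{1..M n}. (\<lambda>N. tail (M n) (v N) j) \<longlonglongrightarrow> tail (M n) w j)"
    using countable_dense_weights[OF T_bounds(5)] by blast
  have "(INF v\<in>weights (M n). loss n \<omega> v) = (INF v\<in>D. loss n \<omega> v)" for \<omega>
  proof -
    interpret C: canonical "M n" "T n" "A n" "B n \<omega>" "E n \<omega>" by (rule canonical)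
    obtain w0 where w0: "w0 \<in> weights (M n)" using C.loss_true_model by blast
    have ne: "D \<noteq> {}" using D(3)[OF w0] by blast
    show ?thesis
    proof (rule antisym)
      show "(INF v\<in>weights (M n). loss n \<omega> v) \<le> (INF v\<in>D. loss n \<omega> v)"
        by (rule cINF_superset_mono[OF ne C.loss_bdd_below D(2)]) simp
      show "(INF v\<in>D. loss n \<omega> v) \<le> (INF v\<in>weights (M n). loss n \<omega> v)"
      proof (rule cINF_greatest)
        show "weights (M n) \<noteq> {}" using w0 by blast
        fix w assume "w \<in> weights (M n)"
        then obtain v where v: "\<And>N. v N \<in> D" "\<And>j. j \<in> {1..M n} \<Longrightarrow> (\<lambda>N. tail (M n) (v N) j) \<longlonglongrightarrow> tail (M n) w j"
          using D(3) by blast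
        have "(\<lambda>N. loss n \<omega> (v N)) \<longlonglongrightarrow> loss n \<omega> w"
          unfolding C.loss_def C.t_def by (intro tendsto_intros v(2))
        then show "(INF v\<in>D. loss n \<omega> v) \<le> loss n \<omega> w"
          by (rule LIMSEQ_le_const) (auto intro!: cINF_lower C.loss_bdd_below v(1))
      qed
    qed
  qed
  moreover have "(\<lambda>\<omega>. INF v\<in>D. loss n \<omega> v) \<in> borel_measurable \<Omega>"
    by (intro borel_measurable_cINF_real D(1) loss_measurable) simp
  ultimately show ?thesis by simp
qed

lemma ratio_measurable: "ratio n \<in> borel_measurable \<Omega>"
  unfolding ratio_def using argmin[OF n]
  by (intro borel_measurable_divide loss_measurable inf_loss_measurable) (auto simp: selected_weights_def)

end

end

context model
begin

section \<open>Bounds that hold with probability tending to one\<close>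

lemma asymp_loss_optimal_iff: "asymp_loss_optimal \<Omega> x \<beta> e k M w_hat \<longleftrightarrow> conv_in_prob \<Omega> ratio 1"
proof -
  have eq: "(let L = avg_loss x n (k n) (M n) (mean_vec x n (\<beta> n)) (response x \<beta> e n \<omega>)
      in L (w_hat n \<omega>) / (INF v\<in>weights (M n). L v)) = ratio n \<omega>" if "n \<ge> n0" for n \<omega>
    unfolding Let_def loss_eq[OF that] ratio_def ..
  show ?thesis
    unfolding asymp_loss_optimal_def conv_in_prob_def
    by (intro all_cong1 imp_cong refl tendsto_cong) (auto simp: eventually_sequentially eq intro!: exI[of _ n0])
qed

lemma S_small:
  assumes "(\<lambda>n. (kT n - k1 n) / (real n * sig n)) \<longlonglongrightarrow> 0" "c > 0"
  shows "whp \<Omega> (\<lambda>n \<omega>. S n \<omega> \<le> c * (real n * sig n))"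
proof -
  have "whp \<Omega> (\<lambda>n \<omega>. S n \<omega> / (real n * sig n) \<le> c)"
  proof (rule whp_Markov[OF _ _ assms(2)])
    show "(\<lambda>n. \<sigma>\<^sup>2 * ((kT n - k1 n) / (real n * sig n))) \<longlonglongrightarrow> 0"
      using tendsto_mult_right_zero[OF assms(1)] .
    show "\<forall>\<^sub>F n in sequentially. integrable \<Omega> (\<lambda>\<omega>. S n \<omega> / (real n * sig n)) \<and>
        (\<forall>\<omega>\<in>space \<Omega>. 0 \<le> S n \<omega> / (real n * sig n)) \<and>
        (\<integral>\<omega>. S n \<omega> / (real n * sig n) \<partial>\<Omega>) \<le> \<sigma>\<^sup>2 * ((kT n - k1 n) / (real n * sig n))"
      using eventually_ge_at_top[of n0]
    proof eventually_elim
      case (elim n)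
      then show ?case
        using S_moments[OF elim] canonical.S_nonneg[OF canonical[OF elim]] sig_pos[OF elim] by simp
    qed
  qed
  then show ?thesis
    by (rule whp_mono[of _ n0]) (use sig_pos n_pos in \<open>auto simp: pos_divide_le_eq\<close>)
qed

text \<open>If \<open>S\<close> is small relative to the signal, the noise in the increment \<open>T\<close> is dominated by its mean.\<close>

lemma Y_lower:
  assumes n: "n \<ge> n0" and S: "S n \<omega> \<le> \<kappa> / 8 * (real n * sig n)"
  shows "0 < A n (T n)" "8 * E n \<omega> (T n) \<le> A n (T n)" "A n (T n) \<le> 4 * Y n \<omega> (T n)"
    "real n * \<kappa> * sig n \<le> 4 * Y n \<omega> (T n)" "0 < Y n \<omega> (T n)"
proof -
  interpret C: canonical "M n" "T n" "A n" "B n \<omega>" "E n \<omega>" by (rule canonical[OF n])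
  have p: "0 < real n * \<kappa> * sig n" using sig_pos[OF n] n_pos[OF n] kappa_pos by simp
  then show A: "0 < A n (T n)" using signal_bound(1)[OF n] by simp
  show E: "8 * E n \<omega> (T n) \<le> A n (T n)" using C.E_T_le_S S signal_bound(1)[OF n] by (simp add: algebra_simps)
  then have "4 * E n \<omega> (T n) \<le> A n (T n)" using A by simp
  then show Y: "A n (T n) \<le> 4 * Y n \<omega> (T n)" by (rule C.Y_T_lower)
  then show "real n * \<kappa> * sig n \<le> 4 * Y n \<omega> (T n)" "0 < Y n \<omega> (T n)" using signal_bound(1)[OF n] A by simp_all
qed

lemma r2_bound:
  assumes n: "n \<ge> n0" and \<omega>: "\<omega> \<in> space \<Omega>" and S: "S n \<omega> \<le> \<kappa> / 8 * (real n * sig n)"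
    and phi: "0 \<le> \<phi> n" and s2: "0 \<le> s2 n \<omega>" "s2 n \<omega> \<le> s"
  shows "0 \<le> r2 n \<omega> (w_hat n \<omega>)"
    "r2 n \<omega> (w_hat n \<omega>) \<le> 4 * s\<^sup>2 / \<kappa> * ((\<phi> n)\<^sup>2 * (kT n - k1 n) / (real n * sig n)) * (kT n - k1 n)"
proof -
  interpret C: canonical "M n" "T n" "A n" "B n \<omega>" "E n \<omega>" by (rule canonical[OF n])
  note Y = Y_lower[OF n S]
  have psi: "0 \<le> \<phi> n * s2 n \<omega>" using phi s2 by simp
  have d: "(\<Sum>j=2..T n. kinc (k n) j) = kT n - k1 n"
    using sum_kinc_between[OF n, of 1 "T n"] T_bounds[OF n] by (simp add: numeral_2_eq_2 kT_def k1_def)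
  note r = C.minimiser_underfit[where d = "kinc (k n)", OF kinc_nonneg[OF n] psi w_hat_props[OF n \<omega>] Y(5), unfolded d]
  show "0 \<le> r2 n \<omega> (w_hat n \<omega>)" using r(2) .
  have p: "0 < real n * \<kappa> * sig n" "0 < real n" using sig_pos[OF n] n_pos[OF n] kappa_pos by simp_all
  have "r2 n \<omega> (w_hat n \<omega>) \<le> (\<phi> n * s2 n \<omega>)\<^sup>2 * (kT n - k1 n)\<^sup>2 / Y n \<omega> (T n)" using r(1) .
  also have "\<dots> \<le> (\<phi> n * s)\<^sup>2 * (kT n - k1 n)\<^sup>2 / (real n * \<kappa> * sig n / 4)"
    using Y(4) p s2 phi by (intro frac_le mult_right_mono power_mono mult_left_mono) auto
  also have "\<dots> = 4 * s\<^sup>2 / \<kappa> * ((\<phi> n)\<^sup>2 * (kT n - k1 n) / (real n * sig n)) * (kT n - k1 n)"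
    using p kappa_pos sig_pos[OF n] by (simp add: field_simps power2_eq_square)
  finally show "r2 n \<omega> (w_hat n \<omega>) \<le> 4 * s\<^sup>2 / \<kappa> * ((\<phi> n)\<^sup>2 * (kT n - k1 n) / (real n * sig n)) * (kT n - k1 n)" .
qed

lemma V_large:
  assumes "filterlim kT at_top sequentially"
  shows "whp \<Omega> (\<lambda>n \<omega>. \<sigma>\<^sup>2 / 2 * kT n \<le> V n \<omega>)"
proof -
  let ?N = "\<lambda>n. {\<omega> \<in> space \<Omega>. \<bar>V n \<omega> - \<sigma>\<^sup>2 * kT n\<bar> \<ge> \<sigma>\<^sup>2 / 2 * kT n}"
  have "(\<lambda>n. 4 * var_const / (\<sigma>\<^sup>2)\<^sup>2 * inverse (kT n)) \<longlonglongrightarrow> 0"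
    using tendsto_mult_right_zero[OF tendsto_inverse_0_at_top[OF assms]] .
  moreover have "\<forall>\<^sub>F n in sequentially. ?N n \<in> sets \<Omega> \<and>
      (\<forall>\<omega>\<in>space \<Omega> - ?N n. \<sigma>\<^sup>2 / 2 * kT n \<le> V n \<omega>) \<and> prob (?N n) \<le> 4 * var_const / (\<sigma>\<^sup>2)\<^sup>2 * inverse (kT n)"
    using eventually_ge_at_top[of n0]
  proof eventually_elim
    case (elim n)
    note [measurable] = borel_measurable_integrable[OF V_moments(1)[OF elim]]
    have p: "0 < \<sigma>\<^sup>2 / 2 * kT n" using kT_pos[OF elim] sigma_pos by simp
    have meas: "?N n \<in> sets \<Omega>" by measurable
    have "prob (?N n) \<le> var_const * kT n / (\<sigma>\<^sup>2 / 2 * kT n)\<^sup>2" by (rule V_moments(3)[OF elim p])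
    also have "\<dots> = 4 * var_const / (\<sigma>\<^sup>2)\<^sup>2 * inverse (kT n)"
      using kT_pos[OF elim] sigma_pos by (simp add: field_simps power2_eq_square)
    finally have "prob (?N n) \<le> 4 * var_const / (\<sigma>\<^sup>2)\<^sup>2 * inverse (kT n)" .
    moreover have "\<sigma>\<^sup>2 / 2 * kT n \<le> V n \<omega>" if "\<not> \<bar>V n \<omega> - \<sigma>\<^sup>2 * kT n\<bar> \<ge> \<sigma>\<^sup>2 / 2 * kT n" for \<omega>
      using that by linarith
    ultimately show ?case using meas by blast
  qed
  ultimately show ?thesis by (intro whp_eventuallyI)
qed

lemma W_small:
  assumes "(\<lambda>n. real (M0 n) / kT n) \<longlonglongrightarrow> 0" "c > 0"
  shows "whp \<Omega> (\<lambda>n \<omega>. W n \<omega> \<le> c * kT n)"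
proof -
  have "whp \<Omega> (\<lambda>n \<omega>. W n \<omega> / kT n \<le> c)"
  proof (rule whp_Markov[OF _ tendsto_mult_right_zero[OF assms(1), of "\<sigma>\<^sup>2"] assms(2)])
    show "\<forall>\<^sub>F n in sequentially. integrable \<Omega> (\<lambda>\<omega>. W n \<omega> / kT n) \<and> (\<forall>\<omega>\<in>space \<Omega>. 0 \<le> W n \<omega> / kT n) \<and>
        (\<integral>\<omega>. W n \<omega> / kT n \<partial>\<Omega>) \<le> \<sigma>\<^sup>2 * (real (M0 n) / kT n)"
      using eventually_ge_at_top[of n0]
    proof eventually_elim
      case (elim n)
      then show ?case using W_moments[OF elim] kT_pos[OF elim] by (simp add: divide_right_mono)
    qed
  qed
  then show ?thesis
    by (rule whp_mono[of _ n0]) (use kT_pos in \<open>auto simp: pos_divide_le_eq\<close>)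
qed

lemma over_small:
  assumes "(\<lambda>n. real (k n (M n)) / kT n) \<longlonglongrightarrow> 1" "c > 0"
  shows "whp \<Omega> (\<lambda>n \<omega>. over n \<omega> (w_hat n \<omega>) \<le> c * kT n)"
proof -
  have lim: "(\<lambda>n. \<sigma>\<^sup>2 * (real (k n (M n)) / kT n - 1)) \<longlonglongrightarrow> 0"
    using tendsto_mult_right_zero[of "\<lambda>n. real (k n (M n)) / kT n - 1"] assms(1) by (simp add: LIM_zero)
  have "whp \<Omega> (\<lambda>n \<omega>. F n (M n) \<omega> / kT n \<le> c)"
  proof (rule whp_Markov[OF _ lim assms(2)])
    show "\<forall>\<^sub>F n in sequentially. integrable \<Omega> (\<lambda>\<omega>. F n (M n) \<omega> / kT n) \<and> (\<forall>\<omega>\<in>space \<Omega>. 0 \<le> F n (M n) \<omega> / kT n) \<and>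
        (\<integral>\<omega>. F n (M n) \<omega> / kT n \<partial>\<Omega>) \<le> \<sigma>\<^sup>2 * (real (k n (M n)) / kT n - 1)"
      using eventually_ge_at_top[of n0]
    proof eventually_elim
      case (elim n)
      have "T n \<le> M n" using T_bounds[OF elim] by simp
      from F_moments(1-3)[OF elim this order_refl] show ?case using kT_pos[OF elim] by (simp add: field_simps)
    qed
  qed
  then show ?thesis
  proof (rule whp_mono[of _ n0])
    fix n \<omega> assume n: "n \<ge> n0" and \<omega>: "\<omega> \<in> space \<Omega>" "F n (M n) \<omega> / kT n \<le> c"
    have "over n \<omega> (w_hat n \<omega>) \<le> F n (M n) \<omega>"
      by (rule canonical.over_le[OF canonical[OF n] w_hat_props(1)[OF n \<omega>(1)]])
    also have "\<dots> \<le> c * kT n" using \<omega>(2) kT_pos[OF n] by (simp add: pos_divide_le_eq)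
    finally show "over n \<omega> (w_hat n \<omega>) \<le> c * kT n" .
  qed
qed

text \<open>Chebyshev's inequality on dyadic blocks. The sums \<open>F n m\<close> increase with \<open>m\<close>, so among all \<open>m\<close> with \<open>2 ^ i \<le>
  k n m - kT n < 2 ^ (i + 1)\<close> it suffices to control the largest index \<open>top i\<close> with \<open>k n m - kT n \<le> 2 ^ (i + 1)\<close>; the
  bounds for the blocks form a convergent geometric series. As \<open>h \<ge> 8 * \<sigma>\<^sup>2\<close>, half of the
  threshold \<open>h * 2 ^ i / 2\<close> absorbs the mean.\<close>

lemma overfit_maximal:
  assumes n: "n \<ge> n0" and h: "8 * \<sigma>\<^sup>2 \<le> h"
  shows "\<exists>N\<in>sets \<Omega>. prob N \<le> 64 * var_const / h\<^sup>2 \<and> (\<forall>\<omega>\<in>space \<Omega> - N. \<forall>m. T n < m \<longrightarrow> m \<le> M n \<longrightarrow>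
     2 * F n m \<omega> \<le> h * (real (k n m) - kT n))"
proof -
  have hpos: "h > 0" using h sigma_pos by linarith
  define q where "q m = real (k n m) - kT n" for m
  define I where "I i = {m \<in> {T n<..M n}. q m \<le> 2 ^ Suc i}" for i
  define top where "top i = Max (I i)" for i
  define Bad where "Bad i = (if I i = {} then {} else
    {\<omega> \<in> space \<Omega>. \<bar>F n (top i) \<omega> - \<sigma>\<^sup>2 * q (top i)\<bar> \<ge> h * 2 ^ i / 4})" for i
  have fin: "finite (I i)" for i by (simp add: I_def)
  have top: "top i \<in> I i" if "I i \<noteq> {}" for i unfolding top_def using fin that by (rule Max_in)
  have q_pos: "0 < q m" if "T n < m" "m \<le> M n" for m
    using K_less[OF nc[OF n], of "T n" m] that T_bounds[OF n] by (auto simp: q_def kT_def)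
  have BadM: "Bad i \<in> sets \<Omega>" for i
  proof (cases "I i = {}")
    case False
    then have "T n \<le> top i" "top i \<le> M n" using top[of i] by (auto simp: I_def)
    note [measurable] = borel_measurable_integrable[OF F_moments(1)[OF n this]]
    show ?thesis unfolding Bad_def using False by simp
  qed (simp add: Bad_def)
  have BadP: "prob (Bad i) \<le> 32 * var_const / h\<^sup>2 * (1 / 2) ^ i" for i
  proof (cases "I i = {}")
    case True
    then show ?thesis using var_const_pos by (simp add: Bad_def)
  next
    case False
    then have t: "T n \<le> top i" "top i \<le> M n" "q (top i) \<le> 2 ^ Suc i" using top[of i] by (auto simp: I_def)
    have "prob (Bad i) \<le> var_const * q (top i) / (h * 2 ^ i / 4)\<^sup>2"
      using F_moments(4)[OF n t(1,2), of "h * 2 ^ i / 4"] hpos False by (simp add: Bad_def q_def)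
    also have "\<dots> \<le> var_const * 2 ^ Suc i / (h * 2 ^ i / 4)\<^sup>2"
      using t(3) var_const_pos by (intro divide_right_mono mult_left_mono) auto
    also have "\<dots> = 32 * var_const / h\<^sup>2 * (1 / 2) ^ i"
      using hpos by (simp add: field_simps power2_eq_square power_one_over)
    finally show ?thesis .
  qed
  define N where "N = (\<Union>i<n. Bad i)"
  have "prob N \<le> (\<Sum>i<n. prob (Bad i))"
    unfolding N_def using BadM by (intro measure_UNION_le) auto
  also have "\<dots> \<le> (\<Sum>i<n. 32 * var_const / h\<^sup>2 * (1 / 2) ^ i)" by (intro sum_mono BadP)
  also have "\<dots> = 32 * var_const / h\<^sup>2 * (\<Sum>i<n. (1 / 2) ^ i)" by (simp add: sum_distrib_left)
  also have "\<dots> \<le> 32 * var_const / h\<^sup>2 * 2"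
    using var_const_pos by (intro mult_left_mono) (auto simp: geometric_sum)
  finally have "prob N \<le> 64 * var_const / h\<^sup>2" by simp
  moreover have "N \<in> sets \<Omega>" unfolding N_def using BadM by auto
  moreover have "2 * F n m \<omega> \<le> h * q m" if \<omega>: "\<omega> \<in> space \<Omega> - N" and m: "T n < m" "m \<le> M n" for \<omega> m
  proof -
    interpret C: canonical "M n" "T n" "A n" "B n \<omega>" "E n \<omega>" by (rule canonical[OF n])
    define l where "l = k n m - k n (T n)"
    have ql: "q m = real l" using q_pos[OF m] by (simp add: l_def q_def kT_def)
    have "l \<ge> 1" using q_pos[OF m] ql by simp
    then obtain i where i: "2 ^ i \<le> l" "l < 2 ^ (i + 1)" using ex_power_ivl1[of 2 l] by auto
    have "i < 2 ^ i" by simp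
    also have "\<dots> \<le> l" by (rule i(1))
    also have "l < n" using k_bounds(5)[OF n, of m] m T_bounds[OF n] by (auto simp: l_def)
    finally have "i < n" .
    then have good: "\<omega> \<notin> Bad i" using \<omega> by (auto simp: N_def)
    have qi: "2 ^ i \<le> q m" "q m \<le> 2 ^ Suc i"
      using i unfolding ql by (metis of_nat_le_iff of_nat_power of_nat_numeral, metis Suc_eq_plus1 less_imp_le of_nat_le_iff of_nat_power of_nat_numeral)
    then have mI: "m \<in> I i" using m by (auto simp: I_def)
    then have "top i \<in> I i" using top by blast
    then have t: "T n < top i" "top i \<le> M n" "q (top i) \<le> 2 ^ Suc i" by (simp_all add: I_def)
    have "m \<le> top i" unfolding top_def using fin mI by (rule Max_ge)
    note t = t this
    have "F n m \<omega> \<le> F n (top i) \<omega>"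
      using t T_bounds[OF n] C.E_nonneg by (intro sum_mono2) auto
    also have "\<dots> < \<sigma>\<^sup>2 * q (top i) + h * 2 ^ i / 4"
      using good mI \<omega> by (auto simp: Bad_def abs_if split: if_splits)
    also have "\<dots> \<le> \<sigma>\<^sup>2 * 2 ^ Suc i + h * 2 ^ i / 4" using t(3) by (simp add: mult_left_mono)
    also have "\<dots> \<le> h * 2 ^ i / 2"
    proof -
      have "8 * \<sigma>\<^sup>2 * 2 ^ i \<le> h * 2 ^ i" using h by (rule mult_right_mono) simp
      moreover have "\<sigma>\<^sup>2 * 2 ^ Suc i = 8 * \<sigma>\<^sup>2 * 2 ^ i / 4" by simp
      ultimately show ?thesis by linarith
    qed
    also have "\<dots> \<le> h * q m / 2" using qi hpos by simp
    finally show ?thesis by simp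
  qed
  ultimately show ?thesis unfolding q_def by blast
qed

context
  fixes c1 c2 :: real
  assumes c1_pos: "0 < c1"
    and variance_estimate: "whp \<Omega> (\<lambda>n \<omega>. c1 * \<sigma>\<^sup>2 \<le> s2 n \<omega> \<and> s2 n \<omega> \<le> c2 * \<sigma>\<^sup>2)"
begin

lemma over_zero:
  assumes phi: "filterlim \<phi> at_top sequentially"
  shows "whp \<Omega> (\<lambda>n \<omega>. over n \<omega> (w_hat n \<omega>) \<le> 0)"
proof -
  define h where "h n = c1 * \<sigma>\<^sup>2 * \<phi> n" for n
  have c: "0 < c1 * \<sigma>\<^sup>2" using c1_pos sigma_pos by simp
  have h: "filterlim h at_top sequentially"
    unfolding h_def by (rule filterlim_tendsto_pos_mult_at_top[OF tendsto_const c phi])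
  have hev: "\<forall>\<^sub>F n in sequentially. 8 * \<sigma>\<^sup>2 \<le> h n" using h by (simp add: filterlim_at_top)
  define P where "P n \<omega> \<longleftrightarrow> (\<forall>m. T n < m \<longrightarrow> m \<le> M n \<longrightarrow> 2 * F n m \<omega> \<le> h n * (real (k n m) - kT n))" for n \<omega>
  define N where "N n = (SOME N. N \<in> sets \<Omega> \<and> prob N \<le> 64 * var_const / (h n)\<^sup>2 \<and> (\<forall>\<omega>\<in>space \<Omega> - N. P n \<omega>))" for n
  have "(\<lambda>n. inverse (h n)) \<longlonglongrightarrow> 0" by (rule tendsto_inverse_0_at_top[OF h])
  from tendsto_mult_right_zero[OF tendsto_mult_zero[OF this this], of "64 * var_const"]
  have lim: "(\<lambda>n. 64 * var_const / (h n)\<^sup>2) \<longlonglongrightarrow> 0"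
    by (simp add: divide_inverse power2_eq_square)
  have "whp \<Omega> P"
  proof (rule whp_eventuallyI[OF _ lim])
    show "\<forall>\<^sub>F n in sequentially. N n \<in> sets \<Omega> \<and> (\<forall>\<omega>\<in>space \<Omega> - N n. P n \<omega>) \<and> prob (N n) \<le> 64 * var_const / (h n)\<^sup>2"
      using hev eventually_ge_at_top[of n0]
    proof eventually_elim
      case (elim n)
      have "\<exists>N. N \<in> sets \<Omega> \<and> prob N \<le> 64 * var_const / (h n)\<^sup>2 \<and> (\<forall>\<omega>\<in>space \<Omega> - N. P n \<omega>)"
        using overfit_maximal[OF elim(2,1)] unfolding P_def by blast
      from someI_ex[OF this, folded N_def] show ?case by blast
    qed
  qed
  from whp_conj[OF whp_conj[OF this whp_of_eventually[OF hev]] variance_estimate] show ?thesis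
  proof (rule whp_mono[of _ n0], elim conjE)
    fix n \<omega> assume n: "n \<ge> n0" and \<omega>: "\<omega> \<in> space \<Omega>" and F: "P n \<omega>"
      and hn: "8 * \<sigma>\<^sup>2 \<le> h n" and s2: "c1 * \<sigma>\<^sup>2 \<le> s2 n \<omega>"
    interpret C: canonical "M n" "T n" "A n" "B n \<omega>" "E n \<omega>" by (rule canonical[OF n])
    have "0 < h n" using hn sigma_pos by linarith
    then have phi: "0 \<le> \<phi> n" using c by (simp add: h_def zero_less_mult_iff)
    have le: "h n \<le> \<phi> n * s2 n \<omega>" using mult_left_mono[OF s2 phi] by (simp add: h_def mult.commute)
    have psi: "0 \<le> \<phi> n * s2 n \<omega>" using le \<open>0 < h n\<close> by simp
    show "over n \<omega> (w_hat n \<omega>) \<le> 0"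
    proof (rule C.minimiser_overfit[where d = "kinc (k n)", OF kinc_nonneg[OF n] psi w_hat_props[OF n \<omega>]])
      fix m assume m: "T n < m" "m \<le> M n"
      have d: "(\<Sum>j=Suc (T n)..m. kinc (k n) j) = real (k n m) - kT n"
        using sum_kinc_between[OF n, of "T n" m] m T_bounds[OF n] by (simp add: kT_def)
      have "0 \<le> real (k n m) - kT n"
        using K_less[OF nc[OF n], of "T n" m] m T_bounds[OF n] by (auto simp: kT_def)
      with le have "h n * (real (k n m) - kT n) \<le> \<phi> n * s2 n \<omega> * (real (k n m) - kT n)" by (rule mult_right_mono)
      then show "2 * F n m \<omega> \<le> \<phi> n * s2 n \<omega> * (\<Sum>j=Suc (T n)..m. kinc (k n) j)"
        unfolding d using F m unfolding P_def by force
    qed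
  qed
qed

section \<open>Sufficient conditions for loss optimality\<close>

text \<open>Both positive statements reduce to this lemma; they differ only in how the overfitting part is
  controlled.\<close>

lemma loss_optimality:
  assumes kT: "filterlim kT at_top sequentially"
    and d: "(\<lambda>n. (kT n - k1 n) / (real n * sig n)) \<longlonglongrightarrow> 0"
    and pd: "(\<lambda>n. (\<phi> n)\<^sup>2 * (kT n - k1 n) / (real n * sig n)) \<longlonglongrightarrow> 0"
    and M0: "(\<lambda>n. real (M0 n) / kT n) \<longlonglongrightarrow> 0"
    and phi: "\<forall>\<^sub>F n in sequentially. 0 \<le> \<phi> n"
    and over: "\<And>c. c > 0 \<Longrightarrow> whp \<Omega> (\<lambda>n \<omega>. over n \<omega> (w_hat n \<omega>) \<le> c * kT n)"
  shows "asymp_loss_optimal \<Omega> x \<beta> e k M w_hat"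
  unfolding asymp_loss_optimal_iff
proof (rule conv_in_probI)
  fix \<epsilon> :: real assume eps: "\<epsilon> > 0"
  define \<delta> where "\<delta> = min (1 / 6) (\<epsilon> / 14)"
  have \<delta>: "0 < \<delta>" "\<delta> \<le> 1 / 6" "14 * \<delta> \<le> \<epsilon>" using eps by (auto simp: \<delta>_def)
  \<comment> \<open>the first bound serves \<open>Y_lower\<close>, the second \<open>4 * S \<le> \<delta>\<^sup>2 * Y\<close>, as \<open>Y \<ge> n * \<kappa> * sig n / 4\<close>\<close>
  define c where "c = min (\<kappa> / 8) (\<delta>\<^sup>2 * \<kappa> / 16)"
  have c: "c > 0" "c \<le> \<kappa> / 8" "c \<le> \<delta>\<^sup>2 * \<kappa> / 16" using \<delta> kappa_pos by (auto simp: c_def)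
  \<comment> \<open>since \<open>V\<close> is at least \<open>\<sigma>\<^sup>2 / 2 * kT n\<close>, a bound \<open>b * kT n\<close> is a bound \<open>\<delta> * V\<close>\<close>
  define b where "b = \<delta> * (\<sigma>\<^sup>2 / 2)"
  have b: "b > 0" using \<delta> sigma_pos by (simp add: b_def)
  define s where "s = c2 * \<sigma>\<^sup>2"
  have pd': "(\<lambda>n. 4 * s\<^sup>2 / \<kappa> * ((\<phi> n)\<^sup>2 * (kT n - k1 n) / (real n * sig n))) \<longlonglongrightarrow> 0"
    using tendsto_mult_right_zero[OF pd] .
  have "0 < \<delta>\<^sup>2 * (\<sigma>\<^sup>2 / 2)" using \<delta> sigma_pos by simp
  from order_tendstoD(2)[OF pd' this]
  have small: "\<forall>\<^sub>F n in sequentially. 4 * s\<^sup>2 / \<kappa> * ((\<phi> n)\<^sup>2 * (kT n - k1 n) / (real n * sig n)) < \<delta>\<^sup>2 * (\<sigma>\<^sup>2 / 2)" .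
  have "whp \<Omega> (\<lambda>n \<omega>. ((S n \<omega> \<le> c * (real n * sig n) \<and> \<sigma>\<^sup>2 / 2 * kT n \<le> V n \<omega>) \<and>
      (W n \<omega> \<le> b * kT n \<and> over n \<omega> (w_hat n \<omega>) \<le> b * kT n)) \<and> (c1 * \<sigma>\<^sup>2 \<le> s2 n \<omega> \<and> s2 n \<omega> \<le> c2 * \<sigma>\<^sup>2) \<and>
      0 \<le> \<phi> n \<and> 4 * s\<^sup>2 / \<kappa> * ((\<phi> n)\<^sup>2 * (kT n - k1 n) / (real n * sig n)) < \<delta>\<^sup>2 * (\<sigma>\<^sup>2 / 2))"
    by (intro whp_conj[OF whp_conj[OF whp_conj[OF S_small[OF d c(1)] V_large[OF kT]] whp_conj[OF W_small[OF M0 b] over[OF b]]]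
          whp_conj[OF variance_estimate whp_conj[OF whp_of_eventually[OF phi] whp_of_eventually[OF small]]]])
  then show "whp \<Omega> (\<lambda>n \<omega>. \<bar>ratio n \<omega> - 1\<bar> \<le> \<epsilon>)"
  proof (rule whp_mono[of _ n0], elim conjE)
    fix n \<omega> assume n: "n \<ge> n0" and \<omega>: "\<omega> \<in> space \<Omega>" and H: "S n \<omega> \<le> c * (real n * sig n)"
      "\<sigma>\<^sup>2 / 2 * kT n \<le> V n \<omega>" "W n \<omega> \<le> b * kT n" "over n \<omega> (w_hat n \<omega>) \<le> b * kT n"
      "c1 * \<sigma>\<^sup>2 \<le> s2 n \<omega>" "s2 n \<omega> \<le> c2 * \<sigma>\<^sup>2" and phin: "0 \<le> \<phi> n"
      and smalln: "4 * s\<^sup>2 / \<kappa> * ((\<phi> n)\<^sup>2 * (kT n - k1 n) / (real n * sig n)) < \<delta>\<^sup>2 * (\<sigma>\<^sup>2 / 2)"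
    interpret C: canonical "M n" "T n" "A n" "B n \<omega>" "E n \<omega>" by (rule canonical[OF n])
    have ns: "0 < real n * sig n" using sig_pos[OF n] n_pos[OF n] by simp
    have S8: "S n \<omega> \<le> \<kappa> / 8 * (real n * sig n)"
      using H(1) mult_right_mono[OF c(2), of "real n * sig n"] ns by simp
    note Y = Y_lower[OF n S8]
    have "0 < c1 * \<sigma>\<^sup>2" using c1_pos sigma_pos by simp
    then have s0: "0 \<le> s2 n \<omega>" using H(5) by simp
    note r = r2_bound[OF n \<omega> S8 phin s0 H(6)]
    have kp: "0 < kT n" "0 < kT n - k1 n" "kT n - k1 n \<le> kT n" using kT_pos[OF n] by (auto simp: k1_def)
    have "0 < \<sigma>\<^sup>2 / 2 * kT n" using kp sigma_pos by simp
    then have Vp: "0 < C.V" using H(2) by simp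
    have bV: "b * kT n \<le> \<delta> * C.V" using mult_left_mono[OF H(2), of \<delta>] \<delta> by (simp add: b_def mult.assoc)
    have "r2 n \<omega> (w_hat n \<omega>) \<le> \<delta>\<^sup>2 * (\<sigma>\<^sup>2 / 2) * (kT n - k1 n)"
      using r(2) mult_right_mono[OF less_imp_le[OF smalln], of "kT n - k1 n"] kp by (simp add: s_def)
    also have "\<dots> \<le> \<delta>\<^sup>2 * (\<sigma>\<^sup>2 / 2) * kT n" using kp by (intro mult_left_mono) auto
    also have "\<dots> \<le> \<delta>\<^sup>2 * C.V" using mult_left_mono[OF H(2), of "\<delta>\<^sup>2"] by (simp add: mult.assoc)
    finally have rV: "C.r2 (w_hat n \<omega>) \<le> \<delta>\<^sup>2 * C.V" .
    have "4 * C.S \<le> \<delta>\<^sup>2 * (real n * \<kappa> * sig n / 4)"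
      using H(1) mult_right_mono[OF c(3), of "real n * sig n"] ns by (simp add: algebra_simps)
    also have "\<dots> \<le> \<delta>\<^sup>2 * C.Y (T n)" using Y(4) by (intro mult_left_mono) auto
    finally have SY: "4 * C.S \<le> \<delta>\<^sup>2 * C.Y (T n)" .
    have "\<bar>ratio n \<omega> - 1\<bar> \<le> 14 * \<delta>" unfolding ratio_def
      using H(3,4) bV by (intro C.loss_ratio[OF w_hat_props(1)[OF n \<omega>] Vp \<delta>(1,2) rV r(1) _ _ SY Y(5)]) linarith+
    then show "\<bar>ratio n \<omega> - 1\<bar> \<le> \<epsilon>" using \<delta>(3) by simp
  qed
qed

end

section \<open>Failure of loss optimality\<close>

text \<open>On the event that the ratio is close to 1 the infimum is positive, and the excess is at most the ratio minus
  1.\<close>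

lemma optimal_imp_no_overfit:
  assumes "asymp_loss_optimal \<Omega> x \<beta> e k M w_hat"
  shows "conv_in_prob \<Omega> (\<lambda>n \<omega>. overfit_excess x n (k n) (M n) (M0 n) (error_vec e n \<omega>) (w_hat n \<omega>)) 0"
proof (rule conv_in_probI)
  fix \<epsilon> :: real assume eps: "\<epsilon> > 0"
  have ev: "\<forall>\<^sub>F n in sequentially. ratio n \<in> borel_measurable \<Omega>"
    using eventually_ge_at_top[of n0] by eventually_elim (rule ratio_measurable)
  have "whp \<Omega> (\<lambda>n \<omega>. \<bar>ratio n \<omega> - 1\<bar> \<le> min \<epsilon> (1 / 2))"
    using assms eps unfolding asymp_loss_optimal_iff by (intro conv_in_probD ev) auto
  then show "whp \<Omega> (\<lambda>n \<omega>. \<bar>overfit_excess x n (k n) (M n) (M0 n) (error_vec e n \<omega>) (w_hat n \<omega>) - 0\<bar> \<le> \<epsilon>)"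
  proof (rule whp_mono[of _ n0])
    fix n \<omega> assume n: "n0 \<le> n" and \<omega>: "\<omega> \<in> space \<Omega>" and r: "\<bar>ratio n \<omega> - 1\<bar> \<le> min \<epsilon> (1 / 2)"
    interpret C: canonical "M n" "T n" "A n" "B n \<omega>" "E n \<omega>" by (rule canonical[OF n])
    let ?w = "w_hat n \<omega>" and ?I = "INF v\<in>weights (M n). loss n \<omega> v"
    let ?G = "\<Sum>m=Suc (T n)..M n. (?w m)\<^sup>2 * F n m \<omega>"
    note w = w_hat_props(1)[OF n \<omega>]
    have "0 \<le> ?I" using w C.loss_nonneg by (intro cINF_greatest) auto
    moreover have "?I \<noteq> 0" using r unfolding ratio_def by auto
    ultimately have I: "0 < ?I" by simp
    have IV: "?I \<le> C.V" using C.loss_true_model cINF_lower[OF C.loss_bdd_below] by metis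
    have G0: "0 \<le> ?G" using C.E_nonneg by (intro sum_nonneg mult_nonneg_nonneg) auto
    have "?G \<le> loss n \<omega> ?w - ?I" using C.overfit_lower_bound[OF w] by simp
    then have "?G / C.V \<le> (loss n \<omega> ?w - ?I) / ?I" using G0 I IV by (intro frac_le) auto
    also have "\<dots> = ratio n \<omega> - 1" using I by (simp add: ratio_def field_simps)
    finally have GV: "?G / C.V \<le> \<epsilon>" "0 \<le> ?G / C.V" using r G0 I IV by auto
    have "overfit_excess x n (k n) (M n) (M0 n) (error_vec e n \<omega>) ?w = ?G / C.V"
      unfolding overfit_excess_def sum_divide_distrib eps_def[symmetric] T_def[symmetric]
    proof (intro sum.cong)
      show "{T n<..M n} = {Suc (T n)..M n}" by auto
      fix m assume "m \<in> {Suc (T n)..M n}"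
      then have m: "T n \<le> m" "m \<le> M n" "m \<in> {1..M n}" "T n \<in> {1..M n}" using T_bounds[OF n] by auto
      have "eps n \<omega> \<bullet> ((proj x n (k n) m - proj x n (k n) (T n)) *\<^sub>v eps n \<omega>) =
          eps n \<omega> \<bullet> (proj x n (k n) m *\<^sub>v eps n \<omega>) - C.V"
        unfolding V_form[OF n]
        by (rule diff_form[OF proj_carrier[OF nc[OF n] m(3)] proj_carrier[OF nc[OF n] m(4)]]) simp_all
      then show "(?w m)\<^sup>2 * (eps n \<omega> \<bullet> (proj x n (k n) m *\<^sub>v eps n \<omega>) / (eps n \<omega> \<bullet> (proj x n (k n) (T n) *\<^sub>v eps n \<omega>)) - 1) =
          (?w m)\<^sup>2 * F n m \<omega> / C.V"
        unfolding V_form[OF n, symmetric] F_form[OF n m(1,2)] using I IV by (simp add: diff_divide_distrib right_diff_distrib)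
    qed
    then show "\<bar>overfit_excess x n (k n) (M n) (M0 n) (error_vec e n \<omega>) ?w - 0\<bar> \<le> \<epsilon>" using GV by simp
  qed
qed

end

context model
begin

text \<open>On \<open>U n\<close> the cross term \<open>B n \<omega> (T n)\<close> is at least \<open>c * sqrt (A n (T n))\<close> and \<open>V\<close> is at most \<open>b\<close>. There, mixing in
  model \<open>M0\<close> gains at least \<open>c\<^sup>2 / 4\<close>, while the selected weights gain at most \<open>c\<^sup>2 / 8\<close>.\<close>

lemma fixed_model_not_optimal:
  assumes c1_pos: "0 < c1"
    and variance_estimate: "whp \<Omega> (\<lambda>n \<omega>. c1 * \<sigma>\<^sup>2 \<le> s2 n \<omega> \<and> s2 n \<omega> \<le> c2 * \<sigma>\<^sup>2)"
    and fixed: "true_model_fixed n0 \<beta> k M0"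
    and phi_n: "(\<lambda>n. (\<phi> n)\<^sup>2 / real n) \<longlonglongrightarrow> 0"
    and phi: "\<forall>\<^sub>F n in sequentially. 0 \<le> \<phi> n"
  shows "\<not> asymp_loss_optimal \<Omega> x \<beta> e k M w_hat"
proof
  assume "asymp_loss_optimal \<Omega> x \<beta> e k M w_hat"
  then have opt: "conv_in_prob \<Omega> ratio 1" unfolding asymp_loss_optimal_iff .
  have const: "T n = T n0" "kT n = kT n0" "k1 n = k1 n0" "sig n = sig n0" if n: "n \<ge> n0" for n
  proof -
    have f: "M0 n = M0 n0" "\<And>m. m \<in> {1..M0 n0 + 1} \<Longrightarrow> k n m = k n0 m"
      "\<And>j. j \<in> {1..k n0 (M0 n0 + 1)} \<Longrightarrow> \<beta> n j = \<beta> n0 j"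
      using fixed n unfolding true_model_fixed_def by blast+
    show T: "T n = T n0" using f(1) by (simp add: T_def)
    show "kT n = kT n0" "k1 n = k1 n0" using f(2) T by (auto simp: kT_def k1_def T_def)
    have "k n (M0 n) = k n0 (M0 n0)" using f(1,2) T_bounds(3)[OF order_refl] by auto
    moreover have "k n (T n) = k n0 (T n0)" using f(2) T by (auto simp: T_def)
    ultimately show "sig n = sig n0" unfolding sig_sum[OF n] sig_sum[OF order_refl]
      by (intro sum.cong arg_cong[where f = "\<lambda>z. z\<^sup>2"] f(3)) (auto simp: T_def)
  qed
  define D where "D = kT n0 - k1 n0"
  have pos: "0 < kT n0" "0 < D" "0 < sig n0" using kT_pos[OF order_refl] sig_pos[OF order_refl] by (auto simp: D_def)
  have d: "(\<lambda>n. (kT n - k1 n) / (real n * sig n)) \<longlonglongrightarrow> 0"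
  proof (rule Lim_transform_eventually)
    show "(\<lambda>n. D / sig n0 * (1 / real n)) \<longlonglongrightarrow> 0"
      by (intro tendsto_mult_right_zero lim_1_over_n)
    show "\<forall>\<^sub>F n in sequentially. D / sig n0 * (1 / real n) = (kT n - k1 n) / (real n * sig n)"
      using eventually_ge_at_top[of n0]
    proof eventually_elim
      case (elim n)
      show ?case unfolding const[OF elim] D_def by simp
    qed
  qed
  obtain c \<delta> where c: "c > 0" and \<delta>: "\<delta> > 0"
    and lin: "\<And>n a. (\<Sum>i<n. (a i)\<^sup>2) = 1 \<Longrightarrow> \<delta> \<le> prob {\<omega> \<in> space \<Omega>. (\<Sum>i<n. a i * e (Suc i) \<omega>) \<ge> c}"
    using linear_form_positive_probability by blast
  \<comment> \<open>by Markov's inequality, \<open>V\<close> exceeds \<open>b\<close> with probability at most \<open>\<delta> / 2\<close>\<close>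
  define b where "b = 2 * \<sigma>\<^sup>2 * kT n0 / \<delta>"
  have b: "b > 0" using pos sigma_pos \<delta> by (simp add: b_def)
  \<comment> \<open>if \<open>r2 \<le> s\<^sup>2\<close> and \<open>V \<le> b\<close>, then the loss is at least \<open>V - s\<^sup>2 - 2 * s * sqrt b \<ge> V - c\<^sup>2 / 8\<close>\<close>
  define s where "s = min 1 (c\<^sup>2 / (8 * (1 + 2 * sqrt b)))"
  have s: "0 < s" "s \<le> 1" "s * (1 + 2 * sqrt b) \<le> c\<^sup>2 / 8"
  proof -
    have p: "0 < 1 + 2 * sqrt b" using b by (simp add: add_pos_pos)
    show "0 < s" "s \<le> 1" using c p by (auto simp: s_def)
    have "s \<le> c\<^sup>2 / (8 * (1 + 2 * sqrt b))" by (simp add: s_def)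
    then show "s * (1 + 2 * sqrt b) \<le> c\<^sup>2 / 8" using p by (simp add: field_simps)
  qed
  define U where "U n = {\<omega> \<in> space \<Omega>. c * sqrt (A n (T n)) \<le> B n \<omega> (T n)} \<inter> {\<omega> \<in> space \<Omega>. V n \<omega> \<le> b}" for n
  have Upos: "\<forall>\<^sub>F n in sequentially. U n \<in> sets \<Omega> \<and> \<delta> / 2 \<le> prob (U n)"
    using eventually_ge_at_top[of n0]
  proof eventually_elim
    case (elim n)
    have T: "T n \<in> {1..M n}" using T_bounds[OF elim] by auto
    note [measurable] = B_measurable[OF elim T] borel_measurable_integrable[OF V_moments(1)[OF elim]]
    obtain a where a: "\<And>\<omega>. B n \<omega> (T n) = (\<Sum>i<n. a i * e (Suc i) \<omega>)" "(\<Sum>i<n. (a i)\<^sup>2) = A n (T n)"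
      using B_linear[OF elim T] by blast
    have "0 < real n * \<kappa> * sig n" using n_pos[OF elim] kappa_pos sig_pos[OF elim] by simp
    then have A: "0 < A n (T n)" using signal_bound(1)[OF elim] by simp
    let ?G = "{\<omega> \<in> space \<Omega>. c * sqrt (A n (T n)) \<le> B n \<omega> (T n)}" and ?H = "{\<omega> \<in> space \<Omega>. V n \<omega> \<ge> b}"
    have "\<delta> \<le> prob {\<omega> \<in> space \<Omega>. (\<Sum>i<n. a i / sqrt (A n (T n)) * e (Suc i) \<omega>) \<ge> c}"
    proof (rule lin)
      have "(\<Sum>i<n. (a i / sqrt (A n (T n)))\<^sup>2) = (\<Sum>i<n. (a i)\<^sup>2) / A n (T n)"
        using A by (simp add: power_divide sum_divide_distrib)
      then show "(\<Sum>i<n. (a i / sqrt (A n (T n)))\<^sup>2) = 1" using a(2) A by simp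
    qed
    also have "{\<omega> \<in> space \<Omega>. (\<Sum>i<n. a i / sqrt (A n (T n)) * e (Suc i) \<omega>) \<ge> c} = ?G"
    proof -
      have "(\<Sum>i<n. a i / sqrt (A n (T n)) * e (Suc i) \<omega>) = B n \<omega> (T n) / sqrt (A n (T n))" for \<omega>
        by (simp add: a(1) sum_divide_distrib)
      then show ?thesis using A by (simp add: pos_le_divide_eq)
    qed
    finally have G: "\<delta> \<le> prob ?G" .
    have "prob ?H \<le> (\<integral>\<omega>. V n \<omega> \<partial>\<Omega>) / b"
      using V_moments(1)[OF elim] canonical.V_nonneg[OF canonical[OF elim]] b
      by (intro integral_Markov_inequality_measure[of _ _ "{}"]) auto
    also have "\<dots> = \<delta> / 2" unfolding V_moments(2)[OF elim] const(2)[OF elim] b_def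
      using pos sigma_pos \<delta> by (simp add: field_simps)
    finally have H: "prob ?H \<le> \<delta> / 2" .
    have meas: "U n \<in> sets \<Omega>" "?H \<in> sets \<Omega>" unfolding U_def by measurable
    have "?G \<subseteq> U n \<union> ?H" by (auto simp: U_def)
    then have "prob ?G \<le> prob (U n \<union> ?H)" using meas by (intro finite_measure_mono) auto
    also have "\<dots> \<le> prob (U n) + prob ?H" using meas by (intro measure_Un_le)
    finally show ?case using G H meas by auto
  qed
  define \<epsilon> where "\<epsilon> = min (1 / 2) (c\<^sup>2 / (16 * b))"
  have \<epsilon>: "\<epsilon> > 0" "\<epsilon> \<le> 1 / 2" "\<epsilon> \<le> c\<^sup>2 / (16 * b)" using c b by (auto simp: \<epsilon>_def)
  have ev: "\<forall>\<^sub>F n in sequentially. ratio n \<in> borel_measurable \<Omega>"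
    using eventually_ge_at_top[of n0] by eventually_elim (rule ratio_measurable)
  have P: "whp \<Omega> (\<lambda>n \<omega>. (\<bar>ratio n \<omega> - 1\<bar> \<le> \<epsilon> \<and> S n \<omega> \<le> \<kappa> / 8 * (real n * sig n)) \<and>
      (c1 * \<sigma>\<^sup>2 \<le> s2 n \<omega> \<and> s2 n \<omega> \<le> c2 * \<sigma>\<^sup>2))"
    by (intro whp_conj conv_in_probD[OF opt \<epsilon>(1) ev] S_small[OF d] variance_estimate) (use kappa_pos in simp)
  define C where "C = 4 * (c2 * \<sigma>\<^sup>2)\<^sup>2 / \<kappa> * D * D / sig n0"
  have "(\<lambda>n. C * ((\<phi> n)\<^sup>2 / real n)) \<longlonglongrightarrow> 0" by (rule tendsto_mult_right_zero[OF phi_n])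
  then have small: "\<forall>\<^sub>F n in sequentially. C * ((\<phi> n)\<^sup>2 / real n) < s\<^sup>2"
    by (rule order_tendstoD(2)) (use s in simp)
  have "\<forall>\<^sub>F n in sequentially. False"
    using whp_meets[OF P half_gt_zero[OF \<delta>] Upos] small phi eventually_ge_at_top[of n0]
  proof eventually_elim
    case (elim n)
    note n = elim(4)
    obtain \<omega> where U: "\<omega> \<in> U n" and H: "\<bar>ratio n \<omega> - 1\<bar> \<le> \<epsilon>" "S n \<omega> \<le> \<kappa> / 8 * (real n * sig n)"
      "c1 * \<sigma>\<^sup>2 \<le> s2 n \<omega>" "s2 n \<omega> \<le> c2 * \<sigma>\<^sup>2"
      using elim(1) by blast
    have \<omega>: "\<omega> \<in> space \<Omega>" and BA: "c * sqrt (A n (T n)) \<le> B n \<omega> (T n)" and Vb: "V n \<omega> \<le> b"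
      using U by (auto simp: U_def)
    interpret C: canonical "M n" "T n" "A n" "B n \<omega>" "E n \<omega>" by (rule canonical[OF n])
    let ?w = "w_hat n \<omega>" and ?I = "INF v\<in>weights (M n). loss n \<omega> v"
    note Y = Y_lower[OF n H(2)]
    have "0 < c1 * \<sigma>\<^sup>2" using c1_pos sigma_pos by simp
    then have s0: "0 \<le> s2 n \<omega>" using H(3) by simp
    note r = r2_bound[OF n \<omega> H(2) elim(3) s0 H(4)]
    have "C.r2 ?w \<le> C * ((\<phi> n)\<^sup>2 / real n)"
      using r(2) unfolding C_def const[OF n] D_def[symmetric] by (simp add: field_simps)
    then have r2s: "C.r2 ?w \<le> s\<^sup>2" using elim(2) by simp
    then have "sqrt (C.r2 ?w) \<le> s" using s(1) by (simp add: real_le_lsqrt)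
    moreover have "sqrt C.V \<le> sqrt b" using Vb by simp
    ultimately have "sqrt (C.r2 ?w) * sqrt C.V \<le> s * sqrt b"
      using s(1) C.V_nonneg by (intro mult_mono) auto
    moreover have "s\<^sup>2 \<le> s" using s(1,2) by (simp add: power2_eq_square mult_left_le)
    ultimately have "C.V - c\<^sup>2 / 8 \<le> C.under ?w"
      using C.under_deviation[of ?w] r2s s(3) by (simp add: algebra_simps)
    then have low: "C.V - c\<^sup>2 / 8 \<le> loss n \<omega> ?w" using C.loss_split[of ?w] C.over_nonneg[of ?w] by simp
    have E0: "0 \<le> E n \<omega> (T n)" using C.E_nonneg[of "T n"] T_bounds[OF n] by simp
    have cA: "0 < c * sqrt (A n (T n))" using c Y(1) by simp
    then have B0: "0 < B n \<omega> (T n)" using BA by simp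
    have CT: "c * sqrt (A n (T n)) \<le> C.C (T n)" using BA E0 by (simp add: C.C_def)
    have CY: "C.C (T n) \<le> C.Y (T n)" using B0 Y(1) by (simp add: C.C_def C.Y_def)
    obtain v where v: "v \<in> weights (M n)" "loss n \<omega> v = C.V - (C.C (T n))\<^sup>2 / C.Y (T n)"
      using C.loss_shrunk[OF _ CY Y(5)] CT cA by auto
    have "c\<^sup>2 / 4 \<le> (C.C (T n))\<^sup>2 / C.Y (T n)"
    proof -
      have "C.Y (T n) \<le> 4 * A n (T n)" using C.Y_T_upper Y(1,2) by simp
      moreover have "c\<^sup>2 * A n (T n) \<le> (C.C (T n))\<^sup>2"
        using power_mono[OF CT less_imp_le[OF cA], of 2] Y(1) by (simp add: power_mult_distrib)
      ultimately have "c\<^sup>2 * A n (T n) / (4 * A n (T n)) \<le> (C.C (T n))\<^sup>2 / C.Y (T n)"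
        using Y(5) by (intro frac_le) auto
      then show ?thesis using Y(1) by simp
    qed
    then have I: "?I \<le> C.V - c\<^sup>2 / 4" using cINF_lower[OF C.loss_bdd_below v(1)] v(2) by linarith
    have "0 \<le> ?I" using v(1) C.loss_nonneg by (intro cINF_greatest) auto
    moreover have "?I \<noteq> 0"
    proof
      assume "?I = 0"
      then have "ratio n \<omega> = 0" unfolding ratio_def by simp
      then show False using H(1) \<epsilon>(2) by simp
    qed
    ultimately have I0: "0 < ?I" by simp
    have "c\<^sup>2 / 8 / b \<le> (loss n \<omega> ?w - ?I) / ?I"
      using I I0 low Vb zero_le_power2[of c] by (intro frac_le) linarith+
    also have "\<dots> = ratio n \<omega> - 1" using I0 by (simp add: ratio_def field_simps)
    also have "\<dots> \<le> c\<^sup>2 / (16 * b)" using H(1) \<epsilon>(3) by linarith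
    finally have "c\<^sup>2 / 8 / b \<le> c\<^sup>2 / (16 * b)" .
    then show False using c b by (simp add: field_simps)
  qed
  then show False by simp
qed

section \<open>The theorem\<close>

text \<open>The signal is bounded because \<open>n * \<kappa> * sig n \<le> A n (T n) \<le> \<parallel>\<mu>\<parallel>\<^sup>2\<close>.\<close>

lemma signal_bounded:
  assumes "(\<lambda>n. sq_norm2 (mean_vec x n (\<beta> n)) / real n) \<in> O(\<lambda>_. 1)"
  obtains H where "\<forall>\<^sub>F n in sequentially. sig n \<le> H"
proof -
  obtain c where c: "\<forall>\<^sub>F n in sequentially. norm (sq_norm2 (mean_vec x n (\<beta> n)) / real n) \<le> c * norm (1::real)"
    using landau_o.bigE[OF assms] by blast
  have "\<forall>\<^sub>F n in sequentially. sig n \<le> c / \<kappa>"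
    using c eventually_ge_at_top[of n0]
  proof eventually_elim
    case (elim n)
    have A0: "0 \<le> A n j" if "j \<in> {1..M n}" for j
      using canonical.A_nonneg[OF canonical[OF elim(2)]] that by auto
    have "A n (T n) \<le> (\<Sum>j=1..M n. A n j)"
      using A0 T_bounds[OF elim(2)] by (intro member_le_sum) auto
    then have "real n * \<kappa> * sig n \<le> sq_norm2 (mean_vec x n (\<beta> n))"
      using signal_bound(1)[OF elim(2)] sum_A[OF elim(2)] by (simp add: sq_norm2_def mu_def)
    moreover have "sq_norm2 (mean_vec x n (\<beta> n)) \<le> c * real n"
      using elim(1) n_pos[OF elim(2)] by (simp add: pos_divide_le_eq abs_le_iff)
    ultimately have "real n * (\<kappa> * sig n) \<le> real n * c" by (simp add: algebra_simps)
    then have "\<kappa> * sig n \<le> c" using n_pos[OF elim(2)] by simp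
    then show ?case using kappa_pos by (simp add: field_simps)
  qed
  then show thesis using that by blast
qed

lemma relative_number_of_models:
  assumes C1: "(\<lambda>n. sq_norm2 (mean_vec x n (\<beta> n)) / real n) \<in> O(\<lambda>_. 1)"
    and M0: "(\<lambda>n. real (M0 n) / (kT n * sig n)) \<longlonglongrightarrow> 0"
  shows "(\<lambda>n. real (M0 n) / kT n) \<longlonglongrightarrow> 0"
proof -
  obtain H where H: "\<forall>\<^sub>F n in sequentially. sig n \<le> H" using signal_bounded[OF C1] by blast
  have "(\<lambda>n. H * (real (M0 n) / (kT n * sig n))) \<longlonglongrightarrow> 0" by (rule tendsto_mult_right_zero[OF M0])
  then show ?thesis
  proof (rule Lim_null_comparison[rotated])
    show "\<forall>\<^sub>F n in sequentially. norm (real (M0 n) / kT n) \<le> H * (real (M0 n) / (kT n * sig n))"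
      using H eventually_ge_at_top[of n0]
    proof eventually_elim
      case (elim n)
      have p: "0 < kT n" "0 < sig n" using kT_pos sig_pos elim by auto
      have "norm (real (M0 n) / kT n) = sig n * (real (M0 n) / (kT n * sig n))" using p by simp
      also have "\<dots> \<le> H * (real (M0 n) / (kT n * sig n))" using elim(1) p by (intro mult_right_mono) auto
      finally show ?case .
    qed
  qed
qed

end

theorem theorem1:
  fixes \<Omega> :: "'a measure"
    and x :: "nat \<Rightarrow> nat \<Rightarrow> real"
    and \<beta> :: "nat \<Rightarrow> nat \<Rightarrow> real"
    and e :: "nat \<Rightarrow> 'a \<Rightarrow> real"
    and \<sigma> :: real
    and k :: "nat \<Rightarrow> nat \<Rightarrow> nat"
    and M M0 :: "nat \<Rightarrow> nat"
    and \<phi> :: "nat \<Rightarrow> real"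
    and w_hat :: "nat \<Rightarrow> 'a \<Rightarrow> nat \<Rightarrow> real"
    and n0 :: nat
  assumes prob: "prob_space \<Omega>"
    and errors: "iid_errors \<Omega> e \<sigma>"
    and candidates: "\<And>n. n \<ge> n0 \<Longrightarrow> nested_candidates x n (k n) (M n)"
    and truth: "\<And>n. n \<ge> n0 \<Longrightarrow> true_model (\<beta> n) (k n) (M n) (M0 n)"
    and argmin: "\<And>n. n \<ge> n0 \<Longrightarrow>
      selected_weights \<Omega> x n (k n) (M n) (\<phi> n) (response x \<beta> e n) (w_hat n)"
    and C1: "(\<lambda>n. sq_norm2 (mean_vec x n (\<beta> n)) / real n) \<in> O(\<lambda>_. 1)"
    and C2: "\<exists>\<kappa>0>0. \<forall>n\<ge>n0. lambda_min (gram x n (k n (M0 n + 1))) \<ge> \<kappa>0"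
    and C3: "\<exists>c1 c2. 0 < c1 \<and> c1 < c2 \<and>
      (\<lambda>n. measure \<Omega> {\<omega> \<in> space \<Omega>.
         sigma_hat_sq x n (k n) (M n) (response x \<beta> e n \<omega>) / \<sigma>\<^sup>2 \<in> {c1..c2}}) \<longlonglongrightarrow> 1"
    and C4: "true_model_fixed n0 \<beta> k M0 \<Longrightarrow> design_clt \<Omega> x e \<sigma> (k n0 (M0 n0 + 1))"
  shows
    "(filterlim \<phi> at_top sequentially \<longrightarrow>
        (true_model_fixed n0 \<beta> k M0 \<and>
         (\<lambda>n. (\<phi> n)\<^sup>2 / real n) \<longlonglongrightarrow> 0
           \<longrightarrow> \<not> asymp_loss_optimal \<Omega> x \<beta> e k M w_hat) \<and>
        (filterlim (\<lambda>n. k n (M0 n + 1)) at_top sequentially \<and>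
         (\<lambda>n. (\<phi> n)\<^sup>2 * (real (k n (M0 n + 1)) - real (k n 1))
                / (real n * signal (\<beta> n) (k n) (M0 n))) \<longlonglongrightarrow> 0 \<and>
         (\<lambda>n. real (M0 n) / (real (k n (M0 n + 1)) * signal (\<beta> n) (k n) (M0 n))) \<longlonglongrightarrow> 0
           \<longrightarrow> asymp_loss_optimal \<Omega> x \<beta> e k M w_hat)) \<and>
     ((\<forall>n\<ge>n0. \<phi> n = 2) \<longrightarrow>
        ((\<lambda>n. (real (k n (M0 n + 1)) - real (k n 1))
                / (real n * signal (\<beta> n) (k n) (M0 n))) \<longlonglongrightarrow> 0 \<and>
         (\<lambda>n. real (M0 n) / (real n * (signal (\<beta> n) (k n) (M0 n))\<^sup>2)) \<longlonglongrightarrow> 0 \<and>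
         \<not> conv_in_prob \<Omega>
             (\<lambda>n \<omega>. overfit_excess x n (k n) (M n) (M0 n) (error_vec e n \<omega>) (w_hat n \<omega>)) 0
           \<longrightarrow> \<not> asymp_loss_optimal \<Omega> x \<beta> e k M w_hat) \<and>
        (filterlim (\<lambda>n. k n (M0 n + 1)) at_top sequentially \<and>
         (\<lambda>n. (real (k n (M0 n + 1)) - real (k n 1))
                / (real n * signal (\<beta> n) (k n) (M0 n))) \<longlonglongrightarrow> 0 \<and>
         (\<lambda>n. real (M0 n) / (real (k n (M0 n + 1)) * signal (\<beta> n) (k n) (M0 n))) \<longlonglongrightarrow> 0 \<and>
         (\<lambda>n. real (k n (M n)) / real (k n (M0 n + 1))) \<longlonglongrightarrow> 1
           \<longrightarrow> asymp_loss_optimal \<Omega> x \<beta> e k M w_hat))"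
proof -
  obtain \<kappa> where \<kappa>: "\<kappa> > 0" "\<And>n. n \<ge> n0 \<Longrightarrow> \<kappa> \<le> lambda_min (gram x n (k n (M0 n + 1)))"
    using C2 by blast
  interpret prob_space \<Omega> by (rule prob)
  interpret model \<Omega> e \<sigma> x \<beta> k M M0 \<phi> w_hat n0 \<kappa>
    by unfold_locales (fact errors candidates truth argmin \<kappa>)+
  note fold = sig_def[symmetric] kT_def[unfolded T_def, symmetric] k1_def[symmetric]
  obtain c1 c2 where c: "0 < c1" and lim: "(\<lambda>n. prob {\<omega> \<in> space \<Omega>.
      sigma_hat_sq x n (k n) (M n) (response x \<beta> e n \<omega>) / \<sigma>\<^sup>2 \<in> {c1..c2}}) \<longlonglongrightarrow> 1"
    using C3 by blast
  have var: "whp \<Omega> (\<lambda>n \<omega>. c1 * \<sigma>\<^sup>2 \<le> s2 n \<omega> \<and> s2 n \<omega> \<le> c2 * \<sigma>\<^sup>2)"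
    by (rule whp_mono[OF whp_of_prob_tendsto_1[OF lim], of 0])
      (use sigma_pos in \<open>auto simp: s2_def pos_le_divide_eq pos_divide_le_eq\<close>)
  have kT_top: "filterlim kT at_top sequentially" if "filterlim (\<lambda>n. k n (M0 n + 1)) at_top sequentially"
    unfolding kT_def T_def using that by (rule filterlim_compose[OF filterlim_real_sequentially])
  have part1: "\<not> asymp_loss_optimal \<Omega> x \<beta> e k M w_hat"
    if "filterlim \<phi> at_top sequentially" "true_model_fixed n0 \<beta> k M0" "(\<lambda>n. (\<phi> n)\<^sup>2 / real n) \<longlonglongrightarrow> 0"
    using that by (intro fixed_model_not_optimal[OF c var]) (auto simp: filterlim_at_top)
  have part2: "asymp_loss_optimal \<Omega> x \<beta> e k M w_hat"
    if phi: "filterlim \<phi> at_top sequentially" and k: "filterlim (\<lambda>n. k n (M0 n + 1)) at_top sequentially"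
      and pd: "(\<lambda>n. (\<phi> n)\<^sup>2 * (kT n - k1 n) / (real n * sig n)) \<longlonglongrightarrow> 0"
      and m: "(\<lambda>n. real (M0 n) / (kT n * sig n)) \<longlonglongrightarrow> 0"
  proof (rule loss_optimality[OF c var kT_top[OF k] _ pd relative_number_of_models[OF C1 m]])
    show "\<forall>\<^sub>F n in sequentially. 0 \<le> \<phi> n" using phi by (simp add: filterlim_at_top)
    have phi1: "\<forall>\<^sub>F n in sequentially. 1 \<le> \<phi> n" using phi by (simp add: filterlim_at_top)
    show "(\<lambda>n. (kT n - k1 n) / (real n * sig n)) \<longlonglongrightarrow> 0"
    proof (rule Lim_null_comparison[OF _ pd])
      show "\<forall>\<^sub>F n in sequentially. norm ((kT n - k1 n) / (real n * sig n)) \<le> (\<phi> n)\<^sup>2 * (kT n - k1 n) / (real n * sig n)"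
        using phi1 eventually_ge_at_top[of n0]
      proof eventually_elim
        case (elim n)
        have p: "0 \<le> (kT n - k1 n) / (real n * sig n)"
          using kT_pos[OF elim(2)] sig_pos[OF elim(2)] by (intro divide_nonneg_nonneg) auto
        have "1 \<le> (\<phi> n)\<^sup>2" using elim(1) by (simp add: one_le_power)
        then show ?case using mult_right_mono[OF _ p, of 1 "(\<phi> n)\<^sup>2"] p by simp
      qed
    qed
    fix b :: real assume "b > 0"
    show "whp \<Omega> (\<lambda>n \<omega>. canonical.over (M n) (T n) (E n \<omega>) (w_hat n \<omega>) \<le> b * kT n)"
      by (rule whp_mono[OF over_zero[OF c var phi], of 0]) (use \<open>b > 0\<close> in \<open>auto simp: kT_def elim: order.trans\<close>)
  qed
  have part3: "asymp_loss_optimal \<Omega> x \<beta> e k M w_hat"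
    if phi: "\<forall>n\<ge>n0. \<phi> n = 2" and k: "filterlim (\<lambda>n. k n (M0 n + 1)) at_top sequentially"
      and d: "(\<lambda>n. (kT n - k1 n) / (real n * sig n)) \<longlonglongrightarrow> 0"
      and m: "(\<lambda>n. real (M0 n) / (kT n * sig n)) \<longlonglongrightarrow> 0"
      and kM: "(\<lambda>n. real (k n (M n)) / kT n) \<longlonglongrightarrow> 1"
  proof (rule loss_optimality[OF c var kT_top[OF k] d _ relative_number_of_models[OF C1 m] _ over_small[OF kM]])
    show "\<forall>\<^sub>F n in sequentially. 0 \<le> \<phi> n"
      using eventually_ge_at_top[of n0] by eventually_elim (use phi in simp)
    show "(\<lambda>n. (\<phi> n)\<^sup>2 * (kT n - k1 n) / (real n * sig n)) \<longlonglongrightarrow> 0"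
    proof (rule Lim_transform_eventually[OF tendsto_mult_right_zero[OF d, of 4]])
      show "\<forall>\<^sub>F n in sequentially. 4 * ((kT n - k1 n) / (real n * sig n)) = (\<phi> n)\<^sup>2 * (kT n - k1 n) / (real n * sig n)"
        using eventually_ge_at_top[of n0] by eventually_elim (use phi in simp)
    qed
  qed
  show ?thesis
    unfolding fold
  proof (intro conjI impI, goal_cases)
    case 1
    then show ?case by (intro part1) simp_all
  next
    case 2
    then show ?case by (intro part2) simp_all
  next
    case 3
    then show ?case using optimal_imp_no_overfit by blast
  next
    case 4
    then show ?case by (intro part3) simp_all
  qed
qed

end
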